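(* Assume the Setup. Let $(T,o)$ be a valid finite rooted tree of height $r$. Let $\mathcal T_n$ be a sample of $\mathbb P^H$ and $v_n\in V_n$ uniformly random, independent of $\mathcal T_n$. Then \[\lim_{n\to\infty}\mathbb P\big(B_{\mathcal T_n}(v_n,r)\cong (T,o)\big)=\frac{e^{-k|I(T)|}(k!)^{|U(T)|}\,m(I(T),T)}{|\mathrm{Aut}(T,o)|}.\]
   Context: Setup. $k\ge 1$ is a fixed integer and $d=d(n)$ is a sequence of positive integers with $d(n)\to\infty$. For each $n$, $G=G_n=(V,U,E)$ is a finite simple bipartite graph with parts $V=V_n$, $|V|=n$, and $U=U_n$, $|U|=m$, and edge set $E$, which is $C_4$-free (any two distinct vertices have at most one common neighbour) and $(d,k+1)$-bi-regular (every $v\in V$ has degree $d$ and every $u\in U$ has degree $k+1$). $B=B_n$ is a signed adjacency matrix of $G$: the real $V\times U$ matrix with $B_{v,u}\in\{1,-1\}$ if $vu\in E$ and $B_{v,u}=0$ otherwise. $H\subset\mathbb R^U$ is the row space of $B$ and $P_H$ the orthogonal projection onto $H$, viewed as a $U\times U$ matrix. The determinantal measure $\mathbb P^H$ is the probability measure on subsets $\mathcal S\subset U$ of size $\operatorname{rank}B$ given by $\mathbb P^H(\mathcal S)=\det(P_H|_{\mathcal S})$, where $P_H|_{\mathcal S}$ is the principal submatrix with rows and columns indexed by $\mathcal S$. For $\mathcal S\subset U$, $G[\mathcal S]$ denotes the subgraph of $G$ induced by $\mathcal S\cup N_G(\mathcal S)$. For $v\in V$ and an integer $r\ge 0$, $B_{\mathcal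 S}(v,r)$ denotes the rooted ball of radius $r$ around $v$ in $G[\mathcal S]$ (rooted at $v$; it is just $\{v\}$ if $v$ has no neighbour in $\mathcal S$). Trees. For a finite rooted tree $(T,o)$, the height of a vertex is its distance from $o$ and the height of $T$ is the maximal height of a vertex. Vertices of even (odd) height are called even (odd); $V(T)$ and $U(T)$ denote the sets of even and odd vertices. $(T,o)$ is valid if its height is even and every odd vertex has degree exactly $k+1$ in $T$. $I(T)\subset V(T)$ is the set of even vertices of height strictly smaller than the height of $T$. For $K\subset V(T)$, $m(K,T)$ is the number of matchings of $T$ in which every vertex of $K\cup U(T)$ is saturated. $\mathrm{Aut}(T,o)$ is the group of root-preserving automorphisms and $\cong$ denotes root-preserving isomorphism. *)

theory Defs
  imports "HOL-Analysis.Analysis"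
begin

definition setup_graph ::
  "nat \<Rightarrow> nat \<Rightarrow> nat \<Rightarrow> 'a set \<Rightarrow> 'b set \<Rightarrow> ('a \<times> 'b) set \<Rightarrow> ('a \<Rightarrow> 'b \<Rightarrow> real) \<Rightarrow> bool"
  where
  "setup_graph k d n V U E B \<longleftrightarrow>
     finite V \<and> finite U \<and> card V = n \<and> E \<subseteq> V \<times> U \<and>
     \<comment> \<open>(d, k+1)-bi-regular\<close>
     (\<forall>v\<in>V. card {u\<in>U. (v,u) \<in> E} = d) \<and>
     (\<forall>u\<in>U. card {v\<in>V. (v,u) \<in> E} = k + 1) \<and>
     \<comment> \<open>C4-free: distinct vertices have at most one common neighbour\<close>
     (\<forall>v1\<in>V. \<forall>v2\<in>V. v1 \<noteq> v2 \<longrightarrow> card {u\<in>U. (v1,u) \<in> E \<and> (v2,u) \<in> E} \<le> 1) \<and>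
     (\<forall>u1\<in>U. \<forall>u2\<in>U. u1 \<noteq> u2 \<longrightarrow> card {v\<in>V. (v,u1) \<in> E \<and> (v,u2) \<in> E} \<le> 1) \<and>
     \<comment> \<open>B is a signed adjacency matrix of the graph\<close>
     (\<forall>v\<in>V. \<forall>u\<in>U. ((v,u) \<in> E \<longrightarrow> B v u \<in> {1, -1}) \<and> ((v,u) \<notin> E \<longrightarrow> B v u = 0))"

text \<open>Vectors in R^U are functions 'b => real vanishing outside U.\<close>

definition row_space :: "'a set \<Rightarrow> 'b set \<Rightarrow> ('a \<Rightarrow> 'b \<Rightarrow> real) \<Rightarrow> ('b \<Rightarrow> real) set" where
  "row_space V U B = {x. \<exists>c. x = (\<lambda>u. if u \<in> U then (\<Sum>v\<in>V. c v * B v u) else 0)}"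

definition innerU :: "'b set \<Rightarrow> ('b \<Rightarrow> real) \<Rightarrow> ('b \<Rightarrow> real) \<Rightarrow> real" where
  "innerU U x y = (\<Sum>u\<in>U. x u * y u)"

definition rows_lin_indep :: "'a set \<Rightarrow> 'b set \<Rightarrow> ('a \<Rightarrow> 'b \<Rightarrow> real) \<Rightarrow> bool" where
  "rows_lin_indep W U B \<longleftrightarrow>
     (\<forall>c. (\<forall>u\<in>U. (\<Sum>v\<in>W. c v * B v u) = 0) \<longrightarrow> (\<forall>v\<in>W. c v = 0))"

definition mat_rank :: "'a set \<Rightarrow> 'b set \<Rightarrow> ('a \<Rightarrow> 'b \<Rightarrow> real) \<Rightarrow> nat" where
  "mat_rank V U B = Max {card W | W. W \<subseteq> V \<and> rows_lin_indep W U B}"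

definition proj_H :: "'a set \<Rightarrow> 'b set \<Rightarrow> ('a \<Rightarrow> 'b \<Rightarrow> real) \<Rightarrow> ('b \<Rightarrow> real) \<Rightarrow> ('b \<Rightarrow> real)" where
  "proj_H V U B x = (THE y. y \<in> row_space V U B \<and>
      (\<forall>h\<in>row_space V U B. innerU U (\<lambda>u. x u - y u) h = 0))"

definition proj_mat :: "'a set \<Rightarrow> 'b set \<Rightarrow> ('a \<Rightarrow> 'b \<Rightarrow> real) \<Rightarrow> 'b \<Rightarrow> 'b \<Rightarrow> real" where
  "proj_mat V U B u w = proj_H V U B (\<lambda>u'. if u' = w then 1 else 0) u"

definition principal_det :: "('b \<Rightarrow> 'b \<Rightarrow> real) \<Rightarrow> 'b set \<Rightarrow> real" where
  "principal_det P S = (\<Sum>p\<in>{p. p permutes S}. of_int (sign p) * (\<Prod>u\<in>S. P u (p u)))"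

definition det_measure :: "'a set \<Rightarrow> 'b set \<Rightarrow> ('a \<Rightarrow> 'b \<Rightarrow> real) \<Rightarrow> 'b set \<Rightarrow> real" where
  "det_measure V U B S =
     (if S \<subseteq> U \<and> card S = mat_rank V U B then principal_det (proj_mat V U B) S else 0)"

definition walk_of :: "('x \<Rightarrow> 'x \<Rightarrow> bool) \<Rightarrow> 'x list \<Rightarrow> bool" where
  "walk_of adj xs \<longleftrightarrow> xs \<noteq> [] \<and> (\<forall>i. Suc i < length xs \<longrightarrow> adj (xs ! i) (xs ! Suc i))"

definition gdist :: "('x \<Rightarrow> 'x \<Rightarrow> bool) \<Rightarrow> 'x \<Rightarrow> 'x \<Rightarrow> nat" where
  "gdist adj x y = (LEAST n. \<exists>xs. walk_of adj xs \<and> hd xs = x \<and> last xs = y \<and> length xs = Suc n)"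

definition ball_set :: "('x \<Rightarrow> 'x \<Rightarrow> bool) \<Rightarrow> 'x \<Rightarrow> nat \<Rightarrow> 'x set" where
  "ball_set adj x r = {y. \<exists>xs. walk_of adj xs \<and> hd xs = x \<and> last xs = y \<and> length xs \<le> Suc r}"

text \<open>Root-preserving isomorphism of rooted graphs (vertex set, adjacency, root);
  adjacency is compared only between vertices of the vertex sets (induced subgraphs).\<close>
definition rooted_iso ::
  "'x set \<Rightarrow> ('x \<Rightarrow> 'x \<Rightarrow> bool) \<Rightarrow> 'x \<Rightarrow> 'y set \<Rightarrow> ('y \<Rightarrow> 'y \<Rightarrow> bool) \<Rightarrow> 'y \<Rightarrow> bool" where
  "rooted_iso A adjA a C adjC c \<longleftrightarrow>
     (\<exists>f. bij_betw f A C \<and> f a = c \<and> (\<forall>x\<in>A. \<forall>y\<in>A. adjA x y \<longleftrightarrow> adjC (f x) (f y)))"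

definition adj_sub :: "('a \<times> 'b) set \<Rightarrow> 'b set \<Rightarrow> ('a + 'b) \<Rightarrow> ('a + 'b) \<Rightarrow> bool" where
  "adj_sub E S x y = (case (x, y) of
       (Inl v, Inr u) \<Rightarrow> (v, u) \<in> E \<and> u \<in> S
     | (Inr u, Inl v) \<Rightarrow> (v, u) \<in> E \<and> u \<in> S
     | _ \<Rightarrow> False)"

definition ball_iso ::
  "('a \<times> 'b) set \<Rightarrow> 'b set \<Rightarrow> 'a \<Rightarrow> nat \<Rightarrow> 't set \<Rightarrow> ('t \<Rightarrow> 't \<Rightarrow> bool) \<Rightarrow> 't \<Rightarrow> bool" where
  "ball_iso E S v r Tv TE rt \<longleftrightarrow>
     rooted_iso (ball_set (adj_sub E S) (Inl v) r) (adj_sub E S) (Inl v) Tv TE rt"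

text \<open>P(B_{T_n}(v_n,r) = (T,rt)) with T_n ~ P^H and v_n uniform on V, independent.\<close>
definition ball_prob ::
  "'a set \<Rightarrow> 'b set \<Rightarrow> ('a \<times> 'b) set \<Rightarrow> ('a \<Rightarrow> 'b \<Rightarrow> real) \<Rightarrow> nat \<Rightarrow>
   't set \<Rightarrow> ('t \<Rightarrow> 't \<Rightarrow> bool) \<Rightarrow> 't \<Rightarrow> real" where
  "ball_prob V U E B r Tv TE rt =
     (\<Sum>S\<in>Pow U. det_measure V U B S *
        (real (card {v\<in>V. ball_iso E S v r Tv TE rt}) / real (card V)))"

definition is_cycle :: "('x \<Rightarrow> 'x \<Rightarrow> bool) \<Rightarrow> 'x list \<Rightarrow> bool" where
  "is_cycle adj xs \<longleftrightarrow> length xs \<ge> 3 \<and> distinct xs \<and> walk_of adj xs \<and> adj (last xs) (hd xs)"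

definition finite_rooted_tree :: "'t set \<Rightarrow> ('t \<Rightarrow> 't \<Rightarrow> bool) \<Rightarrow> 't \<Rightarrow> bool" where
  "finite_rooted_tree Tv TE rt \<longleftrightarrow>
     finite Tv \<and> rt \<in> Tv \<and>
     (\<forall>x y. TE x y \<longrightarrow> x \<in> Tv \<and> y \<in> Tv) \<and>
     (\<forall>x y. TE x y \<longleftrightarrow> TE y x) \<and> (\<forall>x. \<not> TE x x) \<and>
     (\<forall>y\<in>Tv. \<exists>xs. walk_of TE xs \<and> hd xs = rt \<and> last xs = y) \<and>
     \<not> (\<exists>xs. is_cycle TE xs)"

definition vheight :: "('t \<Rightarrow> 't \<Rightarrow> bool) \<Rightarrow> 't \<Rightarrow> 't \<Rightarrow> nat" where
  "vheight TE rt x = gdist TE rt x"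

definition tree_height :: "'t set \<Rightarrow> ('t \<Rightarrow> 't \<Rightarrow> bool) \<Rightarrow> 't \<Rightarrow> nat" where
  "tree_height Tv TE rt = Max (vheight TE rt ` Tv)"

definition even_vertices :: "'t set \<Rightarrow> ('t \<Rightarrow> 't \<Rightarrow> bool) \<Rightarrow> 't \<Rightarrow> 't set" where
  "even_vertices Tv TE rt = {x\<in>Tv. even (vheight TE rt x)}"

definition odd_vertices :: "'t set \<Rightarrow> ('t \<Rightarrow> 't \<Rightarrow> bool) \<Rightarrow> 't \<Rightarrow> 't set" where
  "odd_vertices Tv TE rt = {x\<in>Tv. odd (vheight TE rt x)}"

definition valid_tree :: "nat \<Rightarrow> 't set \<Rightarrow> ('t \<Rightarrow> 't \<Rightarrow> bool) \<Rightarrow> 't \<Rightarrow> bool" where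
  "valid_tree k Tv TE rt \<longleftrightarrow>
     even (tree_height Tv TE rt) \<and>
     (\<forall>x\<in>odd_vertices Tv TE rt. card {y\<in>Tv. TE x y} = k + 1)"

definition inner_even :: "'t set \<Rightarrow> ('t \<Rightarrow> 't \<Rightarrow> bool) \<Rightarrow> 't \<Rightarrow> 't set" where
  "inner_even Tv TE rt = {x\<in>even_vertices Tv TE rt. vheight TE rt x < tree_height Tv TE rt}"

definition is_matching :: "('t \<Rightarrow> 't \<Rightarrow> bool) \<Rightarrow> 't set set \<Rightarrow> bool" where
  "is_matching TE M \<longleftrightarrow>
     (\<forall>e\<in>M. \<exists>x y. e = {x, y} \<and> TE x y) \<and>
     (\<forall>e1\<in>M. \<forall>e2\<in>M. e1 \<noteq> e2 \<longrightarrow> e1 \<inter> e2 = {})"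

definition num_matchings :: "'t set \<Rightarrow> 't set \<Rightarrow> ('t \<Rightarrow> 't \<Rightarrow> bool) \<Rightarrow> 't \<Rightarrow> nat" where
  "num_matchings K Tv TE rt =
     card {M. is_matching TE M \<and> K \<union> odd_vertices Tv TE rt \<subseteq> \<Union>M}"

definition root_auts :: "'t set \<Rightarrow> ('t \<Rightarrow> 't \<Rightarrow> bool) \<Rightarrow> 't \<Rightarrow> ('t \<Rightarrow> 't) set" where
  "root_auts Tv TE rt = {f. bij_betw f Tv Tv \<and> f rt = rt \<and>
      (\<forall>x\<in>Tv. \<forall>y\<in>Tv. TE x y \<longleftrightarrow> TE (f x) (f y)) \<and> (\<forall>x. x \<notin> Tv \<longrightarrow> f x = x)}"

end

theory Submission
  imports Defs
begin

text \<open>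
  Let \<open>M = B\<^sup>T B\<close>. Because \<open>P M = M\<close> for the projection \<open>P = P\<^sub>H\<close> and the rank of \<open>B\<close> is at most \<open>n\<close>,
  the squared Frobenius norm of \<open>P - M / d\<close> is at most \<open>n k / d\<close>. Hence, for most choices of a bounded
  set \<open>A\<close> of nearby elements of \<open>U\<close>, the inclusion probability \<open>det P\<^sub>A\<close> is close to \<open>det M\<^sub>A / d ^ |A|\<close>,
  and when \<open>A\<close> spans a forest, \<open>det M\<^sub>A\<close> counts the matchings saturating \<open>A\<close> (the expansion of a
  Gram determinant, in which only the identity permutation survives).

  The ball at \<open>v\<close> is isomorphic to \<open>T\<close> iff, for some embedding of \<open>T\<close> rooted at \<open>v\<close>, the random set meets
  the neighbourhood of the inner even vertices exactly in the odd vertices of the embedded tree;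
  there are then \<open>|Aut(T)|\<close> such embeddings, out of \<open>n d ^ |U(T)| (k!) ^ |U(T)|\<close> asymptotically. By the
  Bonferroni inequalities the probability of this event is an alternating sum over \<open>j\<close> extra leaves
  attached to inner vertices. Counting the matchings of \<open>T\<close> with its extra leaves, the sum over \<open>j\<close> is
  \<open>e ^ (- k |I|) * (1 - 1) ^ q\<close> for each matching of \<open>T\<close> that saturates \<open>U(T)\<close> and misses \<open>q\<close> inner
  vertices, so only those with \<open>q = 0\<close> contribute.

  Embeddings through vertices where \<open>P\<close> is atypical are discarded before determinants are
  compared, since their moments need not be small; they are instead controlled by a counting
  argument valid for every fixed value of the random set.
\<close>

section \<open>Determinants of principal submatrices\<close>

text \<open>The comparison of \<open>P\<close> with \<open>M / d\<close> is governed by a count of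
  free elements. There are at most of order \<open>n * d ^ N\<close> configurations with
  \<open>N\<close> elements of \<open>U\<close>. After all entries are multiplied by
  \<open>d\<close>, the determinants of \<open>M\<close> are bounded, so the total error must be of
  smaller order than \<open>n * d ^ N\<close>. Two prescribed distinct elements leave order
  \<open>d ^ (N - 2)\<close> configurations, and the rescaled squared Frobenius error is at most
  \<open>n * k * d\<close>; the squared off-diagonal errors therefore add up to order
  \<open>n * d ^ (N - 1)\<close>. One prescribed element leaves order \<open>d ^ (N - 1)\<close>
  configurations. There the Frobenius bound combined with Cauchy-Schwarz only gives order
  \<open>n * d ^ N\<close>, so the diagonal needs a bound of its own in absolute value. The same
  bound on the diagonal decides which vertices are atypical, because the diagonal of a projection
  controls all of its entries.\<close>

lemma principal_det_empty [simp]: "principal_det K {} = 1"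
  by (simp add: principal_det_def)

text \<open>The minor formed by the rows \<open>f u\<close> of a possibly rectangular
  \<open>b\<close>, repetitions allowed, and the columns in \<open>A\<close>. Such minors appear
  when a Gram determinant is expanded by multilinearity in its rows.\<close>

definition row_det :: "('c \<Rightarrow> 'b \<Rightarrow> real) \<Rightarrow> 'b set \<Rightarrow> ('b \<Rightarrow> 'c) \<Rightarrow> real" where
  "row_det b A f = (\<Sum>p\<in>{p. p permutes A}. of_int (sign p) * (\<Prod>u\<in>A. b (f u) (p u)))"

lemma principal_det_eq_row_det: "principal_det K A = row_det K A id"
  by (simp add: principal_det_def row_det_def)

lemma row_det_cong:
  "(\<And>u. u \<in> A \<Longrightarrow> f u = g u) \<Longrightarrow> row_det b A f = row_det b A g"
  unfolding row_det_def by (intro sum.cong refl arg_cong2[where f="(*)"] prod.cong) auto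

lemma row_det_permute:
  assumes A: "finite A" and q: "q permutes A"
  shows "row_det b A (f \<circ> q) = of_int (sign q) * row_det b A f"
proof -
  have pq: "permutation q" using A q permutation_permutes by blast
  have "row_det b A (f \<circ> q) =
      (\<Sum>p | p permutes A. of_int (sign (p \<circ> q)) * (\<Prod>u\<in>A. b ((f \<circ> q) u) ((p \<circ> q) u)))"
    unfolding row_det_def by (rule sum_permutations_compose_right[OF q])
  also have "\<dots> = (\<Sum>p | p permutes A. of_int (sign q) * (of_int (sign p) * (\<Prod>u\<in>A. b (f u) (p u))))"
  proof (intro sum.cong refl)
    fix p assume "p \<in> {p. p permutes A}"
    then have "permutation p" using A permutation_permutes by blast
    moreover have "(\<Prod>u\<in>A. b (f u) (p u)) = (\<Prod>u\<in>A. b ((f \<circ> q) u) ((p \<circ> q) u))"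
      by (subst prod.permute[OF q]) (simp add: o_def)
    ultimately show "of_int (sign (p \<circ> q)) * (\<Prod>u\<in>A. b ((f \<circ> q) u) ((p \<circ> q) u)) =
       of_int (sign q) * (of_int (sign p) * (\<Prod>u\<in>A. b (f u) (p u)))"
      using pq by (simp add: sign_compose)
  qed
  finally show ?thesis by (simp add: row_det_def sum_distrib_left)
qed

lemma row_det_eq_0:
  assumes A: "finite A" and "u \<in> A" "w \<in> A" "u \<noteq> w" and f: "f u = f w"
  shows "row_det b A f = 0"
proof -
  have p: "Transposition.transpose u w permutes A" using assms by (simp add: permutes_swap_id)
  have "row_det b A (f \<circ> Transposition.transpose u w) = row_det b A f"
    by (rule row_det_cong) (use f in \<open>auto simp: Transposition.transpose_def\<close>)
  with row_det_permute[OF A p, of b f] show ?thesis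
    using assms by (simp add: sign_swap_id)
qed

text \<open>The expansion behind the Cauchy--Binet formula.\<close>
lemma principal_det_gram:
  assumes A: "finite A" and Z: "finite Z"
    and K: "\<And>u w. u \<in> A \<Longrightarrow> w \<in> A \<Longrightarrow> K u w = (\<Sum>z\<in>Z. c z u * b z w)"
  shows "principal_det K A = (\<Sum>f\<in>A \<rightarrow>\<^sub>E Z. (\<Prod>u\<in>A. c (f u) u) * row_det b A f)"
proof -
  have "principal_det K A = (\<Sum>p | p permutes A. of_int (sign p) * (\<Prod>u\<in>A. \<Sum>z\<in>Z. c z u * b z (p u)))"
    unfolding principal_det_def
    by (intro sum.cong refl arg_cong2[where f="(*)"] prod.cong) (auto simp: K permutes_in_image)
  also have "\<dots> = (\<Sum>p | p permutes A. of_int (sign p) * (\<Sum>f\<in>A \<rightarrow>\<^sub>E Z. \<Prod>u\<in>A. c (f u) u * b (f u) (p u)))"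
    by (simp add: prod_sum_PiE[OF A] Z)
  also have "\<dots> = (\<Sum>f\<in>A \<rightarrow>\<^sub>E Z. \<Sum>p | p permutes A. of_int (sign p) * (\<Prod>u\<in>A. c (f u) u * b (f u) (p u)))"
    unfolding sum_distrib_left by (rule sum.swap)
  also have "\<dots> = (\<Sum>f\<in>A \<rightarrow>\<^sub>E Z. (\<Prod>u\<in>A. c (f u) u) * row_det b A f)"
    unfolding row_det_def sum_distrib_left prod.distrib
    by (intro sum.cong refl) (simp add: mult_ac)
  finally show ?thesis .
qed

text \<open>Averaging the expansion over the permutations of \<open>A\<close> turns it into a sum of squares.\<close>
lemma principal_det_gram_nonneg:
  assumes A: "finite A" and Z: "finite Z"
    and K: "\<And>u w. u \<in> A \<Longrightarrow> w \<in> A \<Longrightarrow> K u w = (\<Sum>z\<in>Z. b z u * b z w)"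
  shows "principal_det K A \<ge> 0"
proof -
  let ?S = "{q. q permutes A}"
  have comp: "(\<Sum>f\<in>A \<rightarrow>\<^sub>E Z. g f) = (\<Sum>f\<in>A \<rightarrow>\<^sub>E Z. g (restrict (f \<circ> q) A))"
    if q: "q permutes A" for q and g :: "('a \<Rightarrow> 'b) \<Rightarrow> real"
  proof (rule sum.reindex_bij_witness[of _ "\<lambda>f. restrict (f \<circ> q) A" "\<lambda>f. restrict (f \<circ> inv q) A"])
    fix f assume f: "f \<in> A \<rightarrow>\<^sub>E Z"
    show "restrict (restrict (f \<circ> inv q) A \<circ> q) A = f" "restrict (restrict (f \<circ> q) A \<circ> inv q) A = f"
      using f q permutes_inv[OF q]
      by (auto simp: fun_eq_iff restrict_def permutes_in_image permutes_inverses[OF q] PiE_def extensional_def)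
    show "restrict (f \<circ> q) A \<in> A \<rightarrow>\<^sub>E Z" "restrict (f \<circ> inv q) A \<in> A \<rightarrow>\<^sub>E Z"
      using f q permutes_inv[OF q] by (auto simp: permutes_in_image PiE_def)
    show "g (restrict (restrict (f \<circ> inv q) A \<circ> q) A) = g f"
      using \<open>restrict (restrict (f \<circ> inv q) A \<circ> q) A = f\<close> by simp
  qed
  have "real (card ?S) * principal_det K A = (\<Sum>q\<in>?S. principal_det K A)" by simp
  also have "\<dots> = (\<Sum>q\<in>?S. \<Sum>f\<in>A \<rightarrow>\<^sub>E Z. of_int (sign q) * (\<Prod>u\<in>A. b (f (q u)) u) * row_det b A f)"
  proof (intro sum.cong refl)
    fix q assume "q \<in> ?S" then have q: "q permutes A" by simp
    show "principal_det K A = (\<Sum>f\<in>A \<rightarrow>\<^sub>E Z. of_int (sign q) * (\<Prod>u\<in>A. b (f (q u)) u) * row_det b A f)"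
    proof (subst principal_det_gram[OF A Z K], assumption, assumption,
        subst comp[OF q, of "\<lambda>f. (\<Prod>u\<in>A. b (f u) u) * row_det b A f"], intro sum.cong refl)
      fix f
      have "row_det b A (restrict (f \<circ> q) A) = row_det b A (f \<circ> q)"
        by (rule row_det_cong) simp
      then show "(\<Prod>u\<in>A. b (restrict (f \<circ> q) A u) u) * row_det b A (restrict (f \<circ> q) A) =
         of_int (sign q) * (\<Prod>u\<in>A. b (f (q u)) u) * row_det b A f"
        by (simp add: row_det_permute[OF A q])
    qed
  qed
  also have "\<dots> = (\<Sum>f\<in>A \<rightarrow>\<^sub>E Z. \<Sum>q\<in>?S. of_int (sign q) * (\<Prod>u\<in>A. b (f (q u)) u) * row_det b A f)"
    by (rule sum.swap)
  also have "\<dots> = (\<Sum>f\<in>A \<rightarrow>\<^sub>E Z. row_det b A f * row_det b A f)"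
  proof (intro sum.cong refl)
    fix f
    \<comment> \<open>Indexing by inverse permutations transposes the minor: the sum over
      \<open>q\<close> left by the averaging is the row determinant again, which produces the
      square.\<close>
    have "row_det b A f = (\<Sum>q\<in>?S. of_int (sign (inv q)) * (\<Prod>u\<in>A. b (f u) (inv q u)))"
      unfolding row_det_def by (rule sum_permutations_inverse)
    also have "\<dots> = (\<Sum>q\<in>?S. of_int (sign q) * (\<Prod>u\<in>A. b (f (q u)) u))"
    proof (intro sum.cong refl)
      fix q assume "q \<in> ?S" then have q: "q permutes A" by simp
      have "(\<Prod>u\<in>A. b (f u) (inv q u)) = (\<Prod>u\<in>A. b (f (q u)) u)"
        by (subst prod.permute[OF q]) (simp add: o_def permutes_inverses[OF q])
      moreover have "sign (inv q) = sign q"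
        using A q permutation_permutes sign_inverse by blast
      ultimately show "of_int (sign (inv q)) * (\<Prod>u\<in>A. b (f u) (inv q u)) = of_int (sign q) * (\<Prod>u\<in>A. b (f (q u)) u)"
        by simp
    qed
    finally have "(\<Sum>q\<in>?S. of_int (sign q) * (\<Prod>u\<in>A. b (f (q u)) u)) = row_det b A f" by simp
    then show "(\<Sum>q\<in>?S. of_int (sign q) * (\<Prod>u\<in>A. b (f (q u)) u) * row_det b A f) = row_det b A f * row_det b A f"
      by (simp flip: sum_distrib_right)
  qed
  also have "\<dots> \<ge> 0" by (intro sum_nonneg) simp
  finally have "real (card ?S) * principal_det K A \<ge> 0" .
  moreover have "card ?S > 0" using A by (simp add: card_permutations[OF refl])
  ultimately show ?thesis by (simp add: zero_le_mult_iff)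
qed

text \<open>A permutation of \<open>insert u A\<close> either fixes \<open>u\<close> or arises from
  a permutation \<open>p\<close> of \<open>A\<close> by putting \<open>u\<close> into a cycle, so
  that the step from \<open>x\<close> to \<open>p x\<close> becomes \<open>x\<close>,
  \<open>u\<close>, \<open>p x\<close>. The insertion costs one transposition, hence the minus
  sign.\<close>

lemma principal_det_insert:
  assumes A: "finite A" and u: "u \<notin> A"
  shows "principal_det K (insert u A) = K u u * principal_det K A
     - (\<Sum>p | p permutes A. of_int (sign p) * (\<Sum>x\<in>A. K x u * K u (p x) * (\<Prod>y\<in>A - {x}. K y (p y))))"
proof -
  let ?h = "\<lambda>p. of_int (sign p) * (\<Prod>x\<in>insert u A. K x (p x))"
  have split: "principal_det K (insert u A) = (\<Sum>q | q permutes A. ?h (Transposition.transpose u u \<circ> q)) +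
     (\<Sum>b\<in>A. \<Sum>q | q permutes A. ?h (Transposition.transpose u b \<circ> q))"
    unfolding principal_det_def sum_over_permutations_insert[OF A u] using A u by simp
  have 1: "(\<Sum>q | q permutes A. ?h (Transposition.transpose u u \<circ> q)) = K u u * principal_det K A"
    unfolding principal_det_def sum_distrib_left
    using A u by (intro sum.cong refl) (auto simp: permutes_not_in mult_ac)
  have 2: "(\<Sum>b\<in>A. ?h (Transposition.transpose u b \<circ> q)) =
     - (of_int (sign q) * (\<Sum>x\<in>A. K x u * K u (q x) * (\<Prod>y\<in>A - {x}. K y (q y))))"
    if q: "q permutes A" for q
  proof -
    have "(\<Sum>b\<in>A. ?h (Transposition.transpose u b \<circ> q)) = (\<Sum>x\<in>A. ?h (Transposition.transpose u (q x) \<circ> q))"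
      by (subst sum.permute[OF q]) (simp add: o_def)
    also have "\<dots> = (\<Sum>x\<in>A. - (of_int (sign q) * (K x u * K u (q x) * (\<Prod>y\<in>A - {x}. K y (q y)))))"
    proof (intro sum.cong refl)
      fix x assume x: "x \<in> A"
      have qx: "q x \<in> A" "q x \<noteq> u" using q x u permutes_in_image by metis+
      have qu: "q u = u" using q u permutes_not_in by metis
      have "permutation q" using A q permutation_permutes by blast
      then have s: "sign (Transposition.transpose u (q x) \<circ> q) = - sign q"
        using qx(2) by (simp add: sign_compose permutation_swap_id sign_swap_id)
      have "(\<Prod>z\<in>A. K z ((Transposition.transpose u (q x) \<circ> q) z)) =
          K x u * (\<Prod>y\<in>A - {x}. K y ((Transposition.transpose u (q x) \<circ> q) y))"
        by (subst prod.remove[OF A x]) simp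
      also have "(\<Prod>y\<in>A - {x}. K y ((Transposition.transpose u (q x) \<circ> q) y)) = (\<Prod>y\<in>A - {x}. K y (q y))"
      proof (intro prod.cong refl)
        fix y assume y: "y \<in> A - {x}"
        then have "q y \<noteq> q x" using permutes_inj[OF q] by (auto dest: injD)
        moreover have "q y \<noteq> u" using q y u permutes_in_image by fastforce
        ultimately show "K y ((Transposition.transpose u (q x) \<circ> q) y) = K y (q y)"
          by (simp add: Transposition.transpose_def)
      qed
      finally show "?h (Transposition.transpose u (q x) \<circ> q) =
         - (of_int (sign q) * (K x u * K u (q x) * (\<Prod>y\<in>A - {x}. K y (q y))))"
        using A u qu by (simp add: s mult_ac)
    qed
    finally show ?thesis by (simp add: sum_distrib_left sum_negf)
  qed
  have "(\<Sum>b\<in>A. \<Sum>q | q permutes A. ?h (Transposition.transpose u b \<circ> q)) =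
     - (\<Sum>q | q permutes A. of_int (sign q) * (\<Sum>x\<in>A. K x u * K u (q x) * (\<Prod>y\<in>A - {x}. K y (q y))))"
    by (subst sum.swap) (simp add: 2 sum_negf del: o_apply)
  then show ?thesis using split 1 by simp
qed

text \<open>The sum replaces row \<open>x\<close> by row \<open>u\<close>, which repeats a row
  unless \<open>x = u\<close>. Consequently the right-hand side of
  \<open>principal_det_insert\<close> vanishes for \<open>u\<close> in \<open>A\<close>, and sums
  over \<open>U - A\<close> may be extended to all of \<open>U\<close>.\<close>

lemma principal_det_insert_member:
  assumes A: "finite A" and u: "u \<in> A"
  shows "K u u * principal_det K A
     = (\<Sum>p | p permutes A. of_int (sign p) * (\<Sum>x\<in>A. K x u * K u (p x) * (\<Prod>y\<in>A - {x}. K y (p y))))"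
proof -
  have *: "K x u * row_det K A (id(x := u)) =
    (\<Sum>p | p permutes A. of_int (sign p) * (K x u * K u (p x) * (\<Prod>y\<in>A - {x}. K y (p y))))" if x: "x \<in> A" for x
    unfolding row_det_def sum_distrib_left
  proof (intro sum.cong refl)
    fix p
    have "(\<Prod>y\<in>A. K ((id(x := u)) y) (p y)) = K u (p x) * (\<Prod>y\<in>A - {x}. K y (p y))"
      by (subst prod.remove[OF A x]) (auto intro!: prod.cong)
    then show "K x u * (of_int (sign p) * (\<Prod>y\<in>A. K ((id(x := u)) y) (p y))) =
       of_int (sign p) * (K x u * K u (p x) * (\<Prod>y\<in>A - {x}. K y (p y)))" by simp
  qed
  have "(\<Sum>p | p permutes A. of_int (sign p) * (\<Sum>x\<in>A. K x u * K u (p x) * (\<Prod>y\<in>A - {x}. K y (p y))))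
     = (\<Sum>x\<in>A. K x u * row_det K A (id(x := u)))"
    unfolding sum_distrib_left by (subst sum.swap) (simp add: *)
  also have "\<dots> = (\<Sum>x\<in>A. if x = u then K u u * principal_det K A else 0)"
  proof (intro sum.cong refl)
    fix x assume x: "x \<in> A"
    have "row_det K A (id(x := u)) = 0" if "x \<noteq> u"
      by (rule row_det_eq_0[OF A x u that]) (use that in auto)
    then show "K x u * row_det K A (id(x := u)) = (if x = u then K u u * principal_det K A else 0)"
      by (auto simp: principal_det_eq_row_det fun_upd_idem)
  qed
  finally show ?thesis using A u by simp
qed

text \<open>For an idempotent kernel, summing the previous two expansions over the ground set
  collapses each path through the new point to a single entry.\<close>
lemma sum_principal_det_insert:
  assumes U: "finite U" and A: "A \<subseteq> U"
    and idem: "\<And>x y. x \<in> U \<Longrightarrow> y \<in> U \<Longrightarrow> (\<Sum>u\<in>U. K x u * K u y) = K x y"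
  shows "(\<Sum>u\<in>U - A. principal_det K (insert u A)) = ((\<Sum>u\<in>U. K u u) - real (card A)) * principal_det K A"
proof -
  have fA: "finite A" using A U finite_subset by blast
  define R where "R u = K u u * principal_det K A
     - (\<Sum>p | p permutes A. of_int (sign p) * (\<Sum>x\<in>A. K x u * K u (p x) * (\<Prod>y\<in>A - {x}. K y (p y))))" for u
  have "(\<Sum>u\<in>U - A. principal_det K (insert u A)) = (\<Sum>u\<in>U - A. R u)"
    by (intro sum.cong refl) (simp add: R_def principal_det_insert[OF fA])
  also have "\<dots> = (\<Sum>u\<in>U. R u)"
    by (rule sum.mono_neutral_left)
       (use U A principal_det_insert_member[OF fA, of _ K] in \<open>auto simp: R_def\<close>)
  also have "\<dots> = (\<Sum>u\<in>U. K u u) * principal_det K A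
     - (\<Sum>p | p permutes A. \<Sum>u\<in>U. of_int (sign p) * (\<Sum>x\<in>A. K x u * K u (p x) * (\<Prod>y\<in>A - {x}. K y (p y))))"
    unfolding R_def sum_subtractf sum_distrib_right by (subst sum.swap) simp
  also have "(\<Sum>p | p permutes A. \<Sum>u\<in>U. of_int (sign p) * (\<Sum>x\<in>A. K x u * K u (p x) * (\<Prod>y\<in>A - {x}. K y (p y))))
     = (\<Sum>p | p permutes A. real (card A) * (of_int (sign p) * (\<Prod>y\<in>A. K y (p y))))"
  proof (intro sum.cong refl)
    fix p assume "p \<in> {p. p permutes A}" then have p: "p permutes A" by simp
    have "(\<Sum>u\<in>U. \<Sum>x\<in>A. K x u * K u (p x) * (\<Prod>y\<in>A - {x}. K y (p y))) =
       (\<Sum>x\<in>A. (\<Sum>u\<in>U. K x u * K u (p x)) * (\<Prod>y\<in>A - {x}. K y (p y)))"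
      by (subst sum.swap) (simp add: sum_distrib_right)
    also have "\<dots> = (\<Sum>x\<in>A. \<Prod>y\<in>A. K y (p y))"
    proof (intro sum.cong refl)
      fix x assume x: "x \<in> A"
      then have "p x \<in> U" "x \<in> U" using p A permutes_in_image by fastforce+
      then show "(\<Sum>u\<in>U. K x u * K u (p x)) * (\<Prod>y\<in>A - {x}. K y (p y)) = (\<Prod>y\<in>A. K y (p y))"
        by (simp add: idem prod.remove[OF fA x])
    qed
    finally show "(\<Sum>u\<in>U. of_int (sign p) * (\<Sum>x\<in>A. K x u * K u (p x) * (\<Prod>y\<in>A - {x}. K y (p y)))) =
       real (card A) * (of_int (sign p) * (\<Prod>y\<in>A. K y (p y)))"
      by (simp flip: sum_distrib_left)
  qed
  also have "\<dots> = real (card A) * principal_det K A"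
    by (simp add: principal_det_def sum_distrib_left)
  finally show ?thesis by (simp add: algebra_simps)
qed

lemma principal_det_scale:
  assumes "finite A"
  shows "principal_det (\<lambda>u w. c * K u w) A = c ^ card A * principal_det K A"
  by (simp add: principal_det_def prod.distrib sum_distrib_left mult_ac)

lemma abs_principal_det_le:
  assumes A: "finite A" and C: "\<And>u w. u \<in> A \<Longrightarrow> w \<in> A \<Longrightarrow> \<bar>K u w\<bar> \<le> C"
  shows "\<bar>principal_det K A\<bar> \<le> fact (card A) * C ^ card A"
proof -
  have "\<bar>principal_det K A\<bar> \<le> (\<Sum>p | p permutes A. \<bar>of_int (sign p) * (\<Prod>u\<in>A. K u (p u))\<bar>)"
    unfolding principal_det_def by (rule sum_abs)
  also have "\<dots> \<le> (\<Sum>p | p permutes A. C ^ card A)"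
  proof (rule sum_mono)
    fix p assume "p \<in> {p. p permutes A}"
    then have "(\<Prod>u\<in>A. \<bar>K u (p u)\<bar>) \<le> (\<Prod>u\<in>A. C)"
      by (intro prod_mono) (auto simp: permutes_in_image C)
    then show "\<bar>of_int (sign p) * (\<Prod>u\<in>A. K u (p u))\<bar> \<le> C ^ card A"
      by (simp add: abs_mult abs_prod sign_def)
  qed
  also have "\<dots> = fact (card A) * C ^ card A"
    using A by (simp add: card_permutations[OF refl])
  finally show ?thesis .
qed

lemma abs_principal_det_diff_le:
  assumes A: "finite A" and C1: "C \<ge> 1"
    and K: "\<And>u w. u \<in> A \<Longrightarrow> w \<in> A \<Longrightarrow> \<bar>K u w\<bar> \<le> C"
    and L: "\<And>u w. u \<in> A \<Longrightarrow> w \<in> A \<Longrightarrow> \<bar>L u w\<bar> \<le> C"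
  shows "\<bar>principal_det K A - principal_det L A\<bar>
    \<le> fact (card A) * C ^ card A * (\<Sum>u\<in>A. \<Sum>w\<in>A. \<bar>K u w - L u w\<bar>)"
proof -
  let ?D = "\<Sum>u\<in>A. \<Sum>w\<in>A. \<bar>K u w - L u w\<bar>"
  have "principal_det K A - principal_det L A
     = (\<Sum>p | p permutes A. of_int (sign p) * ((\<Prod>u\<in>A. K u (p u)) - (\<Prod>u\<in>A. L u (p u))))"
    by (simp add: principal_det_def right_diff_distrib flip: sum_subtractf)
  then have "\<bar>principal_det K A - principal_det L A\<bar>
     \<le> (\<Sum>p | p permutes A. \<bar>of_int (sign p) * ((\<Prod>u\<in>A. K u (p u)) - (\<Prod>u\<in>A. L u (p u)))\<bar>)"
    by (simp only: sum_abs)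
  also have "\<dots> \<le> (\<Sum>p | p permutes A. C ^ card A * ?D)"
  proof (rule sum_mono)
    fix p assume "p \<in> {p. p permutes A}" then have p: "p permutes A" by simp
    \<comment> \<open>Division by \<open>C\<close> brings all factors into the unit interval in
      absolute value, where a difference of products is at most the sum of the differences of the
      factors.\<close>
    have "\<bar>(\<Prod>u\<in>A. K u (p u) / C) - (\<Prod>u\<in>A. L u (p u) / C)\<bar> \<le> (\<Sum>u\<in>A. \<bar>K u (p u) / C - L u (p u) / C\<bar>)"
      using norm_prod_diff[of A "\<lambda>u. K u (p u) / C" "\<lambda>u. L u (p u) / C"] C1 p
      by (auto simp: permutes_in_image K L divide_le_eq_1)
    also have "\<dots> \<le> ?D"
    proof (rule sum_mono)
      fix u assume u: "u \<in> A"
      have "\<bar>K u (p u) / C - L u (p u) / C\<bar> = \<bar>K u (p u) - L u (p u)\<bar> / C"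
        using C1 by (simp flip: diff_divide_distrib)
      also have "\<dots> \<le> \<bar>K u (p u) - L u (p u)\<bar> / 1"
        using C1 by (intro divide_left_mono) auto
      also have "\<dots> \<le> (\<Sum>w\<in>A. \<bar>K u w - L u w\<bar>)"
        using member_le_sum[of "p u" A "\<lambda>w. \<bar>K u w - L u w\<bar>"] A u p by (auto simp: permutes_in_image)
      finally show "\<bar>K u (p u) / C - L u (p u) / C\<bar> \<le> (\<Sum>w\<in>A. \<bar>K u w - L u w\<bar>)" .
    qed
    finally have "C ^ card A * \<bar>(\<Prod>u\<in>A. K u (p u) / C) - (\<Prod>u\<in>A. L u (p u) / C)\<bar> \<le> C ^ card A * ?D"
      using C1 by (intro mult_left_mono) auto
    moreover have "C ^ card A * \<bar>(\<Prod>u\<in>A. K u (p u) / C) - (\<Prod>u\<in>A. L u (p u) / C)\<bar>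
       = \<bar>(\<Prod>u\<in>A. K u (p u)) - (\<Prod>u\<in>A. L u (p u))\<bar>"
      using C1 A by (simp add: prod_dividef prod_constant flip: diff_divide_distrib)
    ultimately show "\<bar>of_int (sign p) * ((\<Prod>u\<in>A. K u (p u)) - (\<Prod>u\<in>A. L u (p u)))\<bar> \<le> C ^ card A * ?D"
      by (simp add: abs_mult sign_def)
  qed
  also have "\<dots> = fact (card A) * C ^ card A * ?D"
    using A by (simp add: card_permutations[OF refl])
  finally show ?thesis .
qed

section \<open>Projection kernels and inclusion probabilities\<close>

locale projection_kernel =
  fixes U :: "'b set" and K :: "'b \<Rightarrow> 'b \<Rightarrow> real" and h :: nat
  assumes finU: "finite U"
    and sym: "\<And>u w. u \<in> U \<Longrightarrow> w \<in> U \<Longrightarrow> K u w = K w u"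
    and idem: "\<And>u w. u \<in> U \<Longrightarrow> w \<in> U \<Longrightarrow> (\<Sum>z\<in>U. K u z * K z w) = K u w"
    and tr: "(\<Sum>u\<in>U. K u u) = real h"
begin

lemma gram: "u \<in> U \<Longrightarrow> w \<in> U \<Longrightarrow> K u w = (\<Sum>z\<in>U. K z u * K z w)"
  using idem[of u w] sym by (simp cong: sum.cong)

lemma det_nonneg: "A \<subseteq> U \<Longrightarrow> principal_det K A \<ge> 0"
  by (rule principal_det_gram_nonneg[where Z = U and b = K])
     (auto intro: finU finite_subset gram)

lemma diag_nonneg: "u \<in> U \<Longrightarrow> K u u \<ge> 0"
  using gram[of u u] by (simp add: sum_nonneg)

lemma entry_bound: "u \<in> U \<Longrightarrow> w \<in> U \<Longrightarrow> (K u w)\<^sup>2 \<le> K u u * K w w"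
  using Cauchy_Schwarz_ineq_sum[of "\<lambda>z. K z u" "\<lambda>z. K z w" U] gram[of u w] gram[of u u] gram[of w w]
  by (simp add: power2_eq_square)

lemma insert_sum:
  "A \<subseteq> U \<Longrightarrow> (\<Sum>u\<in>U - A. principal_det K (insert u A)) = (real h - real (card A)) * principal_det K A"
  using sum_principal_det_insert[OF finU, of A K] idem tr by simp

text \<open>The sum over one-point extensions is nonnegative, but by \<open>insert_sum\<close> it
  equals the determinant times the negative number \<open>h - card A\<close>. This replaces an
  argument by rank.\<close>

lemma det_eq_0: "A \<subseteq> U \<Longrightarrow> card A > h \<Longrightarrow> principal_det K A = 0"
proof -
  assume A: "A \<subseteq> U" "card A > h"
  have "(\<Sum>u\<in>U - A. principal_det K (insert u A)) \<ge> 0"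
    by (intro sum_nonneg det_nonneg) (use A in auto)
  then have "(real h - real (card A)) * principal_det K A \<ge> 0" by (simp add: insert_sum A)
  then show ?thesis using A det_nonneg[of A] by (simp add: zero_le_mult_iff)
qed

text \<open>Double counting of pairs of a set \<open>S\<close> of size \<open>h\<close> and a point
  \<open>u\<close> of \<open>S - A\<close>: each \<open>S\<close> occurs \<open>h - card A\<close>
  times, which is exactly the factor in \<open>insert_sum\<close>.\<close>

lemma sum_supersets:
  assumes "A \<subseteq> U"
  shows "(\<Sum>S | A \<subseteq> S \<and> S \<subseteq> U \<and> card S = h. principal_det K S) = principal_det K A"
  using assms
proof (induction "h - card A" arbitrary: A)
  \<comment> \<open>Truncated subtraction puts \<open>card A > h\<close> into the base case too;
    there no \<open>S\<close> exists and the determinant vanishes.\<close>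
  case 0
  have fin: "finite S" if "S \<subseteq> U" for S using finU finite_subset that by blast
  show ?case
  proof (cases "card A = h")
    case True
    have "S = A" if "A \<subseteq> S" "S \<subseteq> U" "card S = h" for S
      using card_subset_eq[OF fin[OF that(2)] that(1)] that(3) True by simp
    then have "{S. A \<subseteq> S \<and> S \<subseteq> U \<and> card S = h} = {A}"
      using 0 True by blast
    then show ?thesis by simp
  next
    case False
    then have "card A > h" using 0 by simp
    moreover then have "{S. A \<subseteq> S \<and> S \<subseteq> U \<and> card S = h} = {}"
      using card_mono[OF fin] by (auto simp: not_le[symmetric])
    ultimately show ?thesis using 0(2) det_eq_0[of A] by (auto intro!: sum.neutral)
  qed
next
  case (Suc m)
  have fA: "finite A" using Suc.prems finU finite_subset by blast
  let ?F = "\<lambda>A. {S. A \<subseteq> S \<and> S \<subseteq> U \<and> card S = h}"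
  have finF: "finite (?F A)" for A
    by (rule finite_subset[of _ "Pow U"]) (use finU in auto)
  have "(\<Sum>u\<in>U - A. principal_det K (insert u A)) = (\<Sum>u\<in>U - A. \<Sum>S\<in>?F (insert u A). principal_det K S)"
  proof (intro sum.cong refl)
    fix u assume u: "u \<in> U - A"
    then have "m = h - card (insert u A)" using Suc(2) fA by simp
    then show "principal_det K (insert u A) = (\<Sum>S\<in>?F (insert u A). principal_det K S)"
      using Suc(1)[of "insert u A"] Suc(3) u by simp
  qed
  also have "\<dots> = (\<Sum>u\<in>U - A. \<Sum>S\<in>?F A. if u \<in> S then principal_det K S else 0)"
    by (intro sum.cong refl sum.mono_neutral_cong_left finF) auto
  also have "\<dots> = (\<Sum>S\<in>?F A. \<Sum>u\<in>U - A. if u \<in> S then principal_det K S else 0)"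
    by (rule sum.swap)
  also have "\<dots> = (\<Sum>S\<in>?F A. (real h - real (card A)) * principal_det K S)"
  proof (intro sum.cong refl)
    fix S assume S: "S \<in> ?F A"
    then have fS: "finite S" using finU finite_subset by blast
    have "(\<Sum>u\<in>U - A. if u \<in> S then principal_det K S else 0) = (\<Sum>u\<in>S - A. principal_det K S)"
      by (rule sum.mono_neutral_cong_right) (use finU S in auto)
    also have "\<dots> = real (card S - card A) * principal_det K S"
      using S fA by (simp add: card_Diff_subset)
    also have "real (card S - card A) = real h - real (card A)"
      using S card_mono[OF fS, of A] by (auto simp: of_nat_diff)
    finally show "(\<Sum>u\<in>U - A. if u \<in> S then principal_det K S else 0) = (real h - real (card A)) * principal_det K S" .
  qed
  finally have "(real h - real (card A)) * (\<Sum>S\<in>?F A. principal_det K S) = (real h - real (card A)) * principal_det K A"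
    using Suc(3) by (simp only: insert_sum sum_distrib_left)
  moreover have "real h - real (card A) \<noteq> 0" using Suc(2) by linarith
  ultimately show ?case using mult_left_cancel by blast
qed

end

section \<open>The projection onto the row space\<close>

lemma row_space_orthogonal:
  assumes y: "y \<in> row_space V U B" and f: "\<And>v. v \<in> V \<Longrightarrow> (\<Sum>u\<in>U. f u * B v u) = 0"
  shows "(\<Sum>u\<in>U. f u * y u) = 0"
proof -
  obtain c where c: "y = (\<lambda>u. if u \<in> U then (\<Sum>v\<in>V. c v * B v u) else 0)"
    using y by (auto simp: row_space_def)
  have "(\<Sum>u\<in>U. f u * y u) = (\<Sum>u\<in>U. \<Sum>v\<in>V. c v * (f u * B v u))"
    by (simp add: c sum_distrib_left mult_ac)
  also have "\<dots> = (\<Sum>v\<in>V. c v * (\<Sum>u\<in>U. f u * B v u))"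
    by (subst sum.swap) (simp add: sum_distrib_left)
  finally show ?thesis by (simp add: f)
qed

lemma row_space_row:
  "finite V \<Longrightarrow> v \<in> V \<Longrightarrow> (\<lambda>u. if u \<in> U then B v u else 0) \<in> row_space V U B"
  unfolding row_space_def
  by (intro CollectI exI[of _ "\<lambda>w. of_bool (w = v)"]) (auto simp: fun_eq_iff of_bool_def sum.delta' if_distrib[of "\<lambda>x. x * _"] cong: if_cong)

lemma row_space_add_mult:
  assumes "y \<in> row_space V U B" "z \<in> row_space V U B"
  shows "(\<lambda>u. y u + t * z u) \<in> row_space V U B"
proof -
  obtain c c' where "y = (\<lambda>u. if u \<in> U then (\<Sum>v\<in>V. c v * B v u) else 0)"
    "z = (\<lambda>u. if u \<in> U then (\<Sum>v\<in>V. c' v * B v u) else 0)"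
    using assms by (auto simp: row_space_def)
  then show ?thesis unfolding row_space_def
    by (intro CollectI exI[of _ "\<lambda>v. c v + t * c' v"])
       (auto simp: fun_eq_iff sum.distrib sum_distrib_left algebra_simps)
qed

lemma row_space_mono:
  assumes "finite W" "V \<subseteq> W"
  shows "row_space V U B \<subseteq> row_space W U B"
proof
  fix y assume "y \<in> row_space V U B"
  then obtain c where c: "y = (\<lambda>u. if u \<in> U then (\<Sum>v\<in>V. c v * B v u) else 0)"
    by (auto simp: row_space_def)
  have *: "(\<Sum>v\<in>V. c v * B v u) = (\<Sum>v\<in>W. (if v \<in> V then c v else 0) * B v u)" for u
    by (rule sum.mono_neutral_cong_left) (use assms in auto)
  show "y \<in> row_space W U B"
    unfolding row_space_def c * by (intro CollectI exI[of _ "\<lambda>v. if v \<in> V then c v else 0"] refl)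
qed

lemma projection_exists:
  assumes "finite V" "finite U"
  shows "\<exists>y\<in>row_space V U B. \<forall>v\<in>V. (\<Sum>u\<in>U. (x u - y u) * B v u) = 0"
  using assms(1)
proof (induction V arbitrary: x)
  case empty
  have "(\<lambda>u. 0) \<in> row_space {} U B" by (auto simp: row_space_def fun_eq_iff)
  then show ?case by blast
next
  case (insert v V)
  obtain y where y: "y \<in> row_space V U B" "\<And>w. w \<in> V \<Longrightarrow> (\<Sum>u\<in>U. (x u - y u) * B w u) = 0"
    using insert.IH[of x] by blast
  obtain z where z: "z \<in> row_space V U B" "\<And>w. w \<in> V \<Longrightarrow> (\<Sum>u\<in>U. (B v u - z u) * B w u) = 0"
    using insert.IH[of "B v"] by blast
  have sub: "row_space V U B \<subseteq> row_space (insert v V) U B"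
    using insert by (intro row_space_mono) auto
  define b where "b u = B v u - z u" for u
  have yz: "(\<Sum>u\<in>U. (x u - y u) * z u) = 0" by (rule row_space_orthogonal[OF z(1) y(2)])
  have bz: "(\<Sum>u\<in>U. b u * z u) = 0" unfolding b_def by (rule row_space_orthogonal[OF z(1) z(2)])
  show ?case
  proof (cases "(\<Sum>u\<in>U. b u * b u) = 0")
    case True
    then have "\<forall>u\<in>U. b u = 0" using assms(2) by (simp add: sum_nonneg_eq_0_iff)
    then have "(\<Sum>u\<in>U. (x u - y u) * B v u) = 0"
      using yz by (simp add: b_def)
    then show ?thesis using y sub by (intro bexI[of _ y]) auto
  next
    case False
    define t where "t = (\<Sum>u\<in>U. (x u - y u) * b u) / (\<Sum>u\<in>U. b u * b u)"
    \<comment> \<open>Elements of the row space vanish outside \<open>U\<close>, whereas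
      \<open>B v\<close> may not; the residual is cut off accordingly and agrees with
      \<open>b\<close> on \<open>U\<close>.\<close>
    define b' where "b' u = (if u \<in> U then B v u else 0) + (- 1) * z u" for u
    have b': "b' u = b u" if "u \<in> U" for u using that by (simp add: b'_def b_def)
    have b'in: "b' \<in> row_space (insert v V) U B"
      unfolding b'_def using insert z(1) sub by (intro row_space_add_mult row_space_row) auto
    have orth: "(\<Sum>u\<in>U. (x u - (y u + t * b' u)) * g u) = (\<Sum>u\<in>U. (x u - y u) * g u) - t * (\<Sum>u\<in>U. b u * g u)" for g
      by (simp add: sum_distrib_left b' algebra_simps flip: sum_subtractf)
    have "(\<Sum>u\<in>U. (x u - (y u + t * b' u)) * B v u)
        = (\<Sum>u\<in>U. (x u - (y u + t * b' u)) * b u) + (\<Sum>u\<in>U. (x u - (y u + t * b' u)) * z u)"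
      by (simp add: b_def algebra_simps flip: sum.distrib)
    also have "\<dots> = 0" unfolding orth yz bz using False by (simp add: t_def)
    finally have "(\<Sum>u\<in>U. (x u - (y u + t * b' u)) * B v u) = 0" .
    moreover have "(\<Sum>u\<in>U. (x u - (y u + t * b' u)) * B w u) = 0" if "w \<in> V" for w
      unfolding orth y(2)[OF that] using z(2)[OF that] by (simp add: b_def)
    moreover have "(\<lambda>u. y u + t * b' u) \<in> row_space (insert v V) U B"
      using y(1) sub b'in by (intro row_space_add_mult) auto
    ultimately show ?thesis by (intro bexI[of _ "\<lambda>u. y u + t * b' u"]) auto
  qed
qed

text \<open>Existence and uniqueness give meaning to the definite description in
  \<open>proj_H\<close>. Afterwards the projection is accessed through these two properties
  only.\<close>

lemma proj_H_spec:
  assumes V: "finite V" and U: "finite U"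
  shows "proj_H V U B x \<in> row_space V U B" (is ?in)
    and "v \<in> V \<Longrightarrow> (\<Sum>u\<in>U. proj_H V U B x u * B v u) = (\<Sum>u\<in>U. x u * B v u)"
proof -
  let ?P = "\<lambda>y. y \<in> row_space V U B \<and> (\<forall>h\<in>row_space V U B. innerU U (\<lambda>u. x u - y u) h = 0)"
  obtain y where y: "y \<in> row_space V U B" "\<And>v. v \<in> V \<Longrightarrow> (\<Sum>u\<in>U. (x u - y u) * B v u) = 0"
    using projection_exists[OF V U] by blast
  have Py: "?P y" using y row_space_orthogonal[of _ V U B "\<lambda>u. x u - y u"] by (auto simp: innerU_def)
  have "y' = y" if "?P y'" for y'
  proof -
    define d where "d u = y u + (- 1) * y' u" for u
    have d: "d \<in> row_space V U B" unfolding d_def using that Py by (intro row_space_add_mult) auto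
    then have "innerU U (\<lambda>u. x u - y u) d = 0" "innerU U (\<lambda>u. x u - y' u) d = 0" using that Py by auto
    moreover have "(\<Sum>u\<in>U. d u * d u) = innerU U (\<lambda>u. x u - y' u) d - innerU U (\<lambda>u. x u - y u) d"
      unfolding innerU_def sum_subtractf[symmetric]
      by (intro sum.cong refl) (simp add: d_def algebra_simps)
    ultimately have "(\<Sum>u\<in>U. d u * d u) = 0" by simp
    then have "\<forall>u\<in>U. d u = 0" using U by (simp add: sum_nonneg_eq_0_iff)
    moreover have "\<forall>u. u \<notin> U \<longrightarrow> y u = 0 \<and> y' u = 0" using that Py by (auto simp: row_space_def)
    ultimately have "y' u = y u" for u by (cases "u \<in> U") (auto simp: d_def)
    then show "y' = y" by blast
  qed
  then have P: "?P (proj_H V U B x)" unfolding proj_H_def by (rule theI[of ?P, OF Py])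
  then show ?in by blast
  assume "v \<in> V"
  then have "innerU U (\<lambda>u. x u - proj_H V U B x u) (\<lambda>u. if u \<in> U then B v u else 0) = 0"
    using P row_space_row[OF V] by blast
  then show "(\<Sum>u\<in>U. proj_H V U B x u * B v u) = (\<Sum>u\<in>U. x u * B v u)"
    by (simp add: innerU_def algebra_simps sum_subtractf)
qed

lemma mat_rank_attained:
  assumes "finite V"
  obtains W where "W \<subseteq> V" "rows_lin_indep W U B" "card W = mat_rank V U B"
    "\<And>W'. W' \<subseteq> V \<Longrightarrow> rows_lin_indep W' U B \<Longrightarrow> card W' \<le> mat_rank V U B"
proof -
  let ?S = "{card W | W. W \<subseteq> V \<and> rows_lin_indep W U B}"
  have fin: "finite ?S" using assms by (auto intro: finite_subset[of _ "card ` Pow V"])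
  have "card {} \<in> ?S" by (intro CollectI exI[of _ "{}"]) (simp add: rows_lin_indep_def)
  then have "Max ?S \<in> ?S" using fin by (intro Max_in) auto
  then obtain W where "W \<subseteq> V" "rows_lin_indep W U B" "card W = Max ?S" by auto
  moreover have "card W' \<le> Max ?S" if "W' \<subseteq> V" "rows_lin_indep W' U B" for W'
    using fin that by (intro Max_ge) auto
  ultimately show ?thesis using that by (auto simp: mat_rank_def)
qed

context
  fixes V :: "'a set" and U :: "'b set" and B :: "'a \<Rightarrow> 'b \<Rightarrow> real"
  assumes V: "finite V" and U: "finite U"
begin

abbreviation "PP \<equiv> proj_mat V U B"

lemma proj_mat_row_space: "(\<lambda>u. PP u w) \<in> row_space V U B"
  unfolding proj_mat_def using proj_H_spec(1)[OF V U] by simp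

lemma proj_mat_row: "v \<in> V \<Longrightarrow> w \<in> U \<Longrightarrow> (\<Sum>u\<in>U. PP u w * B v u) = B v w"
  unfolding proj_mat_def using proj_H_spec(2)[OF V U, of v B "\<lambda>u'. if u' = w then 1 else 0"] U
  by (simp add: if_distrib[of "\<lambda>x. x * _"] sum.delta cong: if_cong)

text \<open>The residual of the unit vector at \<open>w\<close> is orthogonal to the row space, in
  particular to column \<open>u\<close>. As the left side is symmetric in \<open>u\<close> and
  \<open>w\<close>, this one identity yields both symmetry and idempotence.\<close>

lemma proj_mat_gram: "w \<in> U \<Longrightarrow> (\<Sum>z\<in>U. PP z u * PP z w) = PP w u"
proof -
  assume w: "w \<in> U"
  have "(\<Sum>z\<in>U. (PP z w - of_bool (z = w)) * PP z u) = 0"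
    by (rule row_space_orthogonal[OF proj_mat_row_space])
       (use proj_mat_row w U in \<open>simp add: left_diff_distrib sum_subtractf sum.delta'
         of_bool_def if_distrib[of "\<lambda>x. x * _"] cong: if_cong\<close>)
  moreover have "(\<Sum>z\<in>U. (PP z w - of_bool (z = w)) * PP z u) = (\<Sum>z\<in>U. PP z w * PP z u) - PP w u"
    using w U by (simp add: left_diff_distrib sum_subtractf sum.delta' of_bool_def
        if_distrib[of "\<lambda>x. x * _"] cong: if_cong)
  ultimately show ?thesis by (simp add: mult.commute)
qed

lemma proj_mat_sym: "u \<in> U \<Longrightarrow> w \<in> U \<Longrightarrow> PP u w = PP w u"
  using proj_mat_gram[of u w] proj_mat_gram[of w u] by (simp add: mult.commute)

lemma proj_mat_idem: "u \<in> U \<Longrightarrow> w \<in> U \<Longrightarrow> (\<Sum>z\<in>U. PP u z * PP z w) = PP u w"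
  using proj_mat_gram[of w u] proj_mat_sym[of u] by (simp cong: sum.cong)

text \<open>\<open>P\<close> is a product of a coefficient matrix \<open>q\<close> with the rows in
  a maximal independent set \<open>W\<close>. The product in the other order is the identity on
  \<open>W\<close>, and both orders have the same trace.\<close>

lemma proj_mat_trace: "(\<Sum>u\<in>U. PP u u) = real (mat_rank V U B)"
proof -
  obtain W where W: "W \<subseteq> V" "rows_lin_indep W U B" "card W = mat_rank V U B"
    and max: "\<And>W'. W' \<subseteq> V \<Longrightarrow> rows_lin_indep W' U B \<Longrightarrow> card W' \<le> mat_rank V U B"
    using mat_rank_attained[OF V] by metis
  have fW: "finite W" using W V finite_subset by blast
  have row: "\<exists>c. \<forall>u\<in>U. B v u = (\<Sum>w\<in>W. c w * B w u)" if v: "v \<in> V" for v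
  proof (cases "v \<in> W")
    case True
    then show ?thesis using fW
      by (intro exI[of _ "\<lambda>w. of_bool (w = v)"])
         (auto simp: of_bool_def sum.delta' if_distrib[of "\<lambda>x. x * _"] cong: if_cong)
  next
    case False
    have "\<not> rows_lin_indep (insert v W) U B"
      using max[of "insert v W"] W v False fW by auto
    then obtain c where c: "\<And>u. u \<in> U \<Longrightarrow> (\<Sum>w\<in>insert v W. c w * B w u) = 0" "\<exists>w\<in>insert v W. c w \<noteq> 0"
      unfolding rows_lin_indep_def by blast
    then have c': "\<And>u. u \<in> U \<Longrightarrow> c v * B v u + (\<Sum>w\<in>W. c w * B w u) = 0"
      using False fW by simp
    have cv: "c v \<noteq> 0"
    proof
      assume "c v = 0"
      then have "\<forall>w\<in>W. c w = 0" using c' W(2) unfolding rows_lin_indep_def by simp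
      then show False using c(2) \<open>c v = 0\<close> by auto
    qed
    have "B v u = (\<Sum>w\<in>W. (- c w / c v) * B w u)" if "u \<in> U" for u
    proof -
      have "B v u = - (\<Sum>w\<in>W. c w * B w u) / c v"
        using c'[OF that] cv by (simp add: field_simps)
      also have "\<dots> = (\<Sum>w\<in>W. (- c w / c v) * B w u)"
        by (simp add: sum_divide_distrib sum_negf)
      finally show ?thesis .
    qed
    then show ?thesis by (intro exI[of _ "\<lambda>w. - c w / c v"]) auto
  qed
  then obtain c where c: "\<And>v u. v \<in> V \<Longrightarrow> u \<in> U \<Longrightarrow> B v u = (\<Sum>w\<in>W. c v w * B w u)" by metis
  have "\<exists>g. \<forall>u\<in>U. PP u x = (\<Sum>v\<in>V. g v * B v u)" for x
    using proj_mat_row_space[of x] unfolding row_space_def by (auto simp: fun_eq_iff)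
  then obtain g where g: "\<And>x u. u \<in> U \<Longrightarrow> PP u x = (\<Sum>v\<in>V. g x v * B v u)" by metis
  define q where "q x w = (\<Sum>v\<in>V. g x v * c v w)" for x w
  have q: "PP u x = (\<Sum>w\<in>W. q x w * B w u)" if u: "u \<in> U" for u x
  proof -
    have "PP u x = (\<Sum>v\<in>V. g x v * (\<Sum>w\<in>W. c v w * B w u))"
      using g[OF u] c[OF _ u] by simp
    also have "\<dots> = (\<Sum>w\<in>W. q x w * B w u)"
      unfolding sum_distrib_left q_def sum_distrib_right by (subst sum.swap) (simp add: mult_ac)
    finally show ?thesis .
  qed
  define s where "s w w' = (\<Sum>x\<in>U. q x w * B w' x)" for w w'
  \<comment> \<open>\<open>P\<close> fixes row \<open>w'\<close>. Expanding this in the rows of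
    \<open>W\<close> and comparing coefficients is legitimate because they are independent.\<close>
  have s: "s w w' = of_bool (w = w')" if w: "w \<in> W" and w': "w' \<in> W" for w w'
  proof -
    have "\<forall>x\<in>U. (\<Sum>w\<in>W. (s w w' - of_bool (w = w')) * B w x) = 0"
    proof
      fix x assume x: "x \<in> U"
      have "B w' x = (\<Sum>u\<in>U. PP u x * B w' u)" using proj_mat_row[of w' x] w' W x by auto
      also have "\<dots> = (\<Sum>u\<in>U. (\<Sum>w\<in>W. q u w * B w x) * B w' u)"
        using proj_mat_sym[OF _ x] q[OF x] by simp
      also have "\<dots> = (\<Sum>w\<in>W. s w w' * B w x)"
        unfolding sum_distrib_right s_def by (subst sum.swap) (simp add: mult_ac)
      finally have "(\<Sum>w\<in>W. s w w' * B w x) = B w' x" by simp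
      then show "(\<Sum>w\<in>W. (s w w' - of_bool (w = w')) * B w x) = 0"
        using w' fW by (simp add: left_diff_distrib sum_subtractf sum.delta of_bool_def
            if_distrib[of "\<lambda>x. x * _"] cong: if_cong)
    qed
    then have "s w w' - of_bool (w = w') = 0"
      using W(2)[unfolded rows_lin_indep_def, rule_format, of "\<lambda>w. s w w' - of_bool (w = w')" w] w by simp
    then show ?thesis by simp
  qed
  have "(\<Sum>u\<in>U. PP u u) = (\<Sum>u\<in>U. \<Sum>w\<in>W. q u w * B w u)" by (simp add: q)
  also have "\<dots> = (\<Sum>w\<in>W. s w w)" unfolding s_def by (rule sum.swap)
  also have "\<dots> = card W" by (simp add: s)
  finally show ?thesis using W by simp
qed

lemma mat_rank_le: "mat_rank V U B \<le> card V"
  using mat_rank_attained[OF V] card_mono[OF V] by metis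

lemma projection_kernel_proj_mat: "projection_kernel U PP (mat_rank V U B)"
  by unfold_locales (rule U proj_mat_sym proj_mat_idem proj_mat_trace; assumption)+

lemma det_measure_nonneg: "det_measure V U B S \<ge> 0"
  using projection_kernel.det_nonneg[OF projection_kernel_proj_mat] by (simp add: det_measure_def)

text \<open>Apart from nonnegativity, this is all that is used of the determinantal measure.\<close>

lemma det_measure_supersets:
  assumes "A \<subseteq> U"
  shows "(\<Sum>S\<in>Pow U. det_measure V U B S * of_bool (A \<subseteq> S)) = principal_det PP A"
proof -
  have "(\<Sum>S\<in>Pow U. det_measure V U B S * of_bool (A \<subseteq> S))
    = (\<Sum>S | A \<subseteq> S \<and> S \<subseteq> U \<and> card S = mat_rank V U B. principal_det PP S)"
    using U by (intro sum.mono_neutral_cong_right) (auto simp: det_measure_def)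
  then show ?thesis
    by (simp add: projection_kernel.sum_supersets[OF projection_kernel_proj_mat assms])
qed

end

section \<open>The signed bi-regular graph\<close>

locale bireg =
  fixes k d n :: nat and V :: "'a set" and U :: "'b set" and E :: "('a \<times> 'b) set"
    and B :: "'a \<Rightarrow> 'b \<Rightarrow> real"
  assumes graph: "setup_graph k d n V U E B" and k1: "k \<ge> 1" and d0: "d > 0" and n0: "n > 0"
begin

definition nbV :: "'b \<Rightarrow> 'a set" where "nbV u = {v\<in>V. (v, u) \<in> E}"
definition nbU :: "'a \<Rightarrow> 'b set" where "nbU v = {u\<in>U. (v, u) \<in> E}"
definition M :: "'b \<Rightarrow> 'b \<Rightarrow> real" where "M u w = (\<Sum>v\<in>V. B v u * B v w)"
abbreviation P :: "'b \<Rightarrow> 'b \<Rightarrow> real" where "P \<equiv> proj_mat V U B"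

lemma finV: "finite V" and finU: "finite U" and cardV: "card V = n" and EVU: "E \<subseteq> V \<times> U"
  using graph by (auto simp: setup_graph_def)

lemma card_nbU: "v \<in> V \<Longrightarrow> card (nbU v) = d"
  using graph by (auto simp: setup_graph_def nbU_def)

lemma card_nbV: "u \<in> U \<Longrightarrow> card (nbV u) = k + 1"
  using graph by (auto simp: setup_graph_def nbV_def)

lemma nbU_sub: "nbU v \<subseteq> U" and nbV_sub: "nbV u \<subseteq> V"
  by (auto simp: nbU_def nbV_def)

lemma fin_nbU [simp]: "finite (nbU v)" and fin_nbV [simp]: "finite (nbV u)"
  using finite_subset[OF nbU_sub finU] finite_subset[OF nbV_sub finV] by auto

lemma mem_nb: "u \<in> nbU v \<longleftrightarrow> v \<in> nbV u"
  using EVU by (auto simp: nbU_def nbV_def)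

lemma common_nbU: "v \<in> V \<Longrightarrow> v' \<in> V \<Longrightarrow> v \<noteq> v' \<Longrightarrow> card (nbU v \<inter> nbU v') \<le> 1"
proof -
  assume "v \<in> V" "v' \<in> V" "v \<noteq> v'"
  moreover have "nbU v \<inter> nbU v' = {u\<in>U. (v, u) \<in> E \<and> (v', u) \<in> E}" by (auto simp: nbU_def)
  ultimately show ?thesis using graph by (simp add: setup_graph_def)
qed

lemma common_nbV: "u \<in> U \<Longrightarrow> u' \<in> U \<Longrightarrow> u \<noteq> u' \<Longrightarrow> card (nbV u \<inter> nbV u') \<le> 1"
proof -
  assume "u \<in> U" "u' \<in> U" "u \<noteq> u'"
  moreover have "nbV u \<inter> nbV u' = {v\<in>V. (v, u) \<in> E \<and> (v, u') \<in> E}" by (auto simp: nbV_def)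
  ultimately show ?thesis using graph by (simp add: setup_graph_def)
qed

lemma B_eq_0: "v \<in> V \<Longrightarrow> u \<in> U \<Longrightarrow> v \<notin> nbV u \<Longrightarrow> B v u = 0"
  using graph by (simp add: setup_graph_def nbV_def)

lemma B_sq: "u \<in> U \<Longrightarrow> v \<in> nbV u \<Longrightarrow> B v u * B v u = 1"
proof -
  assume "u \<in> U" "v \<in> nbV u"
  then have "B v u \<in> {1, - 1}" using graph by (simp add: setup_graph_def nbV_def)
  then show ?thesis by auto
qed

lemma M_common:
  assumes "u \<in> U" "w \<in> U"
  shows "M u w = (\<Sum>v\<in>nbV u \<inter> nbV w. B v u * B v w)"
  unfolding M_def
  by (rule sum.mono_neutral_right) (use assms finV nbV_sub B_eq_0 in auto)

lemma M_sym: "M u w = M w u"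
  by (simp add: M_def mult.commute)

lemma M_diag: "u \<in> U \<Longrightarrow> M u u = k + 1"
  by (simp add: M_common B_sq card_nbV)

text \<open>By \<open>C4\<close>-freeness the sum in \<open>M_common\<close> has at most one term,
  and that term is a sign.\<close>

lemma M_sq:
  assumes "u \<in> U" "w \<in> U" "u \<noteq> w"
  shows "(M u w)\<^sup>2 = card (nbV u \<inter> nbV w)"
proof (cases "nbV u \<inter> nbV w = {}")
  case True then show ?thesis using assms by (simp add: M_common)
next
  case False
  then have "card (nbV u \<inter> nbV w) = 1"
    using common_nbV[OF assms] by (simp add: le_Suc_eq)
  then obtain v where v: "nbV u \<inter> nbV w = {v}" by (auto simp: card_1_singleton_iff)
  then have "v \<in> nbV u" "v \<in> nbV w" by blast+
  then have "(B v u * B v u) * (B v w * B v w) = 1"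
    using B_sq[of u v] B_sq[of w v] assms by simp
  then show ?thesis using v assms by (simp add: M_common power2_eq_square mult_ac)
qed

lemma abs_M_le: "u \<in> U \<Longrightarrow> w \<in> U \<Longrightarrow> \<bar>M u w\<bar> \<le> k + 1"
proof (cases "u = w")
  assume "u \<in> U" "w \<in> U" "u \<noteq> w"
  then have "(M u w)\<^sup>2 \<le> 1\<^sup>2" using common_nbV[of u w] by (simp add: M_sq)
  then have "\<bar>M u w\<bar> \<le> 1" by (simp only: abs_le_square_iff[symmetric] abs_one)
  then show ?thesis by simp
qed (simp add: M_diag)

lemma card_U: "card U * (k + 1) = n * d"
proof -
  have "card U * (k + 1) = (\<Sum>u\<in>U. card (nbV u))" by (simp add: card_nbV)
  also have "\<dots> = (\<Sum>u\<in>U. \<Sum>v\<in>V. of_bool (v \<in> nbV u))"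
    using finV by (intro sum.cong refl) (simp add: nbV_def Int_def conj_commute)
  also have "\<dots> = (\<Sum>v\<in>V. \<Sum>u\<in>U. of_bool (u \<in> nbU v))"
    by (subst sum.swap) (simp add: mem_nb)
  also have "\<dots> = (\<Sum>v\<in>V. card (nbU v))"
    using finU by (intro sum.cong refl) (simp add: nbU_def Int_def conj_commute)
  also have "\<dots> = n * d" by (simp add: card_nbU cardV)
  finally show ?thesis .
qed

lemma card_U_real: "real (card U) * (k + 1) = real n * d"
  using card_U by (metis of_nat_mult of_nat_add of_nat_1)

text \<open>Off the diagonal the squares count common neighbours: each of the \<open>k + 1\<close>
  neighbours of \<open>u\<close> has \<open>d - 1\<close> further neighbours. The diagonal adds the
  square of \<open>k + 1\<close>.\<close>

lemma M_row_sq: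
  assumes u: "u \<in> U"
  shows "(\<Sum>w\<in>U. (M u w)\<^sup>2) = real (k + 1) * real (d + k)"
proof -
  have "(\<Sum>w\<in>U - {u}. (M u w)\<^sup>2) = (\<Sum>w\<in>U - {u}. real (card (nbV u \<inter> nbV w)))"
    using u by (intro sum.cong refl M_sq) auto
  also have "\<dots> = (\<Sum>w\<in>U - {u}. \<Sum>v\<in>nbV u. of_bool (v \<in> nbV w))"
    by (simp add: Int_def)
  also have "\<dots> = (\<Sum>v\<in>nbV u. \<Sum>w\<in>U - {u}. of_bool (w \<in> nbU v))"
    by (subst sum.swap) (simp add: mem_nb)
  also have "\<dots> = (\<Sum>v\<in>nbV u. real (d - 1))"
  proof (intro sum.cong refl)
    fix v assume v: "v \<in> nbV u"
    have "(U - {u}) \<inter> {w. w \<in> nbU v} = nbU v - {u}" using nbU_sub by auto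
    moreover have "card (nbU v - {u}) = d - 1"
      using v nbV_sub card_nbU mem_nb by (subst card_Diff_singleton) auto
    ultimately show "(\<Sum>w\<in>U - {u}. of_bool (w \<in> nbU v)) = real (d - 1)"
      using finU by simp
  qed
  also have "\<dots> = (k + 1) * (real d - 1)" using u d0 by (simp add: card_nbV of_nat_diff)
  finally have "(\<Sum>w\<in>U. (M u w)\<^sup>2) = (M u u)\<^sup>2 + (k + 1) * (real d - 1)"
    using finU u by (simp add: sum.remove)
  then show ?thesis using u by (simp add: M_diag power2_eq_square algebra_simps)
qed

sublocale K: projection_kernel U P "mat_rank V U B"
  by (rule projection_kernel_proj_mat[OF finV finU])

lemma PM: "u \<in> U \<Longrightarrow> w \<in> U \<Longrightarrow> (\<Sum>z\<in>U. P u z * M z w) = M u w"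
proof -
  assume u: "u \<in> U" and w: "w \<in> U"
  have "(\<Sum>z\<in>U. P u z * M z w) = (\<Sum>z\<in>U. \<Sum>v\<in>V. B v w * (P z u * B v z))"
    using K.sym[OF u] by (simp add: M_def sum_distrib_left mult_ac)
  also have "\<dots> = (\<Sum>v\<in>V. B v w * (\<Sum>z\<in>U. P z u * B v z))"
    by (subst sum.swap) (simp add: sum_distrib_left)
  also have "\<dots> = (\<Sum>v\<in>V. B v w * B v u)"
    using u by (simp add: proj_mat_row[OF finV finU])
  also have "\<dots> = M u w" by (simp add: M_def mult.commute)
  finally show ?thesis .
qed

text \<open>Since \<open>P M = M\<close> and \<open>P\<close> is idempotent, \<open>(P - M / d)\<^sup>2 = P - 2 M / d + M\<^sup>2 / d\<^sup>2\<close>, whose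
  diagonal and trace are explicit. This makes the diagonal of \<open>P\<close> close to \<open>(k + 1) / d\<close> up to
  an average error of order \<open>1 / d\<^sup>2\<close>, which the Frobenius bound alone would not give.\<close>
lemma row_error:
  assumes u: "u \<in> U"
  shows "(\<Sum>w\<in>U. (P u w - M u w / d)\<^sup>2) = P u u - (k + 1) / d + k * (k + 1) / d\<^sup>2"
proof -
  have "(\<Sum>w\<in>U. (P u w - M u w / d)\<^sup>2)
     = (\<Sum>w\<in>U. P u w * P w u) - 2 / d * (\<Sum>w\<in>U. P u w * M w u) + (\<Sum>w\<in>U. (M u w)\<^sup>2) / d\<^sup>2"
  proof -
    have "(P u w - M u w / d)\<^sup>2 = P u w * P w u - 2 / d * (P u w * M w u) + (M u w)\<^sup>2 / d\<^sup>2" if "w \<in> U" for w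
      unfolding K.sym[OF that u] M_sym[of w u] by (simp add: power2_eq_square algebra_simps diff_divide_distrib)
    then show ?thesis by (simp add: sum.distrib sum_subtractf sum_distrib_left sum_divide_distrib)
  qed
  also have "\<dots> = P u u - 2 / d * (k + 1) + real (k + 1) * real (d + k) / d\<^sup>2"
    using u by (simp add: K.idem PM M_diag M_row_sq)
  also have "\<dots> = P u u - (k + 1) / d + k * (k + 1) / d\<^sup>2"
    using d0 by (simp add: field_simps power2_eq_square)
  finally show ?thesis .
qed

lemma total_error: "(\<Sum>u\<in>U. \<Sum>w\<in>U. (P u w - M u w / d)\<^sup>2) \<le> real n * k / d"
proof -
  have "(\<Sum>u\<in>U. \<Sum>w\<in>U. (P u w - M u w / d)\<^sup>2)
    = real (mat_rank V U B) - (real (card U) * (k + 1)) / d + (real (card U) * (k + 1)) * k / d\<^sup>2"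
    by (simp add: row_error sum.distrib sum_subtractf K.tr algebra_simps)
  also have "\<dots> = real (mat_rank V U B) - n + real n * k / d"
    unfolding card_U_real using d0 by (simp add: power2_eq_square)
  \<comment> \<open>The main terms are the traces of \<open>P\<close> and of \<open>M / d\<close>.
    The first is the rank, which cannot exceed \<open>n\<close> even if the rows of \<open>B\<close>
    are dependent.\<close>
  also have "\<dots> \<le> real n * k / d" using mat_rank_le[OF finV finU, of B] cardV by simp
  finally show ?thesis .
qed

lemma diag_error: "(\<Sum>u\<in>U. \<bar>P u u - (k + 1) / d\<bar>) \<le> 2 * real n * k / d"
proof -
  have "(\<Sum>u\<in>U. \<bar>P u u - (k + 1) / d\<bar>)
      \<le> (\<Sum>u\<in>U. (\<Sum>w\<in>U. (P u w - M u w / d)\<^sup>2) + k * (k + 1) / d\<^sup>2)"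
  proof (rule sum_mono)
    fix u assume u: "u \<in> U"
    have "P u u - (k + 1) / d = (\<Sum>w\<in>U. (P u w - M u w / d)\<^sup>2) - k * (k + 1) / d\<^sup>2"
      using row_error[OF u] by simp
    moreover have "(\<Sum>w\<in>U. (P u w - M u w / d)\<^sup>2) \<ge> 0" by (intro sum_nonneg) simp
    moreover have "real (k * (k + 1)) / real (d\<^sup>2) \<ge> 0" by simp
    ultimately show "\<bar>P u u - (k + 1) / d\<bar> \<le> (\<Sum>w\<in>U. (P u w - M u w / d)\<^sup>2) + k * (k + 1) / d\<^sup>2"
      by linarith
  qed
  also have "\<dots> = (\<Sum>u\<in>U. \<Sum>w\<in>U. (P u w - M u w / d)\<^sup>2) + (real (card U) * (k + 1)) * k / d\<^sup>2"
    by (simp add: sum.distrib algebra_simps)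
  also have "\<dots> \<le> real n * k / d + real n * k / d"
    unfolding card_U_real using total_error d0 by (intro add_mono) (simp_all add: power2_eq_square)
  finally show ?thesis by (simp add: mult_ac)
qed

end

section \<open>Sums over connected configurations\<close>

text \<open>Lists grow at the head: every entry is related to some entry further right.\<close>
fun linked :: "('b \<Rightarrow> 'b \<Rightarrow> bool) \<Rightarrow> 'b list \<Rightarrow> bool" where
  "linked R [] \<longleftrightarrow> True"
| "linked R (x # xs) \<longleftrightarrow> (xs \<noteq> [] \<longrightarrow> (\<exists>y\<in>set xs. R y x)) \<and> linked R xs"

definition linked_lists :: "('b \<Rightarrow> 'b \<Rightarrow> bool) \<Rightarrow> 'b set \<Rightarrow> nat \<Rightarrow> 'b list set" where
  "linked_lists R U N = {xs. length xs = N \<and> set xs \<subseteq> U \<and> linked R xs}"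

locale bounded_degree =
  fixes R :: "'b \<Rightarrow> 'b \<Rightarrow> bool" and U :: "'b set" and D :: real
  assumes fin: "finite U" and R_sym: "\<And>u w. R u w \<Longrightarrow> R w u"
    and degree: "\<And>u. u \<in> U \<Longrightarrow> real (card {w\<in>U. R u w}) \<le> D"
    and D0: "D \<ge> 0"
begin

lemma finite_linked_lists: "finite (linked_lists R U N)"
  by (rule finite_subset[OF _ finite_lists_length_eq[OF fin, of N]]) (auto simp: linked_lists_def)

lemma sum_neighbours_le:
  assumes "\<And>u. u \<in> U \<Longrightarrow> w u \<ge> 0"
  shows "(\<Sum>y\<in>U. \<Sum>x | x \<in> U \<and> R y x. w x) \<le> D * (\<Sum>x\<in>U. w x)"
proof -
  have "(\<Sum>y\<in>U. \<Sum>x | x \<in> U \<and> R y x. w x) = (\<Sum>x\<in>U. \<Sum>y | y \<in> U \<and> R y x. w x)"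
    using fin by (rule sum.swap_restrict[OF _ fin])
  also have "\<dots> \<le> (\<Sum>x\<in>U. D * w x)"
  proof (rule sum_mono)
    fix x assume x: "x \<in> U"
    have "{y \<in> U. R y x} = {y \<in> U. R x y}" using R_sym by blast
    then show "(\<Sum>y | y \<in> U \<and> R y x. w x) \<le> D * w x"
      using degree[OF x] assms[OF x] by (simp add: mult_right_mono)
  qed
  finally show ?thesis by (simp add: sum_distrib_left)
qed

text \<open>The new head may be related to several entries of the tail; summing over all positions
  \<open>i\<close> of a possible partner overcounts, which is harmless for nonnegative
  \<open>g\<close>.\<close>

lemma sum_linked_step:
  assumes N: "N > 0" and g: "\<And>xs. g xs \<ge> (0::real)"
  shows "(\<Sum>xs\<in>linked_lists R U (Suc N). g xs)
    \<le> (\<Sum>i<N. \<Sum>xs\<in>linked_lists R U N. \<Sum>x | x \<in> U \<and> R (xs ! i) x. g (x # xs))"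
proof -
  let ?S = "SIGMA xs:linked_lists R U N. {x\<in>U. \<exists>y\<in>set xs. R y x}"
  have "(\<Sum>xs\<in>linked_lists R U (Suc N). g xs) = (\<Sum>(xs, x)\<in>?S. g (x # xs))"
    by (rule sum.reindex_bij_witness[of _ "\<lambda>(xs, x). x # xs" "\<lambda>xs. (tl xs, hd xs)"])
       (use N in \<open>auto simp: linked_lists_def length_Suc_conv\<close>)
  also have "\<dots> = (\<Sum>xs\<in>linked_lists R U N. \<Sum>x | x \<in> U \<and> (\<exists>y\<in>set xs. R y x). g (x # xs))"
    using fin by (subst sum.Sigma[symmetric]) (auto simp: finite_linked_lists)
  also have "\<dots> \<le> (\<Sum>xs\<in>linked_lists R U N. \<Sum>i<N. \<Sum>x | x \<in> U \<and> R (xs ! i) x. g (x # xs))"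
  proof (rule sum_mono)
    fix xs assume "xs \<in> linked_lists R U N"
    then have len: "length xs = N" by (simp add: linked_lists_def)
    have "(\<Sum>x | x \<in> U \<and> (\<exists>y\<in>set xs. R y x). g (x # xs))
       \<le> (\<Sum>x | x \<in> U \<and> (\<exists>y\<in>set xs. R y x). \<Sum>i | i < N \<and> R (xs ! i) x. g (x # xs))"
    proof (rule sum_mono)
      fix x assume "x \<in> {x \<in> U. \<exists>y\<in>set xs. R y x}"
      then obtain i where i: "i < N" "R (xs ! i) x" using len by (auto simp: in_set_conv_nth)
      then have "(\<Sum>i\<in>{i}. g (x # xs)) \<le> (\<Sum>i | i < N \<and> R (xs ! i) x. g (x # xs))"
        using g by (intro sum_mono2) auto
      then show "g (x # xs) \<le> (\<Sum>i | i < N \<and> R (xs ! i) x. g (x # xs))" by simp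
    qed
    also have "\<dots> \<le> (\<Sum>x\<in>U. \<Sum>i | i < N \<and> R (xs ! i) x. g (x # xs))"
      using fin g by (intro sum_mono2) (auto intro: sum_nonneg)
    also have "\<dots> = (\<Sum>i<N. \<Sum>x | x \<in> U \<and> R (xs ! i) x. g (x # xs))"
      using sum.swap_restrict[OF fin, of "{..<N}" "\<lambda>x i. g (x # xs)" "\<lambda>x i. R (xs ! i) x"] by simp
    finally show "(\<Sum>x | x \<in> U \<and> (\<exists>y\<in>set xs. R y x). g (x # xs)) \<le>
       (\<Sum>i<N. \<Sum>x | x \<in> U \<and> R (xs ! i) x. g (x # xs))" .
  qed
  also have "\<dots> = (\<Sum>i<N. \<Sum>xs\<in>linked_lists R U N. \<Sum>x | x \<in> U \<and> R (xs ! i) x. g (x # xs))"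
    by (rule sum.swap)
  finally show ?thesis .
qed

lemma nth_in: "xs \<in> linked_lists R U N \<Longrightarrow> i < N \<Longrightarrow> xs ! i \<in> U"
  by (auto simp: linked_lists_def)

text \<open>With the entry at \<open>p\<close> carrying the weight, each of the other
  \<open>N - 1\<close> entries has at most \<open>D\<close> choices relative to an entry it is
  attached to. The factorial bounds the number of attachment patterns.\<close>

lemma one_pin:
  assumes "p < N" "\<And>u. w u \<ge> 0"
  shows "(\<Sum>xs\<in>linked_lists R U N. w (xs ! p)) \<le> fact (N - 1) * D ^ (N - 1) * (\<Sum>u\<in>U. w u)"
  using assms
proof (induction N arbitrary: p w)
  case 0 then show ?case by simp
next
  case (Suc N)
  show ?case
  proof (cases "N = 0")
    case True
    have "(\<Sum>xs\<in>linked_lists R U (Suc N). w (xs ! p)) = (\<Sum>u\<in>U. w u)"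
      by (rule sum.reindex_bij_witness[of _ "\<lambda>u. [u]" "hd"])
         (use Suc.prems True in \<open>auto simp: linked_lists_def length_Suc_conv\<close>)
    then show ?thesis using True by simp
  next
    case False
    define S where "S = (\<Sum>u\<in>U. w u)"
    have S0: "S \<ge> 0" unfolding S_def by (intro sum_nonneg Suc.prems)
    let ?b = "fact (N - 1) * D ^ N * S"
    have DN: "D ^ N = D * D ^ (N - 1)"
      using False by (cases N) auto
    then have b: "fact (N - 1) * D ^ (N - 1) * (D * S) = ?b" by simp
    have "(\<Sum>xs\<in>linked_lists R U (Suc N). w (xs ! p))
      \<le> (\<Sum>i<N. \<Sum>xs\<in>linked_lists R U N. \<Sum>x | x \<in> U \<and> R (xs ! i) x. w ((x # xs) ! p))"
      using False Suc.prems by (intro sum_linked_step) auto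
    also have "\<dots> \<le> (\<Sum>i<N. ?b)"
    proof (rule sum_mono)
      fix i assume i: "i \<in> {..<N}"
      show "(\<Sum>xs\<in>linked_lists R U N. \<Sum>x | x \<in> U \<and> R (xs ! i) x. w ((x # xs) ! p)) \<le> ?b"
      proof (cases p)
        case 0
        \<comment> \<open>If the head itself is pinned, its weight is transferred to the entry it
          hangs from; symmetry of \<open>R\<close> limits the cost to a factor
          \<open>D\<close>.\<close>
        define w' where "w' y = (\<Sum>x | x \<in> U \<and> R y x. w x)" for y
        have w'0: "w' y \<ge> 0" for y unfolding w'_def by (intro sum_nonneg Suc.prems)
        have "(\<Sum>xs\<in>linked_lists R U N. w' (xs ! i)) \<le> fact (N - 1) * D ^ (N - 1) * (\<Sum>u\<in>U. w' u)"
          using i w'0 by (intro Suc.IH) auto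
        also have "\<dots> \<le> fact (N - 1) * D ^ (N - 1) * (D * S)"
          unfolding w'_def S_def using Suc.prems D0 by (intro mult_left_mono sum_neighbours_le) auto
        finally show ?thesis unfolding b by (simp add: 0 w'_def)
      next
        case (Suc p')
        have "(\<Sum>xs\<in>linked_lists R U N. \<Sum>x | x \<in> U \<and> R (xs ! i) x. w ((x # xs) ! p))
          \<le> (\<Sum>xs\<in>linked_lists R U N. D * w (xs ! p'))"
        proof (rule sum_mono)
          fix xs assume "xs \<in> linked_lists R U N"
          then have "xs ! i \<in> U" using i nth_in by auto
          from mult_right_mono[OF degree[OF this] Suc.prems(2)]
          show "(\<Sum>x | x \<in> U \<and> R (xs ! i) x. w ((x # xs) ! p)) \<le> D * w (xs ! p')"
            by (simp add: Suc)
        qed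
        also have "\<dots> = D * (\<Sum>xs\<in>linked_lists R U N. w (xs ! p'))"
          by (simp add: sum_distrib_left)
        also have "\<dots> \<le> D * (fact (N - 1) * D ^ (N - 1) * S)"
          unfolding S_def using Suc Suc.prems D0 by (intro mult_left_mono Suc.IH) auto
        finally show ?thesis by (simp add: DN mult_ac)
      qed
    qed
    also have "\<dots> = fact (Suc N - 1) * D ^ (Suc N - 1) * S"
      using False by (simp add: fact_reduce mult_ac)
    finally show ?thesis unfolding S_def .
  qed
qed

text \<open>Two prescribed entries leave \<open>N - 2\<close> free ones. The second factor
  \<open>D\<close> saved here is what allows a sum of squares over pairs, such as the Frobenius
  error, to be spread over configurations.\<close>

lemma two_pin:
  assumes "p < N" "q < N" "p \<noteq> q" "\<And>u v. w u v \<ge> 0"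
  shows "(\<Sum>xs\<in>linked_lists R U N. w (xs ! p) (xs ! q)) \<le> fact (N - 1) * D ^ (N - 2) * (\<Sum>u\<in>U. \<Sum>v\<in>U. w u v)"
  using assms
proof (induction N arbitrary: p q w)
  case 0 then show ?case by simp
next
  case (Suc N)
  have N0: "N > 0" using Suc.prems by auto
  \<comment> \<open>With the head pinned there are two cases. If it hangs from the other pinned
    entry, a single pin remains and the relation between the two may be dropped; otherwise the entry
    \<open>i\<close> it hangs from inherits its role.\<close>
  have head: "(\<Sum>xs\<in>linked_lists R U N. \<Sum>x | x \<in> U \<and> R (xs ! i) x. w x (xs ! q))
      \<le> fact (N - 1) * D ^ (N - 1) * (\<Sum>u\<in>U. \<Sum>v\<in>U. w u v)"
    if i: "i < N" and q: "q < N" and w: "\<And>u v. w u v \<ge> 0" for i q and w :: "'b \<Rightarrow> 'b \<Rightarrow> real"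
  proof (cases "i = q")
    case True
    define w' where "w' y = (\<Sum>x | x \<in> U \<and> R y x. w x y)" for y
    have w'0: "w' y \<ge> 0" for y unfolding w'_def by (intro sum_nonneg w)
    have "(\<Sum>xs\<in>linked_lists R U N. w' (xs ! q)) \<le> fact (N - 1) * D ^ (N - 1) * (\<Sum>u\<in>U. w' u)"
      using q w'0 by (rule one_pin)
    also have "(\<Sum>u\<in>U. w' u) \<le> (\<Sum>y\<in>U. \<Sum>x\<in>U. w x y)"
      unfolding w'_def using fin w by (intro sum_mono sum_mono2) auto
    also have "(\<Sum>y\<in>U. \<Sum>x\<in>U. w x y) = (\<Sum>x\<in>U. \<Sum>y\<in>U. w x y)" by (rule sum.swap)
    finally show ?thesis using D0 True by (simp add: w'_def mult_left_mono)
  next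
    case False
    define w' where "w' y z = (\<Sum>x | x \<in> U \<and> R y x. w x z)" for y z
    have w'0: "w' y z \<ge> 0" for y z unfolding w'_def by (intro sum_nonneg w)
    have "N \<ge> 2" using i q False by linarith
    then have DN: "D ^ (N - 1) = D * D ^ (N - 2)" by (cases N; cases "N - 1") auto
    have "(\<Sum>u\<in>U. \<Sum>v\<in>U. w' u v) = (\<Sum>v\<in>U. \<Sum>u\<in>U. w' u v)" by (rule sum.swap)
    also have "\<dots> \<le> (\<Sum>v\<in>U. D * (\<Sum>u\<in>U. w u v))"
      unfolding w'_def using w by (intro sum_mono sum_neighbours_le) auto
    also have "\<dots> = D * (\<Sum>v\<in>U. \<Sum>u\<in>U. w u v)" by (simp add: sum_distrib_left)
    also have "\<dots> = D * (\<Sum>u\<in>U. \<Sum>v\<in>U. w u v)" by (subst sum.swap) simp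
    finally have *: "(\<Sum>u\<in>U. \<Sum>v\<in>U. w' u v) \<le> D * (\<Sum>u\<in>U. \<Sum>v\<in>U. w u v)" .
    have "(\<Sum>xs\<in>linked_lists R U N. w' (xs ! i) (xs ! q)) \<le> fact (N - 1) * D ^ (N - 2) * (\<Sum>u\<in>U. \<Sum>v\<in>U. w' u v)"
      using i q False w'0 by (intro Suc.IH) auto
    also have "\<dots> \<le> fact (N - 1) * D ^ (N - 2) * (D * (\<Sum>u\<in>U. \<Sum>v\<in>U. w u v))"
      using * D0 by (intro mult_left_mono) auto
    also have "\<dots> = fact (N - 1) * D ^ (N - 1) * (\<Sum>u\<in>U. \<Sum>v\<in>U. w u v)"
      unfolding DN by (simp add: mult_ac)
    finally show ?thesis by (simp add: w'_def)
  qed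
  let ?S = "\<Sum>u\<in>U. \<Sum>v\<in>U. w u v"
  have "(\<Sum>xs\<in>linked_lists R U (Suc N). w (xs ! p) (xs ! q))
    \<le> (\<Sum>i<N. \<Sum>xs\<in>linked_lists R U N. \<Sum>x | x \<in> U \<and> R (xs ! i) x. w ((x # xs) ! p) ((x # xs) ! q))"
    using N0 Suc.prems by (intro sum_linked_step) auto
  also have "\<dots> \<le> (\<Sum>i<N. fact (N - 1) * D ^ (N - 1) * ?S)"
  proof (rule sum_mono)
    fix i assume i: "i \<in> {..<N}"
    consider q' where "p = 0" "q = Suc q'" | p' where "p = Suc p'" "q = 0"
      | p' q' where "p = Suc p'" "q = Suc q'" using Suc.prems(3) by (metis not0_implies_Suc)
    then show "(\<Sum>xs\<in>linked_lists R U N. \<Sum>x | x \<in> U \<and> R (xs ! i) x. w ((x # xs) ! p) ((x # xs) ! q))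
       \<le> fact (N - 1) * D ^ (N - 1) * ?S"
    proof cases
      case 1
      then show ?thesis using head[of i q' w] i Suc.prems by auto
    next
      case 2
      have "?S = (\<Sum>u\<in>U. \<Sum>v\<in>U. w v u)" by (rule sum.swap)
      then show ?thesis using head[of i p' "\<lambda>x y. w y x"] i Suc.prems 2 by auto
    next
      case 3
      then have "N \<ge> 2" using Suc.prems by auto
      then have DN: "D ^ (N - 1) = D * D ^ (N - 2)" by (cases N; cases "N - 1") auto
      have "(\<Sum>xs\<in>linked_lists R U N. \<Sum>x | x \<in> U \<and> R (xs ! i) x. w ((x # xs) ! p) ((x # xs) ! q))
        \<le> (\<Sum>xs\<in>linked_lists R U N. D * w (xs ! p') (xs ! q'))"
      proof (rule sum_mono)
        fix xs assume "xs \<in> linked_lists R U N"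
        then have "xs ! i \<in> U" using i nth_in by auto
        from mult_right_mono[OF degree[OF this] Suc.prems(4)]
        show "(\<Sum>x | x \<in> U \<and> R (xs ! i) x. w ((x # xs) ! p) ((x # xs) ! q)) \<le> D * w (xs ! p') (xs ! q')"
          by (simp add: 3)
      qed
      also have "\<dots> = D * (\<Sum>xs\<in>linked_lists R U N. w (xs ! p') (xs ! q'))"
        by (simp add: sum_distrib_left)
      also have "\<dots> \<le> D * (fact (N - 1) * D ^ (N - 2) * ?S)"
        using 3 Suc.prems D0 by (intro mult_left_mono Suc.IH) auto
      also have "\<dots> = fact (N - 1) * D ^ (N - 1) * ?S"
        unfolding DN by (simp add: mult_ac)
      finally show ?thesis .
    qed
  qed
  also have "\<dots> = fact (Suc N - 1) * D ^ (Suc N - 2) * ?S"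
    using N0 by (simp add: fact_reduce mult_ac)
  finally show ?case .
qed

end

text \<open>Weighted count of the ways to match \<open>j\<close> leaves added in turn: each leaf
  uses a fresh child, with total weight \<open>\<kappa>\<close>, or one of the \<open>q\<close>
  inner vertices still free, which is then no longer available.\<close>

fun death_sum :: "real \<Rightarrow> nat \<Rightarrow> nat \<Rightarrow> real" where
  "death_sum \<kappa> 0 q = 1"
| "death_sum \<kappa> (Suc j) q = \<kappa> * death_sum \<kappa> j q + real q * death_sum \<kappa> j (q - 1)"

text \<open>\<open>death_sum \<kappa> j q / j!\<close> is the coefficient of \<open>z ^ j\<close> in \<open>(1 + z) ^ q * exp (\<kappa> * z)\<close>.\<close>
lemma death_sum_Suc:
  "death_sum \<kappa> (Suc j) (Suc q) = death_sum \<kappa> (Suc j) q + real (Suc j) * death_sum \<kappa> j q"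
proof (induction j arbitrary: q)
  case 0 then show ?case by simp
next
  case (Suc j)
  define X Y where "X = death_sum \<kappa> (Suc j)" and "Y = death_sum \<kappa> j"
  have IH: "X (Suc q) = X q + real (Suc j) * Y q" for q
    unfolding X_def Y_def by (rule Suc.IH)
  have "real q * X q = real q * (X (q - 1) + real (Suc j) * Y (q - 1))"
    using IH by (cases q) auto
  then have "\<kappa> * X (Suc q) + real (Suc q) * X q
     = \<kappa> * X q + real q * X (q - 1) + real (Suc j) * (\<kappa> * Y q + real q * Y (q - 1)) + X q"
    unfolding IH by (simp add: algebra_simps)
  moreover have "X q = \<kappa> * Y q + real q * Y (q - 1)" by (simp add: X_def Y_def)
  ultimately have "\<kappa> * X (Suc q) + real (Suc q) * X q
     = \<kappa> * X q + real q * X (q - 1) + real (Suc (Suc j)) * X q"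
    by (simp add: algebra_simps)
  then show ?case unfolding X_def death_sum.simps(2)[of \<kappa> "Suc j"] by simp
qed

text \<open>At \<open>z = -1\<close> the generating function vanishes unless \<open>q = 0\<close>.
  In the induction \<open>death_sum_Suc\<close> turns the terms for \<open>Suc q\<close> with
  positive index into differences of successive terms for \<open>q\<close>; they telescope to
  \<open>-1\<close> and cancel the term with index 0.\<close>

lemma death_sum_sums:
  "(\<lambda>j. (-1) ^ j * death_sum \<kappa> j q / fact j) sums (if q = 0 then exp (- \<kappa>) else 0)"
proof (induction q)
  case 0
  have "death_sum \<kappa> j 0 = \<kappa> ^ j" for j by (induction j) auto
  then have "(\<lambda>j. (-1) ^ j * death_sum \<kappa> j 0 / fact j) = (\<lambda>j. (- \<kappa>) ^ j /\<^sub>R fact j)"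
    by (simp add: fun_eq_iff divide_inverse mult_ac power_minus')
  then show ?case using exp_converges[of "- \<kappa>"] by simp
next
  case (Suc q)
  let ?f = "\<lambda>j. (-1) ^ j * death_sum \<kappa> j q / fact j"
  let ?s = "if q = 0 then exp (- \<kappa>) else 0"
  have "(\<lambda>j. (-1) ^ Suc j * death_sum \<kappa> (Suc j) (Suc q) / fact (Suc j)) = (\<lambda>j. ?f (Suc j) - ?f j)"
  proof
    fix j
    have "real (Suc j) * x / fact (Suc j) = x / fact j" for x :: real
      by (simp del: of_nat_Suc)
    then show "(-1) ^ Suc j * death_sum \<kappa> (Suc j) (Suc q) / fact (Suc j) = ?f (Suc j) - ?f j"
      unfolding death_sum_Suc distrib_left add_divide_distrib
      by (simp del: death_sum.simps fact_Suc of_nat_Suc add: mult.left_commute[of _ "real (Suc j)"])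
  qed
  moreover have "(\<lambda>j. ?f (Suc j)) sums (?s - ?f 0)"
    by (rule sums_Suc_iff[where f = ?f, THEN iffD2]) (use Suc in simp)
  then have "(\<lambda>j. ?f (Suc j) - ?f j) sums ((?s - ?f 0) - ?s)"
    using Suc by (rule sums_diff)
  ultimately have "(\<lambda>j. (-1) ^ Suc j * death_sum \<kappa> (Suc j) (Suc q) / fact (Suc j)) sums (- 1)" by simp
  from sums_Suc_iff[where f = "\<lambda>j. (-1) ^ j * death_sum \<kappa> j (Suc q) / fact j", THEN iffD1, OF this]
  show ?case by simp
qed

section \<open>Matchings and extra leaves\<close>

context bireg
begin

definition NV :: "'b set \<Rightarrow> 'a set" where "NV A = (\<Union>u\<in>A. nbV u)"

text \<open>Each element of \<open>U\<close> arrives with its whole star and meets the earlier stars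
  in at most one vertex, so no cycle is closed. Only an upper bound is demanded, so new components
  may begin.\<close>

fun forest :: "'b list \<Rightarrow> bool" where
  "forest [] \<longleftrightarrow> True"
| "forest (c # cs) \<longleftrightarrow> c \<notin> set cs \<and> card (nbV c \<inter> NV (set cs)) \<le> 1 \<and> forest cs"

text \<open>Matchings that saturate \<open>A\<close> and avoid \<open>X\<close>, encoded as
  injective choices of a neighbour; extensionality makes them countable as a finite set.\<close>

definition sat :: "'b set \<Rightarrow> 'a set \<Rightarrow> ('b \<Rightarrow> 'a) set" where
  "sat A X = {f \<in> Pi\<^sub>E A (\<lambda>u. nbV u - X). inj_on f A}"

lemma finite_NV [simp]: "finite A \<Longrightarrow> finite (NV A)"
  by (simp add: NV_def)

lemma finite_sat: "finite A \<Longrightarrow> finite (sat A X)"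
  unfolding sat_def by (rule finite_subset[of _ "Pi\<^sub>E A (\<lambda>u. nbV u - X)"]) (auto intro: finite_PiE)

text \<open>If \<open>p\<close> moved the newest vertex \<open>c\<close>, then \<open>f\<close> would send both \<open>c\<close> and its preimage under \<open>p\<close> to
  the only old neighbour of \<open>c\<close>.\<close>
lemma forest_permutation_trivial:
  assumes "forest xs" "p permutes set xs" "inj_on f (set xs)"
    and "\<And>u. u \<in> set xs \<Longrightarrow> f u \<in> nbV u" "\<And>u. u \<in> set xs \<Longrightarrow> f u \<in> nbV (p u)"
  shows "p = id"
  using assms
proof (induction xs arbitrary: p)
  case Nil then show ?case by simp
next
  case (Cons c cs)
  have "p c = c"
  proof (rule ccontr)
    assume pc: "p c \<noteq> c"
    define b where "b = inv p c"
    have pb: "p b = c" unfolding b_def using Cons.prems(2) by (simp add: permutes_inverses)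
    have b: "b \<in> set cs"
      using Cons.prems(2) pb pc permutes_in_image[OF Cons.prems(2), of b] by auto
    have c: "p c \<in> set cs"
      using pc permutes_in_image[OF Cons.prems(2), of c] by auto
    have "f c \<in> nbV c \<inter> NV (set cs)"
      using Cons.prems(4)[of c] Cons.prems(5)[of c] c by (auto simp: NV_def)
    moreover have "f b \<in> nbV c \<inter> NV (set cs)"
      using Cons.prems(4)[of b] Cons.prems(5)[of b] b pb by (auto simp: NV_def)
    moreover have "card (nbV c \<inter> NV (set cs)) \<le> 1" "finite (nbV c \<inter> NV (set cs))"
      using Cons.prems(1) by auto
    ultimately have "f c = f b"
      using card_le_Suc0_iff_eq[of "nbV c \<inter> NV (set cs)"] by (metis One_nat_def)
    then have "c = b" using Cons.prems(3) b by (auto dest: inj_onD)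
    then show False using b Cons.prems(1) by auto
  qed
  then have "p permutes set cs"
    using Cons.prems(1,2) permutes_superset[of p "insert c (set cs)" "set cs"] by auto
  then show ?case using Cons.prems by (intro Cons.IH) auto
qed

lemma principal_det_M_forest:
  assumes xs: "forest xs" "set xs \<subseteq> U"
  shows "principal_det M (set xs) = card (sat (set xs) {})"
proof -
  let ?A = "set xs"
  have "principal_det M ?A = (\<Sum>f\<in>?A \<rightarrow>\<^sub>E V. (\<Prod>u\<in>?A. B (f u) u) * row_det B ?A f)"
    by (rule principal_det_gram) (auto simp: finV M_def)
  also have "\<dots> = (\<Sum>f\<in>sat ?A {}. 1)"
  proof (rule sum.mono_neutral_cong_right)
    show "finite (?A \<rightarrow>\<^sub>E V)" using finV by (simp add: finite_PiE)
    show "sat ?A {} \<subseteq> ?A \<rightarrow>\<^sub>E V" by (auto simp: sat_def PiE_iff nbV_def extensional_def)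
    show "\<forall>f\<in>(?A \<rightarrow>\<^sub>E V) - sat ?A {}. (\<Prod>u\<in>?A. B (f u) u) * row_det B ?A f = 0"
    proof
      fix f assume f: "f \<in> (?A \<rightarrow>\<^sub>E V) - sat ?A {}"
      show "(\<Prod>u\<in>?A. B (f u) u) * row_det B ?A f = 0"
      proof (cases "inj_on f ?A")
        case False
        then obtain u w where "u \<in> ?A" "w \<in> ?A" "u \<noteq> w" "f u = f w" by (auto simp: inj_on_def)
        then show ?thesis using row_det_eq_0[of ?A u w f B] by simp
      next
        case True
        then obtain u where u: "u \<in> ?A" "f u \<notin> nbV u" using f by (auto simp: sat_def PiE_iff)
        then have "B (f u) u = 0" using f xs by (intro B_eq_0) (auto simp: PiE_iff)
        then have "(\<Prod>u\<in>?A. B (f u) u) = 0" using u by (intro prod_zero) auto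
        then show ?thesis by simp
      qed
    qed
    fix f assume f: "f \<in> sat ?A {}"
    then have fV: "u \<in> ?A \<Longrightarrow> f u \<in> nbV u" for u by (auto simp: sat_def PiE_iff)
    have "row_det B ?A f = (\<Sum>p\<in>{id}. of_int (sign p) * (\<Prod>u\<in>?A. B (f u) (p u)))"
      unfolding row_det_def
    proof (rule sum.mono_neutral_right)
      show "finite {p. p permutes ?A}" by (simp add: finite_permutations)
      show "{id} \<subseteq> {p. p permutes ?A}" by (simp add: permutes_id)
      show "\<forall>p\<in>{p. p permutes ?A} - {id}. of_int (sign p) * (\<Prod>u\<in>?A. B (f u) (p u)) = 0"
      proof
        fix p assume p: "p \<in> {p. p permutes ?A} - {id}"
        have "\<exists>u\<in>?A. f u \<notin> nbV (p u)"
          using forest_permutation_trivial[OF xs(1), of p f] p f fV by (auto simp: sat_def)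
        then obtain u where u: "u \<in> ?A" "f u \<notin> nbV (p u)" by blast
        have "p u \<in> U" using p u xs(2) permutes_in_image by fastforce
        then have "B (f u) (p u) = 0" using u fV[OF u(1)] by (intro B_eq_0) (auto simp: nbV_def)
        then have "(\<Prod>u\<in>?A. B (f u) (p u)) = 0" using u by (intro prod_zero) auto
        then show "of_int (sign p) * (\<Prod>u\<in>?A. B (f u) (p u)) = 0" by simp
      qed
    qed
    \<comment> \<open>Since only the identity survives, every entry of \<open>B\<close> occurs
      squared, and the choice of signs has no influence.\<close>
    then have "(\<Prod>u\<in>?A. B (f u) u) * row_det B ?A f = (\<Prod>u\<in>?A. B (f u) u * B (f u) u)"
      by (simp add: prod.distrib)
    also have "\<dots> = 1" using fV xs(2) B_sq by (intro prod.neutral) auto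
    finally show "(\<Prod>u\<in>?A. B (f u) u) * row_det B ?A f = 1" .
  qed
  finally show ?thesis by simp
qed

lemma card_sat_le: "finite A \<Longrightarrow> A \<subseteq> U \<Longrightarrow> card (sat A X) \<le> (k + 1) ^ card A"
proof -
  assume A: "finite A" "A \<subseteq> U"
  have "card (sat A X) \<le> card (Pi\<^sub>E A nbV)"
    by (intro card_mono finite_PiE A) (auto simp: sat_def PiE_iff extensional_def)
  also have "\<dots> = (k + 1) ^ card A" using A card_nbV by (simp add: card_PiE subset_iff)
  finally show ?thesis .
qed

text \<open>Either \<open>c\<close> is matched to one of its \<open>k\<close> neighbours other than
  \<open>v\<close>, which neither conflict with \<open>A\<close> nor lie in \<open>X\<close> because
  they are outside \<open>NV A\<close>, or it takes \<open>v\<close>, which then becomes forbidden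
  for \<open>A\<close>.\<close>

lemma card_sat_insert:
  assumes A: "finite A" "A \<subseteq> U" and c: "c \<in> U" "c \<notin> A" and v: "nbV c \<inter> NV A = {v}"
    and X: "X \<subseteq> NV A"
  shows "card (sat (insert c A) X) = k * card (sat A X) + (if v \<in> X then 0 else card (sat A (insert v X)))"
proof -
  let ?S1 = "(nbV c - {v}) \<times> sat A X"
  let ?S2 = "if v \<in> X then {} else {v} \<times> sat A (insert v X)"
  have fNV: "f u \<in> NV A" if "f \<in> sat A X" "u \<in> A" for f u
    using that by (auto simp: sat_def NV_def PiE_iff)
  have "sat (insert c A) X = (\<lambda>(y, g). g(c := y)) ` (?S1 \<union> ?S2)"
  proof (intro equalityI subsetI)
    fix f assume f: "f \<in> sat (insert c A) X"
    then have "f c \<in> nbV c - X" and inj: "inj_on f (insert c A)"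
      and PiE: "f \<in> Pi\<^sub>E (insert c A) (\<lambda>u. nbV u - X)" by (auto simp: sat_def PiE_iff)
    let ?g = "f(c := undefined)"
    have g: "?g \<in> Pi\<^sub>E A (\<lambda>u. nbV u - X)" using PiE c(2)
      by (auto simp: PiE_iff extensional_def)
    have ginj: "inj_on ?g A" using inj c(2) by (auto simp: inj_on_def)
    have ne: "f u \<noteq> f c" if "u \<in> A" for u using inj that c(2) by (auto simp: inj_on_def)
    have "(f c, ?g) \<in> ?S1 \<union> ?S2"
    proof (cases "f c = v")
      case True
      then have "?g \<in> sat A (insert v X)" using g ginj ne c(2)
        unfolding sat_def PiE_iff by auto
      then show ?thesis using True \<open>f c \<in> nbV c - X\<close> by auto
    next
      case False
      then show ?thesis using g ginj \<open>f c \<in> nbV c - X\<close> by (auto simp: sat_def)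
    qed
    moreover have "f = (\<lambda>(y, g). g(c := y)) (f c, ?g)" by simp
    ultimately show "f \<in> (\<lambda>(y, g). g(c := y)) ` (?S1 \<union> ?S2)" by blast
  next
    fix f assume "f \<in> (\<lambda>(y, g). g(c := y)) ` (?S1 \<union> ?S2)"
    then obtain y g where f: "f = g(c := y)" and yg: "(y, g) \<in> ?S1 \<union> ?S2" by auto
    have gX: "g \<in> sat A X" using yg by (auto simp: sat_def PiE_iff split: if_splits)
    have vc: "v \<in> nbV c" using v by auto
    have y: "y \<in> nbV c - X"
      using yg vc v X by (auto split: if_splits)
    have ynot: "y \<notin> g ` A"
    proof
      assume "y \<in> g ` A"
      then obtain u where u: "u \<in> A" "y = g u" by auto
      then have "y = v" using v y fNV[OF gX] by auto
      then have "g \<in> sat A (insert v X)" using yg by (auto split: if_splits)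
      then show False using u \<open>y = v\<close> by (auto simp: sat_def PiE_iff)
    qed
    have "g \<in> Pi\<^sub>E A (\<lambda>u. nbV u - X)" using gX by (simp add: sat_def)
    then have "f \<in> Pi\<^sub>E (insert c A) (\<lambda>u. nbV u - X)" unfolding f using y by (rule PiE_fun_upd[rotated])
    moreover have "inj_on f (insert c A)"
      unfolding f using gX ynot c(2) by (auto simp: sat_def inj_on_def)
    ultimately show "f \<in> sat (insert c A) X" by (simp add: sat_def)
  qed
  moreover have "inj_on (\<lambda>(y, g). g(c := y)) (?S1 \<union> ?S2)"
  proof (rule inj_on_subset[OF inj_combinator[OF c(2), of "\<lambda>u. nbV u"]])
    show "?S1 \<union> ?S2 \<subseteq> nbV c \<times> Pi\<^sub>E A nbV"
      using v by (auto simp: sat_def PiE_iff extensional_def split: if_splits)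
  qed
  ultimately have "card (sat (insert c A) X) = card (?S1 \<union> ?S2)"
    by (simp add: card_image)
  also have "\<dots> = card ?S1 + card ?S2"
    using A finite_sat by (intro card_Un_disjoint) auto
  also have "card ?S1 = k * card (sat A X)"
  proof -
    have "v \<in> nbV c" using v by auto
    then show ?thesis using c card_nbV[of c] by (simp add: card_cartesian_product card_Diff_singleton)
  qed
  also have "card ?S2 = (if v \<in> X then 0 else card (sat A (insert v X)))"
    by (simp add: card_cartesian_product)
  finally show ?thesis .
qed

section \<open>Extra leaves at the inner vertices\<close>

definition WU :: "'a set \<Rightarrow> 'b set" where "WU K = (\<Union>v\<in>K. nbU v)"

text \<open>\<open>leaf_lists A K j\<close> are the possible extra elements of the random set next to the inner even
  vertices \<open>K\<close> of an embedded tree with odd part \<open>A\<close>. A list is tidy if attaching it keeps the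
  configuration a forest.\<close>
definition leaf_lists :: "'b set \<Rightarrow> 'a set \<Rightarrow> nat \<Rightarrow> 'b list set" where
  "leaf_lists A K j = {cs. length cs = j \<and> distinct cs \<and> set cs \<subseteq> WU K - A}"

fun tidy :: "'b set \<Rightarrow> 'b list \<Rightarrow> bool" where
  "tidy A [] \<longleftrightarrow> True"
| "tidy A (c # cs) \<longleftrightarrow> card (nbV c \<inter> NV (A \<union> set cs)) \<le> 1 \<and> tidy A cs"

definition tidy_lists :: "'b set \<Rightarrow> 'a set \<Rightarrow> nat \<Rightarrow> 'b list set" where
  "tidy_lists A K j = {cs \<in> leaf_lists A K j. tidy A cs}"

lemma WU_sub: "WU K \<subseteq> U" using nbU_sub by (auto simp: WU_def)

lemma finite_WU [simp]: "finite (WU K)" by (rule finite_subset[OF WU_sub finU])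

lemma finite_leaf_lists: "finite (leaf_lists A K j)"
  by (rule finite_subset[OF _ finite_lists_length_eq[of "WU K" j]]) (auto simp: leaf_lists_def)

lemma finite_tidy_lists: "finite (tidy_lists A K j)"
  using finite_leaf_lists by (simp add: tidy_lists_def)

lemma card_WU_le: "finite K \<Longrightarrow> K \<subseteq> V \<Longrightarrow> card (WU K) \<le> card K * d"
  unfolding WU_def using card_UN_le[of K nbU] card_nbU by (simp add: subset_iff)

lemma card_leaf_lists_le: "finite K \<Longrightarrow> K \<subseteq> V \<Longrightarrow> card (leaf_lists A K j) \<le> (card K * d) ^ j"
proof -
  assume K: "finite K" "K \<subseteq> V"
  have "card (leaf_lists A K j) \<le> card {cs. set cs \<subseteq> WU K \<and> length cs = j}"
    by (intro card_mono finite_lists_length_eq) (auto simp: leaf_lists_def)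
  also have "\<dots> = card (WU K) ^ j" by (simp add: card_lists_length_eq)
  also have "\<dots> \<le> (card K * d) ^ j" by (intro power_mono card_WU_le K) simp
  finally show ?thesis .
qed

lemma card_NV_le: "finite A \<Longrightarrow> A \<subseteq> U \<Longrightarrow> card (NV A) \<le> card A * (k + 1)"
  unfolding NV_def using card_UN_le[of A nbV] card_nbV by (simp add: subset_iff)

definition untidy_at :: "'b set \<Rightarrow> 'a \<Rightarrow> 'b set" where
  "untidy_at A v = {c \<in> nbU v. c \<in> A \<or> card (nbV c \<inter> NV A) > 1}"

text \<open>An untidy \<open>c\<close> outside \<open>A\<close> shares with \<open>v\<close> a
  second vertex \<open>y\<close> of \<open>NV A\<close>, and by \<open>C4\<close>-freeness each
  \<open>y\<close> accounts for at most one such \<open>c\<close>. So all but boundedly many of the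
  \<open>d\<close> neighbours of \<open>v\<close> are tidy.\<close>

lemma card_untidy_at_le:
  assumes A: "finite A" "A \<subseteq> U" and v: "v \<in> V"
  shows "card (untidy_at A v) \<le> card A * (k + 2)"
proof -
  have "untidy_at A v \<subseteq> A \<union> (\<Union>y\<in>NV A - {v}. nbU v \<inter> nbU y)"
  proof
    fix c assume c: "c \<in> untidy_at A v"
    show "c \<in> A \<union> (\<Union>y\<in>NV A - {v}. nbU v \<inter> nbU y)"
    proof (cases "c \<in> A")
      case False
      then have "card (nbV c \<inter> NV A) > 1" "c \<in> nbU v" using c by (auto simp: untidy_at_def)
      moreover have "card (nbV c \<inter> NV A) \<le> 1" if "nbV c \<inter> NV A \<subseteq> {v}"
        using card_mono[OF _ that] by simp
      ultimately obtain y where "y \<in> nbV c \<inter> NV A" "y \<noteq> v" by fastforce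
      then show ?thesis using \<open>c \<in> nbU v\<close> mem_nb by blast
    qed auto
  qed
  then have "card (untidy_at A v) \<le> card (A \<union> (\<Union>y\<in>NV A - {v}. nbU v \<inter> nbU y))"
    using A by (intro card_mono) auto
  also have "\<dots> \<le> card A + card (\<Union>y\<in>NV A - {v}. nbU v \<inter> nbU y)" by (rule card_Un_le)
  also have "card (\<Union>y\<in>NV A - {v}. nbU v \<inter> nbU y) \<le> (\<Sum>y\<in>NV A - {v}. card (nbU v \<inter> nbU y))"
    using A by (intro card_UN_le) auto
  also have "\<dots> \<le> (\<Sum>y\<in>NV A - {v}. 1)"
  proof (rule sum_mono)
    fix y assume "y \<in> NV A - {v}"
    then show "card (nbU v \<inter> nbU y) \<le> 1" using v nbV_sub by (intro common_nbU) (auto simp: NV_def)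
  qed
  also have "\<dots> \<le> card A * (k + 1)"
    using card_NV_le[OF A] card_mono[of "NV A" "NV A - {v}"] A by auto
  finally show ?thesis by (simp add: algebra_simps)
qed

text \<open>A tidy leaf touches only one vertex already present, so it determines its parent
  \<open>v\<close> in \<open>K\<close>, and the union over parents is disjoint.\<close>

lemma sum_tidy_lists_Suc:
  assumes A: "finite A" "A \<subseteq> U" and K: "finite K" "K \<subseteq> NV A"
  shows "(\<Sum>ys\<in>tidy_lists A K (Suc j). g ys)
    = (\<Sum>cs\<in>tidy_lists A K j. \<Sum>v\<in>K. \<Sum>c\<in>nbU v - untidy_at (A \<union> set cs) v. (g (c # cs) :: real))"
proof -
  let ?ok = "\<lambda>cs v. nbU v - untidy_at (A \<union> set cs) v"
  have "(\<Sum>ys\<in>tidy_lists A K (Suc j). g ys)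
     = (\<Sum>(cs, c)\<in>(SIGMA cs:tidy_lists A K j. \<Union>v\<in>K. ?ok cs v). g (c # cs))"
  proof (rule sum.reindex_bij_witness[of _ "\<lambda>(cs, c). c # cs" "\<lambda>ys. (tl ys, hd ys)"])
    fix ys assume "ys \<in> tidy_lists A K (Suc j)"
    then obtain c cs where "ys = c # cs" "c # cs \<in> tidy_lists A K (Suc j)"
      by (auto simp: tidy_lists_def leaf_lists_def length_Suc_conv)
    then show "(case (tl ys, hd ys) of (cs, c) \<Rightarrow> c # cs) = ys"
      "(tl ys, hd ys) \<in> (SIGMA cs:tidy_lists A K j. \<Union>v\<in>K. ?ok cs v)"
      "(case (tl ys, hd ys) of (cs, c) \<Rightarrow> g (c # cs)) = g ys"
      by (auto simp: tidy_lists_def leaf_lists_def untidy_at_def WU_def)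
  next
    fix p assume "p \<in> (SIGMA cs:tidy_lists A K j. \<Union>v\<in>K. ?ok cs v)"
    then show "(tl (case p of (cs, c) \<Rightarrow> c # cs), hd (case p of (cs, c) \<Rightarrow> c # cs)) = p"
      "(case p of (cs, c) \<Rightarrow> c # cs) \<in> tidy_lists A K (Suc j)"
      by (auto simp: tidy_lists_def leaf_lists_def untidy_at_def WU_def)
  qed
  also have "\<dots> = (\<Sum>cs\<in>tidy_lists A K j. \<Sum>c\<in>(\<Union>v\<in>K. ?ok cs v). g (c # cs))"
    using K by (subst sum.Sigma[symmetric]) (auto simp: finite_tidy_lists)
  also have "\<dots> = (\<Sum>cs\<in>tidy_lists A K j. \<Sum>v\<in>K. \<Sum>c\<in>?ok cs v. g (c # cs))"
  proof (intro sum.cong refl sum.UNION_disjoint K ballI impI)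
    fix cs v v' assume v: "v \<in> K" "v' \<in> K" "v \<noteq> v'"
    have NV: "v \<in> NV (A \<union> set cs)" "v' \<in> NV (A \<union> set cs)" using v K by (auto simp: NV_def)
    show "?ok cs v \<inter> ?ok cs v' = {}"
    proof (rule ccontr)
      assume "?ok cs v \<inter> ?ok cs v' \<noteq> {}"
      then obtain c where c: "c \<in> nbU v" "c \<in> nbU v'" "c \<notin> untidy_at (A \<union> set cs) v" by auto
      then have "card (nbV c \<inter> NV (A \<union> set cs)) \<le> Suc 0" by (simp add: untidy_at_def)
      then have "\<forall>x\<in>nbV c \<inter> NV (A \<union> set cs). \<forall>y\<in>nbV c \<inter> NV (A \<union> set cs). x = y"
        using card_le_Suc0_iff_eq[of "nbV c \<inter> NV (A \<union> set cs)"] by simp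
      moreover have "v \<in> nbV c" "v' \<in> nbV c" using c mem_nb by blast+
      ultimately show False using NV v by blast
    qed
  qed auto
  finally show ?thesis .
qed

text \<open>A new leaf is matched either to one of its \<open>k\<close> fresh children or to its parent in \<open>K\<close>; in the
  latter case the parent joins the forbidden set \<open>X\<close>.\<close>
fun leaf_limit :: "'b set \<Rightarrow> 'a set \<Rightarrow> nat \<Rightarrow> 'a set \<Rightarrow> real" where
  "leaf_limit A K 0 X = card (sat A X)"
| "leaf_limit A K (Suc j) X = real k * card K * leaf_limit A K j X
     + (\<Sum>v\<in>K - X. leaf_limit A K j (insert v X))"

text \<open>Forbidding one more \<open>v\<close> keeps the matchings \<open>f\<close> that miss
  \<open>v\<close>. After the sums are exchanged, each \<open>f\<close> is counted once for every
  inner vertex it leaves free, which is the second term in the recursion of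
  \<open>death_sum\<close>.\<close>

lemma leaf_limit_eq:
  assumes A: "finite A" and K: "finite K"
  shows "leaf_limit A K j X = (\<Sum>f\<in>sat A X. death_sum (real k * card K) j (card (K - X - f ` A)))"
proof (induction j arbitrary: X)
  case 0 then show ?case by simp
next
  case (Suc j)
  let ?t = "death_sum (real k * card K) j"
  have "(\<Sum>v\<in>K - X. leaf_limit A K j (insert v X))
     = (\<Sum>v\<in>K - X. \<Sum>f | f \<in> sat A X \<and> v \<notin> f ` A. ?t (card (K - X - f ` A) - 1))"
    unfolding Suc
  proof (intro sum.cong refl)
    fix v f assume v: "v \<in> K - X" and f: "f \<in> {f \<in> sat A X. v \<notin> f ` A}"
    have "K - insert v X - f ` A = (K - X - f ` A) - {v}" by auto
    then show "?t (card (K - insert v X - f ` A)) = ?t (card (K - X - f ` A) - 1)"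
      using v f K by (simp add: card_Diff_singleton)
  next
    fix v show "sat A (insert v X) = {f \<in> sat A X. v \<notin> f ` A}"
      by (auto simp: sat_def PiE_iff)
  qed
  also have "\<dots> = (\<Sum>f\<in>sat A X. \<Sum>v | v \<in> K - X \<and> v \<notin> f ` A. ?t (card (K - X - f ` A) - 1))"
    using K finite_sat[OF A] by (intro sum.swap_restrict) auto
  also have "\<dots> = (\<Sum>f\<in>sat A X. real (card (K - X - f ` A)) * ?t (card (K - X - f ` A) - 1))"
  proof (intro sum.cong refl)
    fix f
    have "{v. v \<in> K - X \<and> v \<notin> f ` A} = K - X - f ` A" by auto
    then show "(\<Sum>v | v \<in> K - X \<and> v \<notin> f ` A. ?t (card (K - X - f ` A) - 1))
      = real (card (K - X - f ` A)) * ?t (card (K - X - f ` A) - 1)" by simp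
  qed
  finally show ?case by (simp add: Suc sum.distrib sum_distrib_left)
qed

text \<open>The first term carries the old error through the recursion of \<open>leaf_limit\<close>.
  The second is the loss of the new step: the bound for untidy choices, times the number of lists
  and parents, times the maximal number of matchings.\<close>

fun leaf_err :: "nat \<Rightarrow> nat \<Rightarrow> nat \<Rightarrow> real" where
  "leaf_err a \<kappa> 0 = 0"
| "leaf_err a \<kappa> (Suc j) = \<kappa> * (k + 1) * leaf_err a \<kappa> j + (a + j) * (k + 2) * \<kappa> ^ (j + 1) * (k + 1) ^ (a + j + 1)"

lemma leaf_sum_error:
  assumes A: "finite A" "A \<subseteq> U" and K: "K \<subseteq> NV A" and X: "X \<subseteq> K"
  shows "d * \<bar>(\<Sum>cs\<in>tidy_lists A K j. real (card (sat (A \<union> set cs) X))) - d ^ j * leaf_limit A K j X\<bar>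
     \<le> leaf_err (card A) (card K) j * d ^ j"
  using X
proof (induction j arbitrary: X)
  case 0
  have "tidy_lists A K 0 = {[]}" by (auto simp: tidy_lists_def leaf_lists_def)
  then show ?case by simp
next
  case (Suc j)
  have fK: "finite K" and KV: "K \<subseteq> V"
    using K A finite_subset[OF K finite_NV] by (auto simp: NV_def nbV_def)
  let ?a = "card A" and ?\<kappa> = "card K"
  let ?T = "\<lambda>j X. (\<Sum>cs\<in>tidy_lists A K j. real (card (sat (A \<union> set cs) X)))"
  let ?L = "leaf_limit A K j"
  let ?E = "\<lambda>X. ?T j X - d ^ j * ?L X"
  \<comment> \<open>\<open>t cs v\<close> is the number of matchings after any tidy leaf is attached
    at \<open>v\<close>; it does not depend on the leaf. \<open>g cs v\<close> counts these leaves.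
    The estimate first replaces \<open>g\<close> by \<open>d\<close> and then applies the induction
    hypothesis to \<open>X\<close> and to each \<open>insert v X\<close>.\<close>
  define t where "t cs v = real k * card (sat (A \<union> set cs) X) + (if v \<in> X then 0 else real (card (sat (A \<union> set cs) (insert v X))))" for cs v
  define g where "g cs v = card (nbU v - untidy_at (A \<union> set cs) v)" for cs v
  have cs: "finite (A \<union> set cs)" "A \<union> set cs \<subseteq> U" "card (A \<union> set cs) \<le> ?a + j"
    if "cs \<in> tidy_lists A K j" for cs
  proof -
    have "set cs \<subseteq> U" "length cs = j" using that WU_sub by (auto simp: tidy_lists_def leaf_lists_def)
    then show "finite (A \<union> set cs)" "A \<union> set cs \<subseteq> U" "card (A \<union> set cs) \<le> ?a + j"
      using A card_Un_le[of A "set cs"] card_length[of cs] by auto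
  qed
  have TSuc: "?T (Suc j) X = (\<Sum>cs\<in>tidy_lists A K j. \<Sum>v\<in>K. g cs v * t cs v)"
    unfolding sum_tidy_lists_Suc[OF A fK K]
  proof (intro sum.cong refl)
    fix cs v assume csT: "cs \<in> tidy_lists A K j" and v: "v \<in> K"
    have "(\<Sum>c\<in>nbU v - untidy_at (A \<union> set cs) v. real (card (sat (A \<union> set (c # cs)) X))) =
       (\<Sum>c\<in>nbU v - untidy_at (A \<union> set cs) v. t cs v)"
    proof (intro sum.cong refl)
      fix c assume c: "c \<in> nbU v - untidy_at (A \<union> set cs) v"
      then have "v \<in> nbV c" using mem_nb by blast
      then have "v \<in> nbV c \<inter> NV (A \<union> set cs)" using v K by (auto simp: NV_def)
      moreover have "card (nbV c \<inter> NV (A \<union> set cs)) \<le> 1" using c by (auto simp: untidy_at_def)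
      ultimately have "nbV c \<inter> NV (A \<union> set cs) = {v}"
        by (intro card_subset_eq[symmetric]) (auto simp: le_Suc_eq card_eq_0_iff)
      moreover have "X \<subseteq> NV (A \<union> set cs)" using Suc.prems K by (auto simp: NV_def)
      moreover have "c \<in> U" "c \<notin> A \<union> set cs" using c nbU_sub by (auto simp: untidy_at_def)
      ultimately show "real (card (sat (A \<union> set (c # cs)) X)) = t cs v"
        using card_sat_insert[OF cs(1,2)[OF csT], of c v X] by (simp add: t_def)
    qed
    then show "(\<Sum>c\<in>nbU v - untidy_at (A \<union> set cs) v. real (card (sat (A \<union> set (c # cs)) X))) = g cs v * t cs v"
      by (simp add: g_def)
  qed
  let ?b = "(?a + j) * (k + 2)" and ?m = "(k + 1) ^ (?a + j + 1)"
  have t_bound: "0 \<le> t cs v" "t cs v \<le> ?m" if csT: "cs \<in> tidy_lists A K j" for cs v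
  proof -
    have s: "card (sat (A \<union> set cs) Y) \<le> (k + 1) ^ (?a + j)" for Y
      using card_sat_le[OF cs(1,2)[OF csT], of Y] power_increasing[OF cs(3)[OF csT], of "k + 1"] by simp
    have "t cs v \<le> real k * real ((k + 1) ^ (?a + j)) + real ((k + 1) ^ (?a + j))"
      unfolding t_def using s[of X] s[of "insert v X"] by (intro add_mono mult_left_mono) (auto simp del: of_nat_power)
    then show "t cs v \<le> ?m" by (simp add: algebra_simps)
    show "0 \<le> t cs v" by (simp add: t_def)
  qed
  have g_bound: "\<bar>real (g cs v) - d\<bar> \<le> ?b" if csT: "cs \<in> tidy_lists A K j" and v: "v \<in> K" for cs v
  proof -
    have "untidy_at (A \<union> set cs) v \<subseteq> nbU v" by (auto simp: untidy_at_def)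
    then have "g cs v = card (nbU v) - card (untidy_at (A \<union> set cs) v)"
      "card (untidy_at (A \<union> set cs) v) \<le> card (nbU v)"
      unfolding g_def by (auto intro!: card_Diff_subset card_mono finite_subset[OF _ fin_nbU])
    moreover have "card (nbU v) = d" using v KV by (auto simp: card_nbU)
    moreover have "card (untidy_at (A \<union> set cs) v) \<le> ?b"
      using card_untidy_at_le[OF cs(1,2)[OF csT], of v] v KV cs(3)[OF csT] mult_le_mono1 order_trans by blast
    ultimately have "g cs v \<le> d" "d - g cs v \<le> ?b" by auto
    then have "real (g cs v) \<le> d" "real (d - g cs v) \<le> real ?b" using of_nat_mono by blast+
    then show ?thesis by (simp only: of_nat_diff[OF \<open>g cs v \<le> d\<close>])
  qed
  have t_sum: "(\<Sum>cs\<in>tidy_lists A K j. \<Sum>v\<in>K. t cs v) = real k * ?\<kappa> * ?T j X + (\<Sum>v\<in>K - X. ?T j (insert v X))"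
  proof -
    have "(\<Sum>v\<in>K. if v \<in> X then 0 else real (card (sat (A \<union> set cs) (insert v X))))
       = (\<Sum>v\<in>K - X. real (card (sat (A \<union> set cs) (insert v X))))" for cs
      using fK by (intro sum.mono_neutral_cong_right) auto
    then show ?thesis
      unfolding t_def sum.distrib by (subst (2) sum.swap) (simp add: sum_distrib_left mult_ac)
  qed
  have 1: "\<bar>?T (Suc j) X - d * (\<Sum>cs\<in>tidy_lists A K j. \<Sum>v\<in>K. t cs v)\<bar> \<le> (?\<kappa> * d) ^ j * (?\<kappa> * (?b * ?m))"
  proof -
    have "?T (Suc j) X - d * (\<Sum>cs\<in>tidy_lists A K j. \<Sum>v\<in>K. t cs v)
       = (\<Sum>cs\<in>tidy_lists A K j. \<Sum>v\<in>K. (real (g cs v) - d) * t cs v)"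
      unfolding TSuc by (simp add: sum_distrib_left sum_subtractf left_diff_distrib)
    also have "\<bar>\<dots>\<bar> \<le> (\<Sum>cs\<in>tidy_lists A K j. \<Sum>v\<in>K. \<bar>(real (g cs v) - d) * t cs v\<bar>)"
      by (intro order_trans[OF sum_abs] sum_mono sum_abs)
    also have "\<dots> \<le> (\<Sum>cs\<in>tidy_lists A K j. \<Sum>v\<in>K. real ?b * real ?m)"
      unfolding abs_mult using g_bound t_bound by (intro sum_mono mult_mono) auto
    also have "\<dots> = card (tidy_lists A K j) * (?\<kappa> * (real ?b * real ?m))" by simp
    also have "\<dots> \<le> real ((?\<kappa> * d) ^ j) * (?\<kappa> * (real ?b * real ?m))"
    proof (intro mult_right_mono of_nat_mono)
      have "card (tidy_lists A K j) \<le> card (leaf_lists A K j)"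
        by (intro card_mono finite_leaf_lists) (auto simp: tidy_lists_def)
      then show "card (tidy_lists A K j) \<le> (?\<kappa> * d) ^ j"
        using card_leaf_lists_le[OF fK KV] order_trans by blast
    qed simp
    finally show ?thesis by simp
  qed
  have 2: "d * \<bar>(\<Sum>cs\<in>tidy_lists A K j. \<Sum>v\<in>K. t cs v) - d ^ j * leaf_limit A K (Suc j) X\<bar>
     \<le> ?\<kappa> * (k + 1) * (leaf_err ?a ?\<kappa> j * d ^ j)"
  proof -
    have "(\<Sum>cs\<in>tidy_lists A K j. \<Sum>v\<in>K. t cs v) - d ^ j * leaf_limit A K (Suc j) X
      = real k * ?\<kappa> * ?E X + (\<Sum>v\<in>K - X. ?E (insert v X))"
      unfolding t_sum by (simp add: sum_subtractf sum_distrib_left algebra_simps)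
    then have "\<bar>(\<Sum>cs\<in>tidy_lists A K j. \<Sum>v\<in>K. t cs v) - d ^ j * leaf_limit A K (Suc j) X\<bar>
      \<le> real k * ?\<kappa> * \<bar>?E X\<bar> + (\<Sum>v\<in>K - X. \<bar>?E (insert v X)\<bar>)"
      using abs_triangle_ineq[of "real k * ?\<kappa> * ?E X" "\<Sum>v\<in>K - X. ?E (insert v X)"]
        sum_abs[of "\<lambda>v. ?E (insert v X)" "K - X"] unfolding abs_mult abs_of_nat by linarith
    then have "d * \<bar>(\<Sum>cs\<in>tidy_lists A K j. \<Sum>v\<in>K. t cs v) - d ^ j * leaf_limit A K (Suc j) X\<bar>
      \<le> d * (real k * ?\<kappa> * \<bar>?E X\<bar> + (\<Sum>v\<in>K - X. \<bar>?E (insert v X)\<bar>))"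
      by (intro mult_left_mono) auto
    also have "\<dots> = real k * ?\<kappa> * (d * \<bar>?E X\<bar>) + (\<Sum>v\<in>K - X. d * \<bar>?E (insert v X)\<bar>)"
      by (simp add: distrib_left sum_distrib_left)
    also have "\<dots> \<le> real k * ?\<kappa> * (leaf_err ?a ?\<kappa> j * d ^ j) + (\<Sum>v\<in>K - X. leaf_err ?a ?\<kappa> j * d ^ j)"
      using Suc.prems by (intro add_mono mult_left_mono sum_mono Suc.IH) auto
    also have "(\<Sum>v\<in>K - X. leaf_err ?a ?\<kappa> j * d ^ j) \<le> (\<Sum>v\<in>K. leaf_err ?a ?\<kappa> j * d ^ j)"
    proof -
      have "0 \<le> d * \<bar>?E X\<bar>" by simp
      also have "\<dots> \<le> leaf_err ?a ?\<kappa> j * d ^ j" by (rule Suc.IH[OF Suc.prems])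
      finally show ?thesis using fK by (intro sum_mono2) auto
    qed
    finally show ?thesis by (simp add: algebra_simps)
  qed
  have "\<bar>?T (Suc j) X - d ^ Suc j * leaf_limit A K (Suc j) X\<bar>
    \<le> \<bar>?T (Suc j) X - d * (\<Sum>cs\<in>tidy_lists A K j. \<Sum>v\<in>K. t cs v)\<bar>
      + d * \<bar>(\<Sum>cs\<in>tidy_lists A K j. \<Sum>v\<in>K. t cs v) - d ^ j * leaf_limit A K (Suc j) X\<bar>"
  proof -
    have "d * \<bar>x\<bar> = \<bar>d * x\<bar>" for x :: real by (simp add: abs_mult)
    then show ?thesis
      using abs_triangle_ineq[of "?T (Suc j) X - d * (\<Sum>cs\<in>tidy_lists A K j. \<Sum>v\<in>K. t cs v)"
        "d * ((\<Sum>cs\<in>tidy_lists A K j. \<Sum>v\<in>K. t cs v) - d ^ j * leaf_limit A K (Suc j) X)"]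
      by (simp add: right_diff_distrib del: leaf_limit.simps)
  qed
  also have "\<dots> \<le> (?\<kappa> * d) ^ j * (?\<kappa> * (?b * ?m)) + ?\<kappa> * (k + 1) * (leaf_err ?a ?\<kappa> j * d ^ j)"
    using 1 2 by (intro add_mono) auto
  also have "\<dots> = leaf_err ?a ?\<kappa> (Suc j) * d ^ j"
    by (simp add: power_mult_distrib algebra_simps)
  finally have "d * \<bar>?T (Suc j) X - d ^ Suc j * leaf_limit A K (Suc j) X\<bar> \<le> d * (leaf_err ?a ?\<kappa> (Suc j) * d ^ j)"
    by (rule mult_left_mono) simp
  then show ?case by (simp add: mult_ac del: leaf_limit.simps leaf_err.simps)
qed

fun untidy_err :: "nat \<Rightarrow> nat \<Rightarrow> nat \<Rightarrow> nat" where
  "untidy_err a \<kappa> 0 = 0"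
| "untidy_err a \<kappa> (Suc j) = \<kappa> * untidy_err a \<kappa> j + \<kappa> ^ (j + 1) * ((a + j) * (k + 2))"

text \<open>An untidy list has an untidy tail, or its head is among boundedly many bad choices at
  some \<open>v\<close> in \<open>K\<close>. Either way one factor \<open>d\<close> is lost.\<close>

lemma untidy_error:
  assumes A: "finite A" "A \<subseteq> U" and K: "finite K" "K \<subseteq> V"
  shows "d * card (leaf_lists A K j - tidy_lists A K j) \<le> untidy_err (card A) (card K) j * d ^ j"
proof (induction j)
  case 0
  have "leaf_lists A K 0 - tidy_lists A K 0 = {}" by (auto simp: tidy_lists_def leaf_lists_def)
  then show ?case by (simp only: card.empty)
next
  case (Suc j)
  let ?a = "card A" and ?\<kappa> = "card K" and ?b = "(card A + j) * (k + 2)"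
  let ?D = "leaf_lists A K j - tidy_lists A K j"
  let ?S = "SIGMA cs:leaf_lists A K j. \<Union>v\<in>K. untidy_at (A \<union> set cs) v"
  have finu: "finite (untidy_at B v)" for B v by (rule finite_subset[OF _ fin_nbU[of v]]) (auto simp: untidy_at_def)
  have sub: "leaf_lists A K (Suc j) - tidy_lists A K (Suc j) \<subseteq> (\<lambda>(cs, c). c # cs) ` (?D \<times> WU K \<union> ?S)"
  proof
    fix ys assume ys: "ys \<in> leaf_lists A K (Suc j) - tidy_lists A K (Suc j)"
    then obtain c cs where eq: "ys = c # cs" by (auto simp: leaf_lists_def length_Suc_conv)
    have leaf: "cs \<in> leaf_lists A K j" "c \<in> WU K" using ys eq by (auto simp: leaf_lists_def)
    have "(cs, c) \<in> ?D \<times> WU K \<union> ?S"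
    proof (cases "tidy A cs")
      case False
      then show ?thesis using leaf by (auto simp: tidy_lists_def)
    next
      case True
      then have "card (nbV c \<inter> NV (A \<union> set cs)) > 1"
        using ys unfolding eq by (auto simp: tidy_lists_def)
      then show ?thesis using leaf by (auto simp: untidy_at_def WU_def)
    qed
    then show "ys \<in> (\<lambda>(cs, c). c # cs) ` (?D \<times> WU K \<union> ?S)"
      unfolding eq by (intro image_eqI[of _ _ "(cs, c)"]) auto
  qed
  have fin: "finite (?D \<times> WU K \<union> ?S)"
    using finite_leaf_lists K finu by auto
  have "card (leaf_lists A K (Suc j) - tidy_lists A K (Suc j)) \<le> card (?D \<times> WU K \<union> ?S)"
    using surj_card_le[OF fin sub] .
  also have "\<dots> \<le> card (?D \<times> WU K) + card ?S" by (rule card_Un_le)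
  also have "card (?D \<times> WU K) \<le> card ?D * (?\<kappa> * d)"
    unfolding card_cartesian_product by (intro mult_le_mono card_WU_le K) simp
  also have "card ?S = (\<Sum>cs\<in>leaf_lists A K j. card (\<Union>v\<in>K. untidy_at (A \<union> set cs) v))"
    using finite_leaf_lists K finu by (intro card_SigmaI) auto
  also have "\<dots> \<le> (\<Sum>cs\<in>leaf_lists A K j. ?\<kappa> * ?b)"
  proof (rule sum_mono)
    fix cs assume "cs \<in> leaf_lists A K j"
    then have "set cs \<subseteq> U" "length cs = j" using WU_sub by (auto simp: leaf_lists_def)
    then have cs: "finite (A \<union> set cs)" "A \<union> set cs \<subseteq> U" "card (A \<union> set cs) \<le> ?a + j"
      using A card_Un_le[of A "set cs"] card_length[of cs] by auto
    have "card (\<Union>v\<in>K. untidy_at (A \<union> set cs) v) \<le> (\<Sum>v\<in>K. card (untidy_at (A \<union> set cs) v))"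
      using K by (intro card_UN_le) auto
    also have "\<dots> \<le> (\<Sum>v\<in>K. ?b)"
      using card_untidy_at_le[OF cs(1,2)] cs(3) K(2) mult_le_mono1 order_trans
      by (intro sum_mono) blast
    finally show "card (\<Union>v\<in>K. untidy_at (A \<union> set cs) v) \<le> ?\<kappa> * ?b" by simp
  qed
  also have "\<dots> \<le> (?\<kappa> * d) ^ j * (?\<kappa> * ?b)"
    using card_leaf_lists_le[OF K, of A j] by simp
  finally have "card (leaf_lists A K (Suc j) - tidy_lists A K (Suc j)) \<le> card ?D * (?\<kappa> * d) + (?\<kappa> * d) ^ j * (?\<kappa> * ?b)"
    by simp
  also have "\<dots> = ?\<kappa> * (d * card ?D) + (?\<kappa> * d) ^ j * (?\<kappa> * ?b)" by simp
  also have "\<dots> \<le> ?\<kappa> * (untidy_err ?a ?\<kappa> j * d ^ j) + (?\<kappa> * d) ^ j * (?\<kappa> * ?b)"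
    using Suc by (intro add_mono mult_left_mono) auto
  also have "\<dots> = untidy_err ?a ?\<kappa> (Suc j) * d ^ j" by (simp add: power_mult_distrib algebra_simps)
  finally show ?case by (simp del: untidy_err.simps)
qed

end

section \<open>Embeddings of trees\<close>

lemma sum_fibers_le:
  assumes S: "finite S" and T: "finite T" and g: "g ` S \<subseteq> T"
    and fib: "\<And>h. h \<in> T \<Longrightarrow> card {x \<in> S. g x = h} \<le> C"
    and w: "\<And>h. h \<in> T \<Longrightarrow> w h \<ge> (0::real)"
  shows "(\<Sum>x\<in>S. w (g x)) \<le> real C * (\<Sum>h\<in>T. w h)"
proof -
  have "(\<Sum>x\<in>S. w (g x)) = (\<Sum>h\<in>T. \<Sum>x | x \<in> S \<and> g x = h. w (g x))"
    using sum.group[OF S T g, of "\<lambda>x. w (g x)"] by simp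
  also have "\<dots> = (\<Sum>h\<in>T. real (card {x \<in> S. g x = h}) * w h)" by simp
  also have "\<dots> \<le> (\<Sum>h\<in>T. real C * w h)"
    using fib w by (intro sum_mono mult_right_mono) auto
  finally show ?thesis by (simp add: sum_distrib_left)
qed

text \<open>A tree grown from the root \<open>rt\<close> by attaching odd vertices one at a time (the newest
  at the head of the list), each to one existing even vertex and with fresh children.\<close>
definition even_part :: "'x \<Rightarrow> ('u \<Rightarrow> 'x set) \<Rightarrow> 'u list \<Rightarrow> 'x set" where
  "even_part rt nb us = insert rt (\<Union>u\<in>set us. nb u)"

fun grown :: "'x \<Rightarrow> ('u \<Rightarrow> 'x set) \<Rightarrow> 'x set \<Rightarrow> 'u list \<Rightarrow> bool" where
  "grown rt nb I [] \<longleftrightarrow> True"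
| "grown rt nb I (u # us) \<longleftrightarrow> u \<notin> set us \<and> (\<exists>p\<in>I. nb u \<inter> even_part rt nb us = {p}) \<and> grown rt nb I us"

lemma grown_distinct: "grown rt nb I us \<Longrightarrow> distinct us"
  by (induction us) auto

text \<open>The first vertex ever attached can only hang from \<open>rt\<close>, so the root already
  belongs to some \<open>nb u\<close>.\<close>

lemma grown_root: "grown rt nb I us \<Longrightarrow> us \<noteq> [] \<Longrightarrow> even_part rt nb us = (\<Union>u\<in>set us. nb u)"
proof (induction us)
  case (Cons u us)
  have "rt \<in> (\<Union>w\<in>set (u # us). nb w)"
  proof (cases "us = []")
    case True
    obtain p where "nb u \<inter> even_part rt nb us = {p}" using Cons.prems(1) by auto
    then have "p \<in> nb u" "p \<in> even_part rt nb us" by blast+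
    then show ?thesis using True by (simp add: even_part_def)
  next
    case False
    then have "rt \<in> (\<Union>w\<in>set us. nb w)" using Cons.IH Cons.prems(1) by (simp add: even_part_def) blast
    then show ?thesis by simp
  qed
  then show ?case unfolding even_part_def by (rule insert_absorb)
qed simp

lemma grown_inter:
  assumes "grown rt nb I us" "u \<in> set us" "w \<in> set us" "u \<noteq> w"
  shows "\<exists>p. nb u \<inter> nb w \<subseteq> {p}"
  using assms
proof (induction us)
  case (Cons x us)
  then obtain p where p: "nb x \<inter> even_part rt nb us = {p}" by auto
  have "nb x \<inter> nb y \<subseteq> {p}" if "y \<in> set us" for y using p that by (auto simp: even_part_def)
  then show ?case using Cons by (auto simp: Int_commute)
qed simp

text \<open>Parents lie in \<open>I\<close>, so \<open>R\<close> is required only across vertices of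
  \<open>I\<close>. This serves both the plain relation \<open>share\<close> and a sparser one that
  is available at inner vertices only.\<close>

lemma grown_linked:
  assumes "grown rt nb I us"
    and "\<And>u w p. u \<in> set us \<Longrightarrow> w \<in> set us \<Longrightarrow> p \<in> I \<Longrightarrow> p \<in> nb u \<Longrightarrow> p \<in> nb w \<Longrightarrow> R (f w) (f u)"
  shows "linked R (map f us)"
  using assms
proof (induction us)
  case (Cons u us)
  obtain p where p: "p \<in> I" "nb u \<inter> even_part rt nb us = {p}" using Cons.prems by auto
  have "\<exists>y\<in>f ` set us. R y (f u)" if us: "us \<noteq> []"
  proof -
    have "p \<in> (\<Union>u\<in>set us. nb u)" using grown_root[OF _ us, of rt nb I] p Cons.prems(1) by auto
    then obtain w where "w \<in> set us" "p \<in> nb w" by auto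
    then show ?thesis using Cons.prems(2)[of u w p] p by auto
  qed
  moreover have "linked R (map f us)" using Cons by auto
  ultimately show ?case by simp
qed simp

context bireg
begin

text \<open>Injectivity is imposed on even vertices and whole neighbourhoods of odd vertices are
  matched; injectivity of \<open>q\<close> then follows, see \<open>inj_q\<close>. Both maps are
  extensional so that embeddings can be counted.\<close>

definition embs :: "'x \<Rightarrow> ('u \<Rightarrow> 'x set) \<Rightarrow> 'u list \<Rightarrow> (('x \<Rightarrow> 'a) \<times> ('u \<Rightarrow> 'b)) set" where
  "embs rt nb us = {(e, q). e \<in> even_part rt nb us \<rightarrow>\<^sub>E V \<and> q \<in> set us \<rightarrow>\<^sub>E U \<and>
     inj_on e (even_part rt nb us) \<and> (\<forall>u\<in>set us. e ` nb u = nbV (q u))}"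

lemma finite_embs: "finite (even_part rt nb us) \<Longrightarrow> finite (embs rt nb us)"
  by (rule finite_subset[of _ "(even_part rt nb us \<rightarrow>\<^sub>E V) \<times> (set us \<rightarrow>\<^sub>E U)"])
     (auto simp: embs_def finV finU intro!: finite_PiE)

text \<open>By \<open>C4\<close>-freeness every other vertex of \<open>Y\<close> shares at most one
  neighbour with \<open>v\<close>.\<close>

lemma card_crowded_le:
  assumes Y: "finite Y" "Y \<subseteq> V" and v: "v \<in> Y"
  shows "card {c \<in> nbU v. nbV c \<inter> Y \<noteq> {v}} \<le> card Y"
proof -
  have "{c \<in> nbU v. nbV c \<inter> Y \<noteq> {v}} \<subseteq> (\<Union>y\<in>Y - {v}. nbU v \<inter> nbU y)"
    using v mem_nb by fast
  then have "card {c \<in> nbU v. nbV c \<inter> Y \<noteq> {v}} \<le> card (\<Union>y\<in>Y - {v}. nbU v \<inter> nbU y)"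
    using Y by (intro card_mono) auto
  also have "\<dots> \<le> (\<Sum>y\<in>Y - {v}. card (nbU v \<inter> nbU y))"
    using Y by (intro card_UN_le) auto
  also have "\<dots> \<le> (\<Sum>y\<in>Y - {v}. 1)"
    using Y v by (intro sum_mono common_nbU) auto
  also have "\<dots> \<le> card Y" using Y by (simp add: card_Diff1_le)
  finally show ?thesis .
qed

text \<open>To extend an embedding by \<open>u\<close>, a neighbour \<open>c\<close> of the image of
  the parent is chosen that touches the old image nowhere else, and then a bijection from the
  \<open>k\<close> children onto the \<open>k\<close> remaining neighbours of
  \<open>c\<close>.\<close>

lemma card_embs_Cons:
  assumes g: "grown rt nb I (u # us)" and nb: "\<And>w. w \<in> set (u # us) \<Longrightarrow> card (nb w) = k + 1"
    and p: "nb u \<inter> even_part rt nb us = {p}"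
  shows "card (embs rt nb (u # us)) =
    (\<Sum>(e, q)\<in>embs rt nb us. card {c \<in> nbU (e p). nbV c \<inter> e ` even_part rt nb us = {e p}} * fact k)"
proof -
  let ?V = "even_part rt nb us" and ?N = "nb u - {p}"
  have fnb: "finite (nb w)" if "w \<in> set (u # us)" for w
    using nb[OF that] card.infinite by fastforce
  have fV: "finite ?V" using fnb by (auto simp: even_part_def)
  have fN: "finite ?N" using fnb[of u] by auto
  have cN: "card ?N = k" using nb[of u] p fN by (subst card_Diff_singleton) auto
  have finF: "finite {f \<in> ?N \<rightarrow>\<^sub>E (nbV c - {y}). inj_on f ?N}" for c y
    by (rule finite_subset[of _ "?N \<rightarrow>\<^sub>E (nbV c - {y})"]) (auto intro!: finite_PiE fN)
  have V': "even_part rt nb (u # us) = ?V \<union> ?N" "?V \<inter> ?N = {}" "nb u = insert p ?N" "p \<in> ?V"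
    using p by (auto simp: even_part_def)
  have u: "u \<notin> set us" using g by simp
  let ?ok = "\<lambda>e. {c \<in> nbU (e p). nbV c \<inter> e ` ?V = {e p}}"
  let ?F = "\<lambda>e c. {f \<in> ?N \<rightarrow>\<^sub>E (nbV c - {e p}). inj_on f ?N}"
  let ?T = "SIGMA eq:embs rt nb us. SIGMA c:?ok (fst eq). ?F (fst eq) c"
  have "bij_betw (\<lambda>(e, q). ((restrict e ?V, restrict q (set us)), q u, restrict e ?N)) (embs rt nb (u # us)) ?T"
  proof (rule bij_betw_byWitness[where f' = "\<lambda>((e, q), c, f). (\<lambda>x. if x \<in> ?N then f x else e x, q(u := c))"])
    show "\<forall>a\<in>embs rt nb (u # us). (\<lambda>((e, q), c, f). (\<lambda>x. if x \<in> ?N then f x else e x, q(u := c)))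
       ((\<lambda>(e, q). ((restrict e ?V, restrict q (set us)), q u, restrict e ?N)) a) = a"
      using u by (auto simp: embs_def V'(1) fun_eq_iff PiE_iff extensional_def)
    show "\<forall>a'\<in>?T. (\<lambda>(e, q). ((restrict e ?V, restrict q (set us)), q u, restrict e ?N))
       ((\<lambda>((e, q), c, f). (\<lambda>x. if x \<in> ?N then f x else e x, q(u := c))) a') = a'"
    proof
      fix a' assume "a' \<in> ?T"
      then obtain e q c f where a': "a' = ((e, q), c, f)" "(e, q) \<in> embs rt nb us" "f \<in> ?F e c" by auto
      have "e \<in> extensional ?V" "q \<in> extensional (set us)" "f \<in> extensional ?N"
        using a' by (auto simp: embs_def PiE_iff)
      then show "(\<lambda>(e, q). ((restrict e ?V, restrict q (set us)), q u, restrict e ?N))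
       ((\<lambda>((e, q), c, f). (\<lambda>x. if x \<in> ?N then f x else e x, q(u := c))) a') = a'"
        using V'(2) u unfolding a'(1) by (auto simp: fun_eq_iff extensional_def)
    qed
    show "(\<lambda>(e, q). ((restrict e ?V, restrict q (set us)), q u, restrict e ?N)) ` embs rt nb (u # us) \<subseteq> ?T"
    proof
      fix y assume "y \<in> (\<lambda>(e, q). ((restrict e ?V, restrict q (set us)), q u, restrict e ?N)) ` embs rt nb (u # us)"
      then obtain e q where y: "y = ((restrict e ?V, restrict q (set us)), q u, restrict e ?N)"
        and eq: "(e, q) \<in> embs rt nb (u # us)" by auto
      then have e: "e \<in> ?V \<union> ?N \<rightarrow>\<^sub>E V" "inj_on e (?V \<union> ?N)" and q: "q \<in> set (u # us) \<rightarrow>\<^sub>E U"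
        and nbe': "\<forall>w\<in>set (u # us). e ` nb w = nbV (q w)"
        unfolding embs_def V'(1) by blast+
      have nbe: "e ` nb w = nbV (q w)" if "w \<in> set (u # us)" for w using nbe' that by blast
      have nbq: "nbV (q u) = insert (e p) (e ` ?N)" using nbe[of u] V'(3) by (metis image_insert list.set_intros(1))
      have disj: "e ` ?V \<inter> e ` ?N = {}" using inj_on_image_Int[OF e(2), of ?V ?N] V'(2) by auto
      have nbsub: "nb w \<subseteq> ?V" if "w \<in> set us" for w using that by (auto simp: even_part_def)
      have "restrict e ?V ` nb w = nbV (restrict q (set us) w)" if w: "w \<in> set us" for w
      proof -
        have "restrict e ?V ` nb w = e ` nb w" using nbsub[OF w] by (intro image_cong) auto
        then show ?thesis using nbe[of w] w by simp
      qed
      moreover have "restrict e ?V \<in> ?V \<rightarrow>\<^sub>E V" "restrict q (set us) \<in> set us \<rightarrow>\<^sub>E U"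
        using e(1) q by (auto simp: PiE_iff)
      moreover have "inj_on (restrict e ?V) ?V" using e(2) by (simp add: inj_on_restrict_eq inj_on_Un)
      ultimately have "(restrict e ?V, restrict q (set us)) \<in> embs rt nb us"
        unfolding embs_def by blast
      moreover have "q u \<in> ?ok (restrict e ?V)"
        using nbq disj V'(4) mem_nb[of "q u" "e p"] by auto
      moreover have "restrict e ?N \<in> ?F (restrict e ?V) (q u)"
      proof -
        have "e x \<noteq> e p" if "x \<in> ?N" for x using disj V'(4) that by blast
        then show ?thesis using nbq V'(4) e(2) by (auto simp: inj_on_Un inj_on_restrict_eq)
      qed
      ultimately show "y \<in> ?T" unfolding y by auto
    qed
    show "(\<lambda>((e, q), c, f). (\<lambda>x. if x \<in> ?N then f x else e x, q(u := c))) ` ?T \<subseteq> embs rt nb (u # us)"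
    proof
      fix y assume "y \<in> (\<lambda>((e, q), c, f). (\<lambda>x. if x \<in> ?N then f x else e x, q(u := c))) ` ?T"
      then obtain e q c f where y: "y = (\<lambda>x. if x \<in> ?N then f x else e x, q(u := c))"
        and "(e, q) \<in> embs rt nb us" and c: "c \<in> ?ok e" and f: "f \<in> ?N \<rightarrow>\<^sub>E (nbV c - {e p})" "inj_on f ?N"
        by auto
      then have e: "e \<in> ?V \<rightarrow>\<^sub>E V" "inj_on e ?V" and q: "q \<in> set us \<rightarrow>\<^sub>E U"
        and nbe: "\<And>w. w \<in> set us \<Longrightarrow> e ` nb w = nbV (q w)" unfolding embs_def by blast+
      let ?e = "\<lambda>x. if x \<in> ?N then f x else e x"
      have cU: "c \<in> U" using c nbU_sub by auto
      \<comment> \<open>An injection between sets of size \<open>k\<close> is onto, so the star of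
        the new vertex is filled.\<close>
      have fim: "f ` ?N = nbV c - {e p}"
      proof (rule card_subset_eq)
        show "f ` ?N \<subseteq> nbV c - {e p}" using f by auto
        have "e p \<in> nbV c" using c mem_nb by auto
        then show "card (f ` ?N) = card (nbV c - {e p})"
          using f(2) cN card_nbV[OF cU] by (simp add: card_image)
      qed simp
      have 1: "?e ` nb w = nbV ((q(u := c)) w)" if w: "w \<in> set (u # us)" for w
      proof (cases "w = u")
        case True
        have ep: "e p \<in> nbV c" using c mem_nb by auto
        have eN: "?e ` ?N = f ` ?N" by (intro image_cong) auto
        have "?e ` nb u = insert (?e p) (?e ` ?N)"
          using arg_cong[OF V'(3), of "(`) ?e"] unfolding image_insert .
        also have "?e p = e p" by simp
        also have "insert (e p) (?e ` ?N) = nbV c"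
          unfolding eN fim using ep by (rule insert_Diff)
        finally show ?thesis using True by simp
      next
        case False
        then have "nb w \<subseteq> ?V" using w by (auto simp: even_part_def)
        then have "?e ` nb w = e ` nb w" using V'(2) by (intro image_cong) auto
        then show ?thesis using nbe[of w] w False by simp
      qed
      have 2: "inj_on ?e (?V \<union> ?N)"
      proof -
        have "?e ` ?V = e ` ?V" using V'(2) by (intro image_cong) auto
        moreover have "?e ` ?N = nbV c - {e p}" unfolding fim[symmetric] by (intro image_cong) auto
        moreover have "inj_on ?e ?V" using e(2) V'(2) by (subst inj_on_cong[of _ _ e]) auto
        moreover have "inj_on ?e ?N" using f(2) by (subst inj_on_cong[of _ _ f]) auto
        moreover have "e ` ?V \<inter> (nbV c - {e p}) = {}" using c by auto
        ultimately show ?thesis unfolding inj_on_Un by blast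
      qed
      have 3: "?e \<in> ?V \<union> ?N \<rightarrow>\<^sub>E V" 
        using e(1) f(1) by (auto simp: PiE_iff extensional_def nbV_def)
      have 4: "q(u := c) \<in> set (u # us) \<rightarrow>\<^sub>E U" using q cU by (auto simp: PiE_iff extensional_def)
      show "y \<in> embs rt nb (u # us)"
        unfolding embs_def V'(1) y using 1 2 3 4 by blast
    qed
  qed
  then have "card (embs rt nb (u # us)) = card ?T" by (rule bij_betw_same_card)
  also have "card ?T = (\<Sum>eq\<in>embs rt nb us. card (SIGMA c:?ok (fst eq). ?F (fst eq) c))"
    using fV by (intro card_SigmaI finite_embs) (auto intro!: finite_SigmaI finF)
  also have "\<dots> = (\<Sum>eq\<in>embs rt nb us. card (?ok (fst eq)) * fact k)"
  proof (intro sum.cong refl)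
    fix eq assume "eq \<in> embs rt nb us"
    let ?e = "fst eq"
    have "card (SIGMA c:?ok ?e. ?F ?e c) = (\<Sum>c\<in>?ok ?e. card (?F ?e c))"
      by (intro card_SigmaI) (auto intro: finF)
    also have "\<dots> = (\<Sum>c\<in>?ok ?e. fact k)"
    proof (intro sum.cong refl)
      fix c assume c: "c \<in> ?ok ?e"
      then have "c \<in> U" using nbU_sub by blast
      then have "card (nbV c - {?e p}) = k"
        using card_nbV[of c] c mem_nb[of c "?e p"] by (subst card_Diff_singleton) auto
      then have "card (?F ?e c) = prod ((-) k) {0..<k}"
        using card_inj_on_subset_funcset[OF fN _ subset_refl, of "nbV c - {?e p}"] cN by simp
      also have "\<dots> = fact k" by (simp add: fact_prod_rev)
      finally show "card (?F ?e c) = fact k" .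
    qed
    finally show "card (SIGMA c:?ok ?e. ?F ?e c) = card (?ok ?e) * fact k" by simp
  qed
  finally show ?thesis by (simp add: case_prod_beta)
qed

text \<open>\<open>1 + a * (k + 1)\<close> bounds the number of even vertices present, hence the
  neighbours excluded when the next odd vertex is attached. The other term carries the old error
  along.\<close>

fun emb_err :: "nat \<Rightarrow> real" where
  "emb_err 0 = 0"
| "emb_err (Suc a) = (1 + a * (k + 1)) * fact k ^ (a + 1) + fact k * emb_err a"

lemma card_embs:
  fixes rt :: 'x and nb :: "'u \<Rightarrow> 'x set"
  assumes "grown rt nb I us" and "\<And>w. w \<in> set us \<Longrightarrow> card (nb w) = k + 1"
  shows "card (embs rt nb us) \<le> n * (fact k * d) ^ length us \<and>
    d * \<bar>real (card (embs rt nb us)) - n * (fact k * d) ^ length us\<bar> \<le> emb_err (length us) * n * d ^ length us"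
  using assms
proof (induction us)
  case Nil
  let ?F = "\<lambda>v. (\<lambda>x\<in>{rt}. v, \<lambda>_. undefined) :: ('x \<Rightarrow> 'a) \<times> ('u \<Rightarrow> 'b)"
  have "embs rt nb [] = ?F ` V"
    by (auto simp: embs_def even_part_def fun_eq_iff image_iff PiE_iff extensional_def restrict_def)
  moreover have "inj_on ?F V"
    by (auto simp: inj_on_def fun_eq_iff restrict_def split: if_splits)
  ultimately have "card (embs rt nb []) = n" using cardV by (simp only: card_image)
  then show ?case by simp
next
  case (Cons u us)
  let ?V = "even_part rt nb us" and ?a = "length us"
  obtain p where p: "nb u \<inter> ?V = {p}" using Cons.prems by auto
  then have pV: "p \<in> ?V" by auto
  have fnb: "finite (nb w)" if "w \<in> set (u # us)" for w
    using Cons.prems(2)[OF that] card.infinite by fastforce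
  have fV: "finite ?V" using fnb by (auto simp: even_part_def)
  have cV: "card ?V \<le> 1 + ?a * (k + 1)"
  proof -
    have "card ?V \<le> Suc (card (\<Union>u\<in>set us. nb u))" unfolding even_part_def
      using fnb by (intro card_insert_le_m1) auto
    also have "card (\<Union>u\<in>set us. nb u) \<le> (\<Sum>u\<in>set us. card (nb u))" by (rule card_UN_le) simp
    also have "\<dots> = length us * (k + 1)"
      using Cons.prems grown_distinct[of rt nb I us] by (simp add: distinct_card)
    finally show ?thesis by simp
  qed
  have IH: "card (embs rt nb us) \<le> n * (fact k * d) ^ ?a"
    "d * \<bar>real (card (embs rt nb us)) - n * (fact k * d) ^ ?a\<bar> \<le> emb_err ?a * n * d ^ ?a"
    using Cons by auto
  let ?ok = "\<lambda>e. {c \<in> nbU (e p). nbV c \<inter> e ` ?V = {e p}}"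
  let ?m = "\<Sum>(e, q)\<in>embs rt nb us. card (?ok e)"
  have m: "card (embs rt nb (u # us)) = ?m * fact k"
    using card_embs_Cons[OF Cons.prems p] by (simp add: sum_distrib_right case_prod_beta)
  have ok: "card (?ok e) \<le> d" "d \<le> card (?ok e) + (1 + ?a * (k + 1))" if "(e, q) \<in> embs rt nb us" for e q
  proof -
    have e: "e ` ?V \<subseteq> V" using that by (auto simp: embs_def)
    then have ep: "e p \<in> V" using pV by auto
    have "card (?ok e) \<le> card (nbU (e p))" by (intro card_mono) auto
    then show "card (?ok e) \<le> d" using card_nbU ep by simp
    have "card {c \<in> nbU (e p). nbV c \<inter> e ` ?V \<noteq> {e p}} \<le> card (e ` ?V)"
      using fV e pV by (intro card_crowded_le) auto
    also have "\<dots> \<le> 1 + ?a * (k + 1)" using card_image_le[OF fV, of e] cV by linarith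
    finally have *: "card {c \<in> nbU (e p). nbV c \<inter> e ` ?V \<noteq> {e p}} \<le> 1 + ?a * (k + 1)" .
    have "nbU (e p) = ?ok e \<union> {c \<in> nbU (e p). nbV c \<inter> e ` ?V \<noteq> {e p}}" by auto
    then have "card (nbU (e p)) \<le> card (?ok e) + card {c \<in> nbU (e p). nbV c \<inter> e ` ?V \<noteq> {e p}}"
      by (metis (no_types, lifting) card_Un_le)
    then show "d \<le> card (?ok e) + (1 + ?a * (k + 1))" using * card_nbU[OF ep] by linarith
  qed
  have m1: "?m \<le> card (embs rt nb us) * d"
    using sum_bounded_above[of "embs rt nb us" "\<lambda>(e, q). card (?ok e)" d] ok by auto
  have "(\<Sum>(e, q)\<in>embs rt nb us. d) \<le> (\<Sum>(e, q)\<in>embs rt nb us. card (?ok e) + (1 + ?a * (k + 1)))"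
    using ok by (intro sum_mono) auto
  also have "\<dots> = ?m + card (embs rt nb us) * (1 + ?a * (k + 1))"
    unfolding case_prod_beta sum.distrib by simp
  finally have m2: "card (embs rt nb us) * d \<le> ?m + card (embs rt nb us) * (1 + ?a * (k + 1))"
    by (simp add: case_prod_beta)
  have "card (embs rt nb (u # us)) \<le> n * (fact k * d) ^ length (u # us)"
  proof -
    have "card (embs rt nb (u # us)) \<le> card (embs rt nb us) * d * fact k" unfolding m using m1 by simp
    also have "\<dots> \<le> n * (fact k * d) ^ ?a * d * fact k" using IH(1) by simp
    finally show ?thesis by (simp add: mult_ac)
  qed
  note le = this
  let ?N = "real (card (embs rt nb us))" and ?c = "real (1 + ?a * (k + 1))"
  have m1': "real ?m \<le> ?N * d" using of_nat_mono[OF m1, where ?'a = real] by (simp only: of_nat_mult)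
  have m2': "?N * d \<le> real ?m + ?N * ?c" using of_nat_mono[OF m2, where ?'a = real] by (simp only: of_nat_mult of_nat_add)
  have N1: "?N \<le> n * (fact k * d) ^ ?a" using of_nat_mono[OF IH(1), where ?'a = real] by simp
  have "\<bar>real ?m * fact k - fact k * d * ?N\<bar> \<le> fact k * (?N * ?c)"
  proof -
    have "real ?m * fact k - fact k * d * ?N = - (fact k * (?N * d - real ?m))" by (simp add: algebra_simps)
    then have "\<bar>real ?m * fact k - fact k * d * ?N\<bar> = fact k * (?N * d - real ?m)"
      using m1' by (simp add: abs_mult)
    also have "\<dots> \<le> fact k * (?N * ?c)" using m2' by (intro mult_left_mono) auto
    finally show ?thesis .
  qed
  also have "\<dots> \<le> fact k * (n * (fact k * d) ^ ?a * ?c)"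
    using N1 by (intro mult_left_mono mult_right_mono) auto
  finally have A: "\<bar>real ?m * fact k - fact k * d * ?N\<bar> \<le> fact k * (n * (fact k * d) ^ ?a * ?c)" .
  have "real ?m * fact k - n * (fact k * d) ^ length (u # us)
      = (real ?m * fact k - fact k * d * ?N) + fact k * d * (?N - n * (fact k * d) ^ ?a)"
    by (simp add: algebra_simps)
  then have "\<bar>real ?m * fact k - n * (fact k * d) ^ length (u # us)\<bar>
     \<le> \<bar>real ?m * fact k - fact k * d * ?N\<bar> + fact k * (d * \<bar>?N - n * (fact k * d) ^ ?a\<bar>)"
    using abs_triangle_ineq[of "real ?m * fact k - fact k * d * ?N" "fact k * d * (?N - n * (fact k * d) ^ ?a)"]
    by (simp add: abs_mult)
  also have "\<dots> \<le> fact k * (n * (fact k * d) ^ ?a * ?c) + fact k * (emb_err ?a * n * d ^ ?a)"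
    using A IH(2) by (intro add_mono mult_left_mono) auto
  also have "\<dots> = emb_err (length (u # us)) * n * d ^ ?a"
    by (simp add: power_mult_distrib algebra_simps)
  finally have "d * \<bar>real ?m * fact k - n * (fact k * d) ^ length (u # us)\<bar> \<le> d * (emb_err (length (u # us)) * n * d ^ ?a)"
    by (rule mult_left_mono) simp
  then have "d * \<bar>real (card (embs rt nb (u # us))) - n * (fact k * d) ^ length (u # us)\<bar>
     \<le> emb_err (length (u # us)) * n * d ^ length (u # us)"
    unfolding m by (simp del: emb_err.simps add: mult_ac)
  with le show ?case ..
qed

end

section \<open>Configurations\<close>

text \<open>\<open>I\<close> plays the role of the inner even vertices: every odd vertex hangs below an element of \<open>I\<close>
  (part of \<open>grown\<close>) and every element of \<open>I\<close> has an odd neighbour.\<close>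
locale embedded_tree = bireg k d n V U E B
  for k d n :: nat and V :: "'a set" and U :: "'b set" and E :: "('a \<times> 'b) set"
    and B :: "'a \<Rightarrow> 'b \<Rightarrow> real" +
  fixes rt :: 'x and nb :: "'u \<Rightarrow> 'x set" and us :: "'u list" and I :: "'x set"
  assumes gr: "grown rt nb I us"
    and card_nb: "\<And>u. u \<in> set us \<Longrightarrow> card (nb u) = k + 1"
    and I_cover: "\<And>x. x \<in> I \<Longrightarrow> \<exists>u\<in>set us. x \<in> nb u"
begin

abbreviation "Vt \<equiv> even_part rt nb us"
abbreviation "Emb \<equiv> embs rt nb us"
abbreviation "a \<equiv> length us"
abbreviation "\<kappa> \<equiv> card I"

lemma finite_nb: "u \<in> set us \<Longrightarrow> finite (nb u)"
  using card_nb card.infinite by fastforce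

lemma finite_Vt: "finite Vt" using finite_nb by (auto simp: even_part_def)

lemma I_sub: "I \<subseteq> Vt" using I_cover by (auto simp: even_part_def)

lemma finite_I: "finite I" using I_sub finite_Vt finite_subset by metis

lemma finite_Emb: "finite Emb" by (rule finite_embs[OF finite_Vt])

lemma parent: "u \<in> set us \<Longrightarrow> \<exists>p\<in>I. p \<in> nb u"
proof -
  have "grown rt nb I us' \<Longrightarrow> u \<in> set us' \<Longrightarrow> \<exists>p\<in>I. p \<in> nb u" for us'
    by (induction us') auto
  then show "u \<in> set us \<Longrightarrow> \<exists>p\<in>I. p \<in> nb u" using gr by blast
qed

lemma embD:
  assumes "(e, q) \<in> Emb"
  shows "e \<in> Vt \<rightarrow>\<^sub>E V" "q \<in> set us \<rightarrow>\<^sub>E U" "inj_on e Vt" "\<And>u. u \<in> set us \<Longrightarrow> e ` nb u = nbV (q u)"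
  using assms unfolding embs_def by blast+

lemma nb_sub: "u \<in> set us \<Longrightarrow> nb u \<subseteq> Vt" by (auto simp: even_part_def)

text \<open>Equal images would force equal neighbourhoods in the tree. These have at least two
  elements because \<open>k \<ge> 1\<close>, while distinct odd vertices share at most one.\<close>

lemma inj_q: "(e, q) \<in> Emb \<Longrightarrow> inj_on q (set us)"
proof (rule inj_onI, rule ccontr)
  fix u w assume eq: "(e, q) \<in> Emb" and u: "u \<in> set us" "w \<in> set us" "q u = q w" "u \<noteq> w"
  then have "e ` nb u = e ` nb w" using embD(4)[OF eq] by metis
  then have "nb u = nb w"
    using inj_on_image_eq_iff[OF embD(3)[OF eq] nb_sub[OF u(1)] nb_sub[OF u(2)]] by blast
  then obtain p where "nb u \<subseteq> {p}" using grown_inter[OF gr u(1,2,4)] by auto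
  then have "card (nb u) \<le> 1" using card_mono[of "{p}" "nb u"] by simp
  then show False using card_nb[OF u(1)] k1 by simp
qed

lemma q_image: "(e, q) \<in> Emb \<Longrightarrow> q ` set us \<subseteq> U" "(e, q) \<in> Emb \<Longrightarrow> card (q ` set us) = a"
  using embD(2) inj_q grown_distinct[OF gr] by (auto simp: card_image distinct_card)

lemma e_I: "(e, q) \<in> Emb \<Longrightarrow> e ` I \<subseteq> V" "(e, q) \<in> Emb \<Longrightarrow> card (e ` I) = \<kappa>"
  "(e, q) \<in> Emb \<Longrightarrow> e ` I \<subseteq> NV (q ` set us)"
proof -
  assume eq: "(e, q) \<in> Emb"
  show "e ` I \<subseteq> V" using embD(1)[OF eq] I_sub by auto
  show "card (e ` I) = \<kappa>" using inj_on_subset[OF embD(3)[OF eq] I_sub] by (simp add: card_image)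
  show "e ` I \<subseteq> NV (q ` set us)"
  proof
    fix y assume "y \<in> e ` I"
    then obtain x u where "y = e x" "u \<in> set us" "x \<in> nb u" using I_cover by blast
    then show "y \<in> NV (q ` set us)" using embD(4)[OF eq, of u] by (auto simp: NV_def)
  qed
qed

lemma q_in_WU: "(e, q) \<in> Emb \<Longrightarrow> q ` set us \<subseteq> WU (e ` I)"
proof
  fix c assume eq: "(e, q) \<in> Emb" and "c \<in> q ` set us"
  then obtain u where u: "u \<in> set us" "c = q u" by auto
  obtain p where p: "p \<in> I" "p \<in> nb u" using parent[OF u(1)] by blast
  then have "e p \<in> nbV c" using embD(4)[OF eq u(1)] u(2) by blast
  then show "c \<in> WU (e ` I)" using p mem_nb by (auto simp: WU_def)
qed

lemma forest_emb: "(e, q) \<in> Emb \<Longrightarrow> forest (map q us)"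
proof -
  assume eq: "(e, q) \<in> Emb"
  have "grown rt nb I us' \<Longrightarrow> set us' \<subseteq> set us \<Longrightarrow> forest (map q us')" for us'
  proof (induction us')
    case (Cons u us')
    have u: "u \<in> set us" "u \<notin> set us'" "set us' \<subseteq> set us" using Cons.prems by auto
    obtain p where p: "nb u \<inter> even_part rt nb us' = {p}" using Cons.prems by auto
    have "q u \<notin> q ` set us'" using inj_on_image_mem_iff[OF inj_q[OF eq] u(1,3)] u(2) by simp
    moreover have "nbV (q u) \<inter> NV (q ` set us') \<subseteq> {e p}"
    proof
      fix y assume y: "y \<in> nbV (q u) \<inter> NV (q ` set us')"
      then obtain w where w: "w \<in> set us'" "y \<in> nbV (q w)" by (auto simp: NV_def)
      then obtain x x' where x: "x \<in> nb u" "x' \<in> nb w" "y = e x" "y = e x'"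
        using y embD(4)[OF eq, of u] embD(4)[OF eq, of w] u by blast
      then have "x = x'" using embD(3)[OF eq] nb_sub[of u] nb_sub[of w] u w by (auto dest!: inj_onD)
      then have "x \<in> nb u \<inter> even_part rt nb us'" using x w by (auto simp: even_part_def)
      then show "y \<in> {e p}" using p x by auto
    qed
    then have "card (nbV (q u) \<inter> NV (q ` set us')) \<le> 1" using card_mono[of "{e p}"] by fastforce
    moreover have "forest (map q us')" using Cons by auto
    ultimately show ?case by simp
  qed simp
  then show ?thesis using gr by blast
qed

lemma forest_tidy:
  assumes eq: "(e, q) \<in> Emb" and cs: "cs \<in> tidy_lists (q ` set us) K j"
  shows "forest (cs @ map q us)"
proof -
  have "distinct cs \<Longrightarrow> set cs \<inter> q ` set us = {} \<Longrightarrow> tidy (q ` set us) cs \<Longrightarrow> forest (cs @ map q us)"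
    by (induction cs) (auto simp: forest_emb[OF eq] Un_commute)
  then show ?thesis using cs by (auto simp: tidy_lists_def leaf_lists_def)
qed

definition configs :: "nat \<Rightarrow> ((('x \<Rightarrow> 'a) \<times> ('u \<Rightarrow> 'b)) \<times> 'b list) set" where
  "configs j = (SIGMA eq:Emb. leaf_lists (snd eq ` set us) (fst eq ` I) j)"

text \<open>Lists grow at the head and leaves are attached after the tree, so the leaves come first;
  this order fits both \<open>forest\<close> and \<open>linked\<close>.\<close>

definition odd_list :: "(('x \<Rightarrow> 'a) \<times> ('u \<Rightarrow> 'b)) \<times> 'b list \<Rightarrow> 'b list" where
  "odd_list x = snd x @ map (snd (fst x)) us"

lemma finite_configs: "finite (configs j)"
  unfolding configs_def using finite_Emb finite_leaf_lists by (intro finite_SigmaI) auto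

lemma odd_list_config:
  assumes "((e, q), cs) \<in> configs j"
  shows "distinct (odd_list ((e, q), cs))" "length (odd_list ((e, q), cs)) = j + a"
    "set (odd_list ((e, q), cs)) = q ` set us \<union> set cs" "set (odd_list ((e, q), cs)) \<subseteq> U"
    "set cs \<subseteq> WU (e ` I)" "(e, q) \<in> Emb"
proof -
  show eq: "(e, q) \<in> Emb" using assms by (auto simp: configs_def)
  show "set cs \<subseteq> WU (e ` I)" using assms by (auto simp: configs_def leaf_lists_def)
  then show "set (odd_list ((e, q), cs)) \<subseteq> U" using q_image(1)[OF eq] WU_sub[of "e ` I"] by (auto simp: odd_list_def)
  show "distinct (odd_list ((e, q), cs))" "length (odd_list ((e, q), cs)) = j + a"
    "set (odd_list ((e, q), cs)) = q ` set us \<union> set cs"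
    using assms inj_q[OF eq] grown_distinct[OF gr]
    by (auto simp: configs_def leaf_lists_def odd_list_def distinct_map)
qed

text \<open>The one-vertex tree has no inner vertex to which a leaf could be attached. It is treated
  apart because the pinning bounds presuppose an odd vertex.\<close>

lemma no_leaf: "us = [] \<Longrightarrow> configs j \<noteq> {} \<Longrightarrow> j = 0"
proof -
  assume us: "us = []" and "configs j \<noteq> {}"
  then obtain e q cs where c: "((e, q), cs) \<in> configs j" by fastforce
  have "I = {}" using I_cover us by auto
  then have "set cs = {}" using odd_list_config(5)[OF c] by (simp add: WU_def)
  then show "j = 0" using c by (auto simp: configs_def leaf_lists_def)
qed

section \<open>Configurations as linked lists\<close>

definition share :: "'b \<Rightarrow> 'b \<Rightarrow> bool" where "share u w \<longleftrightarrow> nbV u \<inter> nbV w \<noteq> {}"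

lemma share_degree: "u \<in> U \<Longrightarrow> card {w \<in> U. share u w} \<le> (k + 1) * d"
proof -
  assume u: "u \<in> U"
  have "{w \<in> U. share u w} \<subseteq> (\<Union>v\<in>nbV u. nbU v)" by (auto simp: share_def mem_nb)
  then have "card {w \<in> U. share u w} \<le> card (\<Union>v\<in>nbV u. nbU v)" by (intro card_mono) auto
  also have "\<dots> \<le> (\<Sum>v\<in>nbV u. card (nbU v))" by (intro card_UN_le) auto
  also have "\<dots> = (\<Sum>v\<in>nbV u. d)" by (intro sum.cong refl card_nbU) (auto simp: nbV_def)
  finally show ?thesis using u by (simp add: card_nbV)
qed

sublocale S: bounded_degree share U "real ((k + 1) * d)"
  by unfold_locales (use finU share_degree in \<open>auto simp: share_def simp del: of_nat_mult of_nat_add mult_Suc\<close>)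

lemma emb_linked:
  assumes eq: "(e, q) \<in> Emb"
    and R: "\<And>u w v. u \<in> q ` set us \<Longrightarrow> w \<in> q ` set us \<Longrightarrow> v \<in> e ` I \<Longrightarrow> v \<in> nbV u \<Longrightarrow> v \<in> nbV w \<Longrightarrow> R u w"
  shows "linked R (map q us)"
  by (rule grown_linked[OF gr]) (use embD(4)[OF eq] R in blast)

lemma linked_appendI:
  "linked R ys \<Longrightarrow> (\<And>c. c \<in> set cs \<Longrightarrow> \<exists>y\<in>set ys. R y c) \<Longrightarrow> linked R (cs @ ys)"
  by (induction cs) auto

lemma odd_list_linked: "x \<in> configs j \<Longrightarrow> odd_list x \<in> linked_lists share U (j + a)"
proof -
  assume x: "x \<in> configs j"
  obtain e q cs where xe: "x = ((e, q), cs)" by (metis surj_pair)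
  note c = odd_list_config[OF x[unfolded xe]]
  have "linked share (cs @ map q us)"
  proof (rule linked_appendI)
    show "linked share (map q us)" by (rule emb_linked[OF c(6)]) (auto simp: share_def)
    fix w assume "w \<in> set cs"
    then have "w \<in> WU (e ` I)" using c(5) by blast
    then obtain v where v: "v \<in> e ` I" "w \<in> nbU v" unfolding WU_def by blast
    then have "v \<in> NV (q ` set us)" using e_I(3)[OF c(6)] by auto
    then show "\<exists>y\<in>set (map q us). share y w" using v mem_nb by (auto simp: NV_def share_def)
  qed
  then show ?thesis using c unfolding xe by (auto simp: linked_lists_def odd_list_def)
qed

abbreviation "Cf \<equiv> (k + 1) ^ card Vt"

text \<open>With an odd vertex present, every even vertex has an odd neighbour \<open>par x\<close>,
  so given \<open>q\<close> its image is one of \<open>k + 1\<close> vertices.\<close>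

lemma card_fiber_Emb:
  assumes us: "us \<noteq> []"
  shows "card {e. (e, q) \<in> Emb} \<le> Cf" "finite {e. (e, q) \<in> Emb}"
proof -
  define par where "par x = (SOME u. u \<in> set us \<and> x \<in> nb u)" for x
  have par: "par x \<in> set us" "x \<in> nb (par x)" if "x \<in> Vt" for x
  proof -
    have "\<exists>u. u \<in> set us \<and> x \<in> nb u" using that grown_root[OF gr us] by auto
    then show "par x \<in> set us" "x \<in> nb (par x)" unfolding par_def by (auto dest!: someI_ex)
  qed
  have sub: "{e. (e, q) \<in> Emb} \<subseteq> (if q \<in> set us \<rightarrow>\<^sub>E U then Pi\<^sub>E Vt (\<lambda>x. nbV (q (par x))) else {})"
  proof
    fix e assume "e \<in> {e. (e, q) \<in> Emb}"
    then have eq: "(e, q) \<in> Emb" by simp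
    have "e x \<in> nbV (q (par x))" if "x \<in> Vt" for x using embD(4)[OF eq] par[OF that] by blast
    then show "e \<in> (if q \<in> set us \<rightarrow>\<^sub>E U then Pi\<^sub>E Vt (\<lambda>x. nbV (q (par x))) else {})"
      using embD(1,2)[OF eq] by (auto simp: PiE_iff)
  qed
  have fin: "finite (if q \<in> set us \<rightarrow>\<^sub>E U then Pi\<^sub>E Vt (\<lambda>x. nbV (q (par x))) else {})"
    using finite_Vt by (auto intro!: finite_PiE)
  show "finite {e. (e, q) \<in> Emb}" by (rule finite_subset[OF sub fin])
  have "card {e. (e, q) \<in> Emb} \<le> card (if q \<in> set us \<rightarrow>\<^sub>E U then Pi\<^sub>E Vt (\<lambda>x. nbV (q (par x))) else {})"
    by (rule card_mono[OF fin sub])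
  also have "\<dots> \<le> Cf"
  proof (cases "q \<in> set us \<rightarrow>\<^sub>E U")
    case True
    then have "(\<Prod>x\<in>Vt. card (nbV (q (par x)))) = (\<Prod>x\<in>Vt. k + 1)"
      using par(1) by (intro prod.cong refl card_nbV) auto
    then show ?thesis using True finite_Vt by (simp add: card_PiE)
  qed simp
  finally show "card {e. (e, q) \<in> Emb} \<le> Cf" .
qed

text \<open>As the number of leaves is known, the list splits into \<open>cs\<close> and the values
  of \<open>q\<close>. Only \<open>e\<close> is lost, and it has at most \<open>Cf\<close>
  values.\<close>

lemma sum_odd_list_le:
  assumes us: "us \<noteq> []" and S: "S \<subseteq> Emb \<times> {cs. length cs = j}" "finite S" and T: "odd_list ` S \<subseteq> T" "finite T"
    and w: "\<And>h. h \<in> T \<Longrightarrow> w h \<ge> (0::real)"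
  shows "(\<Sum>x\<in>S. w (odd_list x)) \<le> real Cf * (\<Sum>h\<in>T. w h)"
proof (rule sum_fibers_le[OF S(2) T(2,1) _ w])
  fix h assume "h \<in> T"
  show "card {x \<in> S. odd_list x = h} \<le> Cf"
  proof (cases "{x \<in> S. odd_list x = h} = {}")
    case False
    then obtain e0 q0 cs0 where x0: "((e0, q0), cs0) \<in> S" "odd_list ((e0, q0), cs0) = h" by auto
    have det: "cs = cs0 \<and> q = q0" if "((e, q), cs) \<in> S" "odd_list ((e, q), cs) = h" for e q cs
    proof -
      have "length cs = length cs0" using that x0 S(1) by auto
      then have "cs = cs0" "map q us = map q0 us" using that x0 by (auto simp: odd_list_def)
      moreover have "(e, q) \<in> Emb" "(e0, q0) \<in> Emb" using that x0 S(1) by auto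
      then have "q \<in> extensional (set us)" "q0 \<in> extensional (set us)"
        using embD(2)[of e q] embD(2)[of e0 q0] by (auto simp: PiE_iff)
      ultimately show ?thesis by (auto intro: extensionalityI)
    qed
    have "{x \<in> S. odd_list x = h} \<subseteq> (\<lambda>e. ((e, q0), cs0)) ` {e. (e, q0) \<in> Emb}"
    proof
      fix x assume x: "x \<in> {x \<in> S. odd_list x = h}"
      obtain e q cs where xe: "x = ((e, q), cs)" by (metis surj_pair)
      show "x \<in> (\<lambda>e. ((e, q0), cs0)) ` {e. (e, q0) \<in> Emb}"
        using x det[of e q cs] S(1) unfolding xe by auto
    qed
    then have "card {x \<in> S. odd_list x = h} \<le> card {e. (e, q0) \<in> Emb}"
      using surj_card_le[OF card_fiber_Emb(2)[OF us]] by blast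
    then show ?thesis using card_fiber_Emb(1)[OF us, of q0] by linarith
  next
    case True
    show ?thesis unfolding True by simp
  qed
qed

lemma sum_configs_le:
  assumes us: "us \<noteq> []" and w: "\<And>h. w h \<ge> (0::real)"
  shows "(\<Sum>x\<in>configs j. w (odd_list x)) \<le> real Cf * (\<Sum>h\<in>linked_lists share U (j + a). w h)"
  by (rule sum_odd_list_le[where j = j, OF us _ finite_configs _ S.finite_linked_lists])
     (use us odd_list_linked w in \<open>auto simp: configs_def leaf_lists_def\<close>)

definition tree_sat :: "('u \<Rightarrow> 'x) set" where
  "tree_sat = {f \<in> Pi\<^sub>E (set us) nb. inj_on f (set us)}"

definition tree_limit :: "nat \<Rightarrow> real" where
  "tree_limit j = (\<Sum>f\<in>tree_sat. death_sum (real k * \<kappa>) j (card (I - f ` set us)))"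

text \<open>Matchings of the embedded tree are carried back to the abstract tree along
  \<open>e\<close> and \<open>q\<close>. From here on the limit depends on neither the embedding nor
  the graph.\<close>

lemma leaf_limit_emb:
  assumes eq: "(e, q) \<in> Emb"
  shows "leaf_limit (q ` set us) (e ` I) j {} = tree_limit j"
proof -
  let ?A = "q ` set us"
  note e = embD[OF eq] and q = inj_q[OF eq]
  have inv_q: "inv_into (set us) q (q u) = u" if "u \<in> set us" for u by (rule inv_into_f_f[OF q that])
  have "leaf_limit ?A (e ` I) j {} = (\<Sum>f\<in>sat ?A {}. death_sum (real k * \<kappa>) j (card (e ` I - f ` ?A)))"
    using leaf_limit_eq[of ?A "e ` I" j "{}"] finite_I e_I(2)[OF eq] by simp
  also have "\<dots> = tree_limit j"
    unfolding tree_limit_def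
  proof (rule sum.reindex_bij_witness[of _ "\<lambda>f. \<lambda>c\<in>?A. e (f (inv_into (set us) q c))"
        "\<lambda>g. \<lambda>u\<in>set us. inv_into Vt e (g (q u))"])
    have inv_e: "inv_into Vt e (e x) = x" if "x \<in> Vt" for x by (rule inv_into_f_f[OF e(3) that])
    fix g assume "g \<in> sat ?A {}"
    then have g: "g \<in> Pi\<^sub>E ?A nbV" "inj_on g ?A" by (auto simp: sat_def PiE_iff)
    have gu: "\<exists>x\<in>nb u. g (q u) = e x" if u: "u \<in> set us" for u
    proof -
      have "g (q u) \<in> e ` nb u" using g(1) u e(4)[OF u] by (auto simp: PiE_iff)
      then show ?thesis by blast
    qed
    have ginv: "inv_into Vt e (g (q u)) \<in> nb u" "e (inv_into Vt e (g (q u))) = g (q u)" if u: "u \<in> set us" for u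
      using gu[OF u] inv_e nb_sub[OF u] by (auto simp: subset_iff)
    show "(\<lambda>c\<in>?A. e ((\<lambda>u\<in>set us. inv_into Vt e (g (q u))) (inv_into (set us) q c))) = g"
    proof (rule extensionalityI[of _ ?A])
      fix c assume "c \<in> ?A"
      then show "(\<lambda>c\<in>?A. e ((\<lambda>u\<in>set us. inv_into Vt e (g (q u))) (inv_into (set us) q c))) c = g c"
        using inv_q ginv by auto
    qed (use g in \<open>auto simp: PiE_iff\<close>)
    show "(\<lambda>u\<in>set us. inv_into Vt e (g (q u))) \<in> tree_sat"
    proof -
      have "inj_on (\<lambda>u\<in>set us. inv_into Vt e (g (q u))) (set us)"
      proof (rule inj_onI)
        fix u w assume uw: "u \<in> set us" "w \<in> set us"
          and "(\<lambda>u\<in>set us. inv_into Vt e (g (q u))) u = (\<lambda>u\<in>set us. inv_into Vt e (g (q u))) w"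
        then have "g (q u) = g (q w)" using ginv(2) by (metis restrict_apply')
        then show "u = w" using g(2) q uw by (auto dest!: inj_onD)
      qed
      then show ?thesis using ginv(1) by (auto simp: tree_sat_def)
    qed
    have img: "g ` ?A = e ` ((\<lambda>u\<in>set us. inv_into Vt e (g (q u))) ` set us)"
      using ginv(2) by (auto simp: image_iff)
    have "(\<lambda>u\<in>set us. inv_into Vt e (g (q u))) ` set us \<subseteq> Vt"
      using ginv(1) nb_sub by (auto simp: subset_iff)
    then have "e ` (I - (\<lambda>u\<in>set us. inv_into Vt e (g (q u))) ` set us) = e ` I - g ` ?A"
      unfolding img using I_sub by (intro inj_on_image_set_diff[OF e(3)]) blast+
    then have "card (e ` I - g ` ?A) = card (I - (\<lambda>u\<in>set us. inv_into Vt e (g (q u))) ` set us)"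
      using card_image[OF inj_on_subset[OF e(3), of "I - (\<lambda>u\<in>set us. inv_into Vt e (g (q u))) ` set us"]] I_sub
      by (metis Diff_subset order_trans)
    then show "death_sum (real k * \<kappa>) j (card (I - (\<lambda>u\<in>set us. inv_into Vt e (g (q u))) ` set us)) =
       death_sum (real k * \<kappa>) j (card (e ` I - g ` ?A))" by simp
  next
    fix f assume "f \<in> tree_sat"
    then have f: "f \<in> Pi\<^sub>E (set us) nb" "inj_on f (set us)" by (auto simp: tree_sat_def)
    have fV: "f u \<in> Vt" if "u \<in> set us" for u using f(1) that nb_sub by (auto simp: PiE_iff)
    let ?g = "\<lambda>c\<in>?A. e (f (inv_into (set us) q c))"
    have gq: "?g (q u) = e (f u)" if "u \<in> set us" for u using that inv_q by simp
    show "(\<lambda>u\<in>set us. inv_into Vt e (?g (q u))) = f"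
    proof (rule extensionalityI[of _ "set us"])
      fix u assume "u \<in> set us"
      then show "(\<lambda>u\<in>set us. inv_into Vt e (?g (q u))) u = f u"
        using gq fV inv_into_f_f[OF e(3)] by simp
    qed (use f in \<open>auto simp: PiE_iff\<close>)
    have "?g \<in> Pi\<^sub>E ?A (\<lambda>u. nbV u - {})"
    proof (rule PiE_I)
      fix c assume "c \<in> ?A"
      then obtain u where u: "u \<in> set us" "c = q u" by auto
      have "e (f u) \<in> e ` nb u" using f(1) u by (auto simp: PiE_iff)
      then show "?g c \<in> nbV c - {}" using gq[OF u(1)] e(4)[OF u(1)] unfolding u(2) by simp
    qed simp
    moreover have "inj_on ?g ?A"
    proof (rule inj_onI)
      fix c c' assume "c \<in> ?A" "c' \<in> ?A" and gg: "?g c = ?g c'"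
      then obtain u w where u: "u \<in> set us" "c = q u" and w: "w \<in> set us" "c' = q w" by auto
      have "e (f u) = e (f w)" using gg gq[OF u(1)] gq[OF w(1)] unfolding u(2) w(2) by metis
      then have "f u = f w" using e(3) fV u w by (auto dest!: inj_onD)
      then show "c = c'" using f(2) u w by (auto dest!: inj_onD)
    qed
    ultimately show "?g \<in> sat ?A {}" by (simp add: sat_def)
  qed
  finally show ?thesis .
qed

abbreviation "det_bound j \<equiv> fact (j + a) * real (k + 1) ^ (j + a)"

lemma abs_det_M_le:
  assumes "((e, q), cs) \<in> configs j"
  shows "\<bar>principal_det M (q ` set us \<union> set cs)\<bar> \<le> det_bound j"
proof -
  note c = odd_list_config[OF assms]
  have "card (q ` set us \<union> set cs) = j + a" using c distinct_card by metis
  moreover have "\<bar>principal_det M (q ` set us \<union> set cs)\<bar>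
    \<le> fact (card (q ` set us \<union> set cs)) * real (k + 1) ^ card (q ` set us \<union> set cs)"
    using c(3,4) by (intro abs_principal_det_le abs_M_le) auto
  ultimately show ?thesis by simp
qed

text \<open>Tidy lists give forests, whose determinants count matchings. Untidy lists are rarer by a
  factor \<open>d\<close>, so the trivial bound on their determinants is enough.\<close>

lemma leaf_sum_det_M:
  assumes eq: "(e, q) \<in> Emb"
  shows "d * \<bar>(\<Sum>cs\<in>leaf_lists (q ` set us) (e ` I) j. principal_det M (q ` set us \<union> set cs)) - d ^ j * tree_limit j\<bar>
     \<le> (leaf_err a \<kappa> j + untidy_err a \<kappa> j * det_bound j) * d ^ j"
proof -
  let ?A = "q ` set us" and ?L = "leaf_lists (q ` set us) (e ` I) j" and ?T = "tidy_lists (q ` set us) (e ` I) j"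
  have sub: "?T \<subseteq> ?L" by (auto simp: tidy_lists_def)
  have A: "finite ?A" "?A \<subseteq> U" "card ?A = a" using q_image[OF eq] by auto
  have K: "finite (e ` I)" "e ` I \<subseteq> V" "e ` I \<subseteq> NV ?A" "card (e ` I) = \<kappa>" using e_I[OF eq] finite_I by auto
  have tidy: "principal_det M (?A \<union> set cs) = real (card (sat (?A \<union> set cs) {}))" if cs: "cs \<in> ?T" for cs
  proof -
    have "set (cs @ map q us) \<subseteq> U" using cs A WU_sub[of "e ` I"] by (auto simp: tidy_lists_def leaf_lists_def)
    from principal_det_M_forest[OF forest_tidy[OF eq cs] this] show ?thesis by (simp add: Un_commute)
  qed
  have "(\<Sum>cs\<in>?L. principal_det M (?A \<union> set cs)) =
     (\<Sum>cs\<in>?L - ?T. principal_det M (?A \<union> set cs)) + (\<Sum>cs\<in>?T. real (card (sat (?A \<union> set cs) {})))"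
    using sum.subset_diff[OF sub finite_leaf_lists, of "\<lambda>cs. principal_det M (?A \<union> set cs)"] tidy by simp
  then have "\<bar>(\<Sum>cs\<in>?L. principal_det M (?A \<union> set cs)) - d ^ j * tree_limit j\<bar>
     \<le> \<bar>(\<Sum>cs\<in>?L - ?T. principal_det M (?A \<union> set cs))\<bar> + \<bar>(\<Sum>cs\<in>?T. real (card (sat (?A \<union> set cs) {}))) - d ^ j * tree_limit j\<bar>"
    by linarith
  also have "\<bar>(\<Sum>cs\<in>?L - ?T. principal_det M (?A \<union> set cs))\<bar> \<le> (\<Sum>cs\<in>?L - ?T. det_bound j)"
    using eq by (intro order_trans[OF sum_abs] sum_mono abs_det_M_le) (auto simp: configs_def)
  finally have "d * \<bar>(\<Sum>cs\<in>?L. principal_det M (?A \<union> set cs)) - d ^ j * tree_limit j\<bar>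
     \<le> d * ((\<Sum>cs\<in>?L - ?T. det_bound j) + \<bar>(\<Sum>cs\<in>?T. real (card (sat (?A \<union> set cs) {}))) - d ^ j * tree_limit j\<bar>)"
    by (intro mult_left_mono) auto
  also have "\<dots> = real (d * card (?L - ?T)) * det_bound j +
      d * \<bar>(\<Sum>cs\<in>?T. real (card (sat (?A \<union> set cs) {}))) - d ^ j * tree_limit j\<bar>"
    by (simp add: distrib_left)
  also have "\<dots> \<le> real (untidy_err a \<kappa> j * d ^ j) * det_bound j + leaf_err a \<kappa> j * d ^ j"
  proof (rule add_mono)
    show "real (d * card (?L - ?T)) * det_bound j \<le> real (untidy_err a \<kappa> j * d ^ j) * det_bound j"
      using untidy_error[OF A(1,2) K(1,2), of j] A(3) K(4) by (intro mult_right_mono of_nat_mono) auto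
    show "d * \<bar>(\<Sum>cs\<in>?T. real (card (sat (?A \<union> set cs) {}))) - d ^ j * tree_limit j\<bar> \<le> leaf_err a \<kappa> j * d ^ j"
      using leaf_sum_error[OF A(1,2) K(3), of "{}" j] leaf_limit_emb[OF eq, of j] A(3) K(4) by simp
  qed
  finally show ?thesis by (simp add: algebra_simps)
qed

text \<open>Powers of \<open>k + 1\<close> are rounded up to the exponent \<open>j + a\<close>, so
  that one and two pinned entries share the constant.\<close>

abbreviation "pin_const j \<equiv> real Cf * fact (j + a - 1) * real (k + 1) ^ (j + a)"

lemma pin_one:
  assumes us: "us \<noteq> []" and p: "p < j + a" and w: "\<And>u. w u \<ge> (0::real)"
  shows "(\<Sum>x\<in>configs j. w (odd_list x ! p)) \<le> pin_const j * (real d ^ (j + a) / d) * (\<Sum>u\<in>U. w u)"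
proof -
  let ?N = "j + a"
  have N: "?N = Suc (?N - 1)" using p by simp
  have "(\<Sum>x\<in>configs j. w (odd_list x ! p)) \<le> real Cf * (\<Sum>h\<in>linked_lists share U ?N. w (h ! p))"
    using sum_configs_le[OF us, of "\<lambda>h. w (h ! p)" j] w by simp
  also have "\<dots> \<le> real Cf * (fact (?N - 1) * real ((k + 1) * d) ^ (?N - 1) * (\<Sum>u\<in>U. w u))"
    using S.one_pin[OF p, of w] w by (intro mult_left_mono) auto
  also have "real ((k + 1) * d) ^ (?N - 1) = real (k + 1) ^ (?N - 1) * (real d ^ ?N / d)"
  proof -
    have "real d ^ ?N = real d * real d ^ (?N - 1)" by (subst N) simp
    then show ?thesis unfolding of_nat_mult power_mult_distrib using d0 by simp
  qed
  also have "real Cf * (fact (?N - 1) * (real (k + 1) ^ (?N - 1) * (real d ^ ?N / d)) * (\<Sum>u\<in>U. w u))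
     = (real Cf * fact (?N - 1) * (real d ^ ?N / d) * (\<Sum>u\<in>U. w u)) * real (k + 1) ^ (?N - 1)" by (simp add: mult_ac)
  also have "\<dots> \<le> (real Cf * fact (?N - 1) * (real d ^ ?N / d) * (\<Sum>u\<in>U. w u)) * real (k + 1) ^ ?N"
    using w by (intro mult_left_mono power_increasing mult_nonneg_nonneg sum_nonneg) auto
  finally show ?thesis by (simp add: mult_ac)
qed

lemma pin_two:
  assumes us: "us \<noteq> []" and p: "p < j + a" "q < j + a" "p \<noteq> q" and w: "\<And>u v. w u v \<ge> (0::real)"
  shows "(\<Sum>x\<in>configs j. w (odd_list x ! p) (odd_list x ! q))
    \<le> pin_const j * (real d ^ (j + a) / (real d)\<^sup>2) * (\<Sum>u\<in>U. \<Sum>v\<in>U. w u v)"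
proof -
  let ?N = "j + a" and ?W = "\<Sum>u\<in>U. \<Sum>v\<in>U. w u v"
  have N: "?N = Suc (Suc (?N - 2))" using p by simp
  have "(\<Sum>x\<in>configs j. w (odd_list x ! p) (odd_list x ! q))
     \<le> real Cf * (\<Sum>h\<in>linked_lists share U ?N. w (h ! p) (h ! q))"
    using sum_configs_le[OF us, of "\<lambda>h. w (h ! p) (h ! q)" j] w by simp
  also have "\<dots> \<le> real Cf * (fact (?N - 1) * real ((k + 1) * d) ^ (?N - 2) * ?W)"
    using S.two_pin[OF p, of w] w by (intro mult_left_mono) auto
  also have "real ((k + 1) * d) ^ (?N - 2) = real (k + 1) ^ (?N - 2) * (real d ^ ?N / (real d)\<^sup>2)"
  proof -
    have "real d ^ ?N = (real d)\<^sup>2 * real d ^ (?N - 2)" by (subst N) (simp add: power2_eq_square)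
    then show ?thesis unfolding of_nat_mult power_mult_distrib using d0 by simp
  qed
  also have "real Cf * (fact (?N - 1) * (real (k + 1) ^ (?N - 2) * (real d ^ ?N / (real d)\<^sup>2)) * ?W)
     = (real Cf * fact (?N - 1) * (real d ^ ?N / (real d)\<^sup>2) * ?W) * real (k + 1) ^ (?N - 2)" by (simp add: mult_ac)
  also have "\<dots> \<le> (real Cf * fact (?N - 1) * (real d ^ ?N / (real d)\<^sup>2) * ?W) * real (k + 1) ^ ?N"
    using w by (intro mult_left_mono power_increasing mult_nonneg_nonneg sum_nonneg) auto
  finally show ?thesis by (simp add: mult_ac)
qed

lemma card_configs_le:
  assumes us: "us \<noteq> []"
  shows "real (card (configs j)) \<le> pin_const j * real d ^ (j + a) * n"
proof -
  have "real (card (configs j)) \<le> pin_const j * (real d ^ (j + a) / d) * (\<Sum>u\<in>U. 1)"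
    using pin_one[OF us, of 0 j "\<lambda>_. 1"] us by simp
  also have "\<dots> = pin_const j * (real d ^ (j + a) / d) * card U" by simp
  also have "\<dots> \<le> pin_const j * (real d ^ (j + a) / d) * (real n * d)"
  proof (intro mult_left_mono)
    have "card U \<le> card U * (k + 1)" by simp
    then have "card U \<le> n * d" using card_U by simp
    then show "real (card U) \<le> real n * d" by (metis of_nat_mono of_nat_mult)
  qed simp
  finally show ?thesis using d0 by simp
qed

text \<open>For \<open>p = q\<close> only one entry is pinned, which calls for the absolute bound
  \<open>diag_error\<close>. For \<open>p \<noteq> q\<close> the second pin makes the squared bound
  \<open>total_error\<close> sufficient.\<close>

lemma entry_sum:
  assumes us: "us \<noteq> []" and p: "p < j + a" "q < j + a"
  shows "(\<Sum>x\<in>configs j. \<bar>d * P (odd_list x ! p) (odd_list x ! q) - M (odd_list x ! p) (odd_list x ! q)\<bar>)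
    \<le> pin_const j * real d ^ (j + a) * n * (2 * k) / sqrt d"
proof -
  let ?y = "\<lambda>u w. d * P u w - M u w" and ?C = "pin_const j * real d ^ (j + a)"
  have sd: "sqrt d > 0" "sqrt d * sqrt d = d" "sqrt d \<ge> 1" using d0 by auto
  have C0: "?C \<ge> 0" by simp
  have y: "?y u w = d * (P u w - M u w / d)" for u w using d0 by (simp add: field_simps)
  show ?thesis
  proof (cases "p = q")
    case True
    define w where "w u = (if u \<in> U then \<bar>?y u u\<bar> else 0)" for u
    have "(\<Sum>u\<in>U. w u) = d * (\<Sum>u\<in>U. \<bar>P u u - (k + 1) / d\<bar>)"
      unfolding sum_distrib_left w_def y by (intro sum.cong refl) (simp add: M_diag abs_mult)
    also have "\<dots> \<le> d * (2 * real n * k / d)"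
      using diag_error by (intro mult_left_mono) auto
    finally have w_le: "(\<Sum>u\<in>U. w u) \<le> 2 * real n * k" using d0 by simp
    have "(\<Sum>x\<in>configs j. \<bar>?y (odd_list x ! p) (odd_list x ! q)\<bar>) = (\<Sum>x\<in>configs j. w (odd_list x ! p))"
    proof (rule sum.cong[OF refl])
      fix x assume "x \<in> configs j"
      then have "odd_list x ! p \<in> U" using odd_list_linked S.nth_in p by blast
      then show "\<bar>?y (odd_list x ! p) (odd_list x ! q)\<bar> = w (odd_list x ! p)" using True by (simp add: w_def)
    qed
    also have "\<dots> \<le> pin_const j * (real d ^ (j + a) / d) * (\<Sum>u\<in>U. w u)"
      by (rule pin_one[OF us p(1)]) (simp add: w_def)
    also have "\<dots> \<le> pin_const j * (real d ^ (j + a) / d) * (2 * real n * k)"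
      using w_le by (intro mult_left_mono) auto
    also have "\<dots> = (?C * n * (2 * k)) / d" by (simp add: mult_ac)
    also have "\<dots> \<le> (?C * n * (2 * k)) / sqrt d"
      using sd mult_left_mono[OF sd(3), of "sqrt d"] by (intro divide_left_mono) auto
    finally show ?thesis by (simp add: mult_ac)
  next
    case False
    define w where "w u v = (if u \<in> U \<and> v \<in> U then (?y u v)\<^sup>2 else 0)" for u v
    have "(\<Sum>u\<in>U. \<Sum>v\<in>U. w u v) = (real d)\<^sup>2 * (\<Sum>u\<in>U. \<Sum>v\<in>U. (P u v - M u v / d)\<^sup>2)"
      unfolding sum_distrib_left w_def y by (intro sum.cong refl) (simp add: power_mult_distrib)
    also have "\<dots> \<le> (real d)\<^sup>2 * (real n * k / d)" using total_error by (intro mult_left_mono) auto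
    finally have "pin_const j * (real d ^ (j + a) / (real d)\<^sup>2) * (\<Sum>u\<in>U. \<Sum>v\<in>U. w u v)
       \<le> pin_const j * (real d ^ (j + a) / (real d)\<^sup>2) * ((real d)\<^sup>2 * (real n * k / d))"
      by (intro mult_left_mono) auto
    also have "\<dots> = ?C * n * k / d" using d0 by simp
    finally have le: "pin_const j * (real d ^ (j + a) / (real d)\<^sup>2) * (\<Sum>u\<in>U. \<Sum>v\<in>U. w u v) \<le> ?C * n * k / d" .
    have "w u v \<ge> 0" for u v by (simp add: w_def)
    then have w_le: "(\<Sum>x\<in>configs j. w (odd_list x ! p) (odd_list x ! q)) \<le> ?C * n * k / d"
      by (rule order_trans[OF pin_two[OF us p False] le])
    \<comment> \<open>The weight \<open>sqrt d\<close> balances two quantities: the number of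
      configurations, and the sum of squares, which is smaller by a factor \<open>d\<close>. Both
      terms end up with \<open>1 / sqrt d\<close>.\<close>
    have "(\<Sum>x\<in>configs j. \<bar>?y (odd_list x ! p) (odd_list x ! q)\<bar>)
       \<le> (\<Sum>x\<in>configs j. 1 / sqrt d + sqrt d * w (odd_list x ! p) (odd_list x ! q))"
    proof (rule sum_mono)
      fix x assume "x \<in> configs j"
      then have U: "odd_list x ! p \<in> U" "odd_list x ! q \<in> U" using odd_list_linked S.nth_in p by blast+
      define z where "z = \<bar>?y (odd_list x ! p) (odd_list x ! q)\<bar>"
      have "2 * (sqrt d * z) \<le> 1 + (sqrt d * z)\<^sup>2" using sum_squares_bound[of 1 "sqrt d * z"] by (simp add: mult_ac)
      then have "sqrt d * z \<le> 1 + (sqrt d * z)\<^sup>2" using sd(1) by (simp add: z_def) (smt (verit) abs_ge_zero mult_nonneg_nonneg real_sqrt_ge_zero of_nat_0_le_iff)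
      also have "\<dots> = sqrt d * (1 / sqrt d + sqrt d * z\<^sup>2)" using sd by (simp add: power2_eq_square algebra_simps)
      finally have "z \<le> 1 / sqrt d + sqrt d * z\<^sup>2" using sd(1) by (simp only: mult_le_cancel_left_pos)
      then show "\<bar>?y (odd_list x ! p) (odd_list x ! q)\<bar> \<le> 1 / sqrt d + sqrt d * w (odd_list x ! p) (odd_list x ! q)"
        using U by (simp add: z_def w_def)
    qed
    also have "\<dots> = card (configs j) / sqrt d + sqrt d * (\<Sum>x\<in>configs j. w (odd_list x ! p) (odd_list x ! q))"
      by (simp add: sum.distrib sum_distrib_left)
    also have "\<dots> \<le> (?C * n) / sqrt d + sqrt d * (?C * n * k / d)"
      using w_le card_configs_le[OF us, of j] sd(1) by (intro add_mono divide_right_mono mult_left_mono) auto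
    also have "sqrt d * (?C * n * k / d) = ?C * n * k / sqrt d"
      using sd by (simp add: field_simps)
    also have "?C * n / sqrt d + ?C * n * k / sqrt d = (?C * n) * (1 + k) / sqrt d"
      by (simp add: algebra_simps add_divide_distrib)
    also have "\<dots> \<le> (?C * n) * (2 * k) / sqrt d"
      using k1 C0 sd by (intro divide_right_mono mult_left_mono) auto
    finally show ?thesis by (simp add: mult_ac)
  qed
qed

text \<open>Too many elements of \<open>U\<close> may be atypical for a bound by \<open>1 / d\<close>, so the tolerance is \<open>\<theta> / d\<close>;
  \<open>\<theta>\<close> tends to infinity after \<open>d\<close>.\<close>
definition bad_vertices :: "real \<Rightarrow> 'a set" where
  "bad_vertices \<theta> = {v \<in> V. \<exists>u\<in>nbU v. \<bar>P u u - (k + 1) / d\<bar> > \<theta> / d}"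

definition good_embs :: "real \<Rightarrow> (('x \<Rightarrow> 'a) \<times> ('u \<Rightarrow> 'b)) set" where
  "good_embs \<theta> = {eq \<in> Emb. fst eq ` I \<inter> bad_vertices \<theta> = {}}"

definition good_configs :: "real \<Rightarrow> nat \<Rightarrow> ((('x \<Rightarrow> 'a) \<times> ('u \<Rightarrow> 'b)) \<times> 'b list) set" where
  "good_configs \<theta> j = {x \<in> configs j. fst x \<in> good_embs \<theta>}"

text \<open>Markov's inequality applied to \<open>diag_error\<close>; each atypical element of
  \<open>U\<close> spoils its \<open>k + 1\<close> neighbours.\<close>

lemma card_bad_vertices:
  assumes \<theta>: "\<theta> > 0"
  shows "card (bad_vertices \<theta>) \<le> 2 * k * (k + 1) * n / \<theta>"
proof -
  let ?r = "\<lambda>u. \<bar>P u u - (k + 1) / d\<bar>"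
  let ?B = "{u \<in> U. ?r u > \<theta> / d}"
  have fB: "finite ?B" using finU by simp
  have "bad_vertices \<theta> \<subseteq> (\<Union>u\<in>?B. nbV u)"
    using mem_nb by (fastforce simp: bad_vertices_def nbU_def)
  then have "card (bad_vertices \<theta>) \<le> card (\<Union>u\<in>?B. nbV u)" using fB by (intro card_mono) auto
  also have "\<dots> \<le> (\<Sum>u\<in>?B. card (nbV u))" using fB by (intro card_UN_le)
  also have "\<dots> = (k + 1) * card ?B" by (simp add: card_nbV)
  finally have "card (bad_vertices \<theta>) \<le> (k + 1) * card ?B" .
  from of_nat_mono[OF this, where ?'a = real]
  have 1: "real (card (bad_vertices \<theta>)) \<le> (k + 1) * real (card ?B)" by (simp only: of_nat_mult)
  have "real (card ?B) * (\<theta> / d) = (\<Sum>u\<in>?B. \<theta> / d)" by simp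
  also have "\<dots> \<le> (\<Sum>u\<in>?B. ?r u)" by (intro sum_mono) auto
  also have "\<dots> \<le> (\<Sum>u\<in>U. ?r u)" using finU by (intro sum_mono2) auto
  also have "\<dots> \<le> 2 * real n * k / d" by (rule diag_error)
  finally have "real (card ?B) \<le> 2 * real n * k / \<theta>" using \<theta> d0 by (simp add: field_simps)
  then have "(k + 1) * real (card ?B) \<le> (k + 1) * (2 * real n * k / \<theta>)" by (intro mult_left_mono) auto
  with 1 show ?thesis by (simp add: algebra_simps)
qed

text \<open>By Cauchy-Schwarz the entries of \<open>P\<close> are dominated by its diagonal, which
  is why \<open>bad_vertices\<close> inspects the diagonal alone.\<close>

lemma good_entry:
  fixes \<theta> :: real
  assumes eq: "(e, q) \<in> good_embs \<theta>" and \<theta>: "\<theta> \<ge> 0" and u: "u \<in> WU (e ` I)" and w: "w \<in> WU (e ` I)"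
  shows "\<bar>d * P u w\<bar> \<le> k + 1 + \<theta>"
proof -
  have diag: "0 \<le> P z z \<and> P z z \<le> (k + 1 + \<theta>) / d" if z: "z \<in> WU (e ` I)" for z
  proof -
    obtain v where v: "v \<in> e ` I" "z \<in> nbU v" using z by (auto simp: WU_def)
    then have "v \<in> V" "v \<notin> bad_vertices \<theta>" using eq e_I(1)[of e q] by (auto simp: good_embs_def)
    then have "\<bar>P z z - (k + 1) / d\<bar> \<le> \<theta> / d" using v by (auto simp: bad_vertices_def not_less)
    moreover have "(k + 1 + \<theta>) / d = (k + 1) / d + \<theta> / d" by (simp add: add_divide_distrib)
    moreover have "0 \<le> P z z" using K.diag_nonneg[of z] z WU_sub[of "e ` I"] by auto
    ultimately show ?thesis by linarith
  qed
  have c: "(k + 1 + \<theta>) / d \<ge> 0" using \<theta> by simp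
  have "u \<in> U" "w \<in> U" using u w WU_sub[of "e ` I"] by auto
  then have "(P u w)\<^sup>2 \<le> P u u * P w w" by (rule K.entry_bound)
  also have "\<dots> \<le> ((k + 1 + \<theta>) / d) * ((k + 1 + \<theta>) / d)"
    using diag[OF u] diag[OF w] c by (intro mult_mono) auto
  finally have "\<bar>P u w\<bar> \<le> (k + 1 + \<theta>) / d"
    using c by (simp only: power2_eq_square[symmetric] abs_le_square_iff[symmetric] abs_of_nonneg)
  then show ?thesis using d0 by (simp add: abs_mult field_simps)
qed

definition "err_det j \<theta> = fact (j + a) * (real (k + 1) + \<theta>) ^ (j + a) * ((j + a) * (j + a)) * (pin_const j * (2 * k))"

text \<open>On good configurations the rescaled entries are bounded in terms of
  \<open>\<theta>\<close>, so the determinants differ by at most a multiple of the entrywise errors.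
  The multiple grows with \<open>\<theta>\<close>, so \<open>\<theta>\<close> has to be fixed before
  \<open>d\<close> tends to infinity.\<close>

lemma good_det_error:
  assumes \<theta>: "\<theta> \<ge> 0"
  shows "(\<Sum>x\<in>good_configs \<theta> j. \<bar>real d ^ (j + a) * principal_det P (set (odd_list x)) - principal_det M (set (odd_list x))\<bar>)
     \<le> err_det j \<theta> * (real n * real d ^ (j + a)) / sqrt d"
proof (cases "us = []")
  case True
  have "\<bar>real d ^ (j + a) * principal_det P (set (odd_list x)) - principal_det M (set (odd_list x))\<bar> = 0"
    if "x \<in> good_configs \<theta> j" for x
  proof -
    have x: "x \<in> configs j" using that by (auto simp: good_configs_def)
    then have "j = 0" using no_leaf[OF True] by auto
    moreover obtain e q cs where xe: "x = ((e, q), cs)" by (metis surj_pair)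
    moreover have "length (odd_list x) = j + a" using odd_list_config(2) x xe by blast
    ultimately have "set (odd_list x) = {}" using True by simp
    then show ?thesis using True \<open>j = 0\<close> by simp
  qed
  then have "(\<Sum>x\<in>good_configs \<theta> j. \<bar>real d ^ (j + a) * principal_det P (set (odd_list x)) - principal_det M (set (odd_list x))\<bar>) = 0"
    by (intro sum.neutral) blast
  moreover have "err_det j \<theta> * (real n * real d ^ (j + a)) / sqrt d \<ge> 0"
    using \<theta> by (simp add: err_det_def)
  ultimately show ?thesis by simp
next
  case us: False
  let ?N = "j + a" and ?C = "real (k + 1) + \<theta>"
  let ?y = "\<lambda>u w. \<bar>d * P u w - M u w\<bar>"
  have entrywise: "\<bar>real d ^ ?N * principal_det P (set (odd_list x)) - principal_det M (set (odd_list x))\<bar>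
     \<le> fact ?N * ?C ^ ?N * (\<Sum>p<?N. \<Sum>q<?N. ?y (odd_list x ! p) (odd_list x ! q))"
    if "x \<in> good_configs \<theta> j" for x
  proof -
    obtain e q cs where xe: "x = ((e, q), cs)" by (metis surj_pair)
    have x: "((e, q), cs) \<in> configs j" and g: "(e, q) \<in> good_embs \<theta>"
      using that unfolding xe by (auto simp: good_configs_def)
    note c = odd_list_config[OF x]
    let ?h = "odd_list ((e, q), cs)"
    have card: "card (set ?h) = ?N" using c distinct_card by metis
    have sub: "set ?h \<subseteq> WU (e ` I)" using c(3,5) q_in_WU[OF c(6)] by auto
    have "\<bar>principal_det (\<lambda>u w. d * P u w) (set ?h) - principal_det M (set ?h)\<bar>
       \<le> fact (card (set ?h)) * ?C ^ card (set ?h) * (\<Sum>u\<in>set ?h. \<Sum>w\<in>set ?h. ?y u w)"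
    proof (rule abs_principal_det_diff_le)
      fix u w assume uw: "u \<in> set ?h" "w \<in> set ?h"
      show "\<bar>d * P u w\<bar> \<le> ?C" using good_entry[OF g \<theta>, of u w] uw sub by auto
      have "\<bar>M u w\<bar> \<le> real (k + 1)" using uw c(4) by (intro abs_M_le) auto
      then show "\<bar>M u w\<bar> \<le> ?C" using \<theta> by linarith
    qed (use \<theta> in auto)
    moreover have nth: "(\<Sum>u\<in>set ?h. f u) = (\<Sum>p<?N. f (?h ! p))" for f :: "'b \<Rightarrow> real"
      using sum.reindex_bij_betw[OF bij_betw_nth[OF c(1), of "{..<?N}" "set ?h"], of f] c(2) by simp
    ultimately show ?thesis unfolding xe nth card by (simp add: principal_det_scale card)
  qed
  have "(\<Sum>x\<in>good_configs \<theta> j. \<bar>real d ^ ?N * principal_det P (set (odd_list x)) - principal_det M (set (odd_list x))\<bar>)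
     \<le> (\<Sum>x\<in>good_configs \<theta> j. fact ?N * ?C ^ ?N * (\<Sum>p<?N. \<Sum>q<?N. ?y (odd_list x ! p) (odd_list x ! q)))"
    by (rule sum_mono) (rule entrywise)
  \<comment> \<open>The summand has become an entrywise error, which is controlled on average over
    all configurations, so the bad ones may be added.\<close>
  also have "\<dots> \<le> (\<Sum>x\<in>configs j. fact ?N * ?C ^ ?N * (\<Sum>p<?N. \<Sum>q<?N. ?y (odd_list x ! p) (odd_list x ! q)))"
    using \<theta> by (intro sum_mono2 finite_configs) (auto simp: good_configs_def intro!: mult_nonneg_nonneg sum_nonneg)
  also have "\<dots> = fact ?N * ?C ^ ?N * (\<Sum>p<?N. \<Sum>q<?N. \<Sum>x\<in>configs j. ?y (odd_list x ! p) (odd_list x ! q))"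
    unfolding sum_distrib_left[symmetric] by (subst sum.swap, subst (2) sum.swap) simp
  also have "\<dots> \<le> fact ?N * ?C ^ ?N * (\<Sum>p<?N. \<Sum>q<?N. pin_const j * real d ^ ?N * n * (2 * k) / sqrt d)"
    using \<theta> entry_sum[OF us] by (intro mult_left_mono sum_mono) auto
  also have "\<dots> = err_det j \<theta> * (real n * real d ^ ?N) / sqrt d"
    by (simp add: err_det_def)
  finally show ?thesis .
qed

definition "err_bad j = det_bound j * ((j + a) * pin_const j * (2 * k * (k + 1)))"

text \<open>A bad configuration has an odd vertex next to a bad vertex, and pinning that entry shows
  such configurations to be rare. The determinants here are those of \<open>M\<close>, which are
  bounded everywhere.\<close>

lemma bad_configs_error:
  assumes \<theta>: "\<theta> > 0"
  shows "(\<Sum>x\<in>configs j - good_configs \<theta> j. \<bar>principal_det M (set (odd_list x))\<bar>)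
     \<le> err_bad j * (real n * real d ^ (j + a)) / \<theta>"
proof (cases "us = []")
  case True
  then have "I = {}" using I_cover by auto
  then have "fst (fst x) ` I \<inter> bad_vertices \<theta> = {}" for x :: "(('x \<Rightarrow> 'a) \<times> ('u \<Rightarrow> 'b)) \<times> 'b list"
    by (simp only: image_empty Int_empty_left)
  moreover have "fst x \<in> Emb" if "x \<in> configs j" for x using that by (auto simp: configs_def)
  ultimately have "fst x \<in> good_embs \<theta>" if "x \<in> configs j" for x
    using that unfolding good_embs_def by blast
  then have "configs j - good_configs \<theta> j = {}" by (auto simp: good_configs_def)
  then have "(\<Sum>x\<in>configs j - good_configs \<theta> j. \<bar>principal_det M (set (odd_list x))\<bar>) = 0" by (simp only: sum.empty)
  then show ?thesis using \<theta> by (simp add: err_bad_def)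
next
  case us: False
  let ?N = "j + a" and ?Z = "\<Union>v\<in>bad_vertices \<theta>. nbU v"
  have fb: "finite (bad_vertices \<theta>)" "bad_vertices \<theta> \<subseteq> V" using finV by (auto simp: bad_vertices_def)
  have cZ: "card (U \<inter> ?Z) \<le> d * card (bad_vertices \<theta>)"
  proof -
    have "card (U \<inter> ?Z) \<le> card ?Z" using fb by (intro card_mono) auto
    also have "\<dots> \<le> (\<Sum>v\<in>bad_vertices \<theta>. card (nbU v))" using fb by (intro card_UN_le)
    also have "\<dots> = (\<Sum>v\<in>bad_vertices \<theta>. d)" using fb by (intro sum.cong refl card_nbU) auto
    finally show ?thesis by (simp add: mult.commute)
  qed
  have "real (card (configs j - good_configs \<theta> j)) = (\<Sum>x\<in>configs j - good_configs \<theta> j. 1)" by simp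
  also have "\<dots> \<le> (\<Sum>x\<in>configs j - good_configs \<theta> j. \<Sum>p<?N. of_bool (odd_list x ! p \<in> ?Z))"
  proof (rule sum_mono)
    fix x assume xb: "x \<in> configs j - good_configs \<theta> j"
    obtain e q cs where xe: "x = ((e, q), cs)" by (metis surj_pair)
    have x: "((e, q), cs) \<in> configs j" using xb xe by simp
    note c = odd_list_config[OF x]
    have "e ` I \<inter> bad_vertices \<theta> \<noteq> {}"
      using xb c(6) unfolding xe by (auto simp: good_configs_def good_embs_def)
    then obtain y where y: "y \<in> I" "e y \<in> bad_vertices \<theta>" by auto
    obtain u where u: "u \<in> set us" "y \<in> nb u" using I_cover[OF y(1)] by blast
    then have "e y \<in> nbV (q u)" using embD(4)[OF c(6) u(1)] by blast
    then have "q u \<in> ?Z" using y mem_nb by blast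
    moreover have "q u \<in> set (odd_list x)" using u unfolding xe c(3) by auto
    ultimately obtain p where "p < ?N" "odd_list x ! p \<in> ?Z"
      using c(2) unfolding xe by (metis in_set_conv_nth)
    then have "(\<Sum>p\<in>{p}. of_bool (odd_list x ! p \<in> ?Z)) \<le> (\<Sum>p<?N. (of_bool (odd_list x ! p \<in> ?Z) :: real))"
      by (intro sum_mono2) auto
    then show "1 \<le> (\<Sum>p<?N. (of_bool (odd_list x ! p \<in> ?Z) :: real))"
      using \<open>odd_list x ! p \<in> ?Z\<close> by simp
  qed
  also have "\<dots> \<le> (\<Sum>x\<in>configs j. \<Sum>p<?N. of_bool (odd_list x ! p \<in> ?Z))"
    by (intro sum_mono2 finite_configs) (auto intro: sum_nonneg)
  also have "\<dots> = (\<Sum>p<?N. \<Sum>x\<in>configs j. of_bool (odd_list x ! p \<in> ?Z))" by (rule sum.swap)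
  also have "\<dots> \<le> (\<Sum>p<?N. pin_const j * (real d ^ ?N / d) * (\<Sum>u\<in>U. of_bool (u \<in> ?Z)))"
    by (intro sum_mono pin_one[OF us]) auto
  also have "\<dots> = ?N * (pin_const j * (real d ^ ?N / d) * real (card (U \<inter> ?Z)))"
    using finU by (simp add: Int_def)
  also have "\<dots> \<le> ?N * (pin_const j * (real d ^ ?N / d) * (d * (2 * k * (k + 1) * n / \<theta>)))"
  proof (intro mult_left_mono)
    have "real (card (U \<inter> ?Z)) \<le> d * real (card (bad_vertices \<theta>))" using of_nat_mono[OF cZ, where ?'a = real] by simp
    also have "\<dots> \<le> d * (2 * k * (k + 1) * n / \<theta>)" using card_bad_vertices[OF \<theta>] by (intro mult_left_mono) auto
    finally show "real (card (U \<inter> ?Z)) \<le> d * (2 * k * (k + 1) * n / \<theta>)" .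
  qed auto
  also have "\<dots> = (?N * pin_const j * (2 * k * (k + 1))) * (real n * real d ^ ?N) / \<theta>" using d0 by simp
  finally have cnt: "real (card (configs j - good_configs \<theta> j)) \<le> (?N * pin_const j * (2 * k * (k + 1))) * (real n * real d ^ ?N) / \<theta>" .
  have "(\<Sum>x\<in>configs j - good_configs \<theta> j. \<bar>principal_det M (set (odd_list x))\<bar>) \<le> (\<Sum>x\<in>configs j - good_configs \<theta> j. det_bound j)"
  proof (rule sum_mono)
    fix x assume x: "x \<in> configs j - good_configs \<theta> j"
    obtain e q cs where xe: "x = ((e, q), cs)" by (metis surj_pair)
    have x: "((e, q), cs) \<in> configs j" using x xe by simp
    show "\<bar>principal_det M (set (odd_list x))\<bar> \<le> det_bound j"
      using abs_det_M_le[OF x] odd_list_config(3)[OF x] unfolding xe by simp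
  qed
  also have "\<dots> = det_bound j * real (card (configs j - good_configs \<theta> j))" by simp
  also have "\<dots> \<le> det_bound j * ((?N * pin_const j * (2 * k * (k + 1))) * (real n * real d ^ ?N) / \<theta>)"
    using cnt by (intro mult_left_mono) auto
  finally show ?thesis by (simp add: err_bad_def)
qed

definition "err_count j = fact k ^ a * (leaf_err a \<kappa> j + untidy_err a \<kappa> j * det_bound j) + emb_err a * \<bar>tree_limit j\<bar>"

lemma leaf_err_nonneg: "leaf_err b c i \<ge> 0"
  by (induction i) auto

text \<open>Two replacements are made: the leaf sum of each embedding by its main term, then the
  number of embeddings by \<open>n * (fact k * d) ^ a\<close>.\<close>

lemma config_sum_det_M:
  "\<bar>(\<Sum>x\<in>configs j. principal_det M (set (odd_list x))) - fact k ^ a * tree_limit j * (real n * real d ^ (j + a))\<bar>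
     \<le> err_count j * (real n * real d ^ (j + a)) / d"
proof -
  let ?c = "leaf_err a \<kappa> j + untidy_err a \<kappa> j * det_bound j" and ?L = "tree_limit j"
  let ?N = "real (card Emb)"
  have c0: "?c \<ge> 0" using leaf_err_nonneg by simp
  define s where "s eq = (\<Sum>cs\<in>leaf_lists (snd eq ` set us) (fst eq ` I) j. principal_det M (snd eq ` set us \<union> set cs))" for eq
  have "(\<Sum>x\<in>configs j. principal_det M (set (odd_list x))) = (\<Sum>x\<in>configs j. case x of (eq, cs) \<Rightarrow> principal_det M (snd eq ` set us \<union> set cs))"
    by (intro sum.cong refl) (auto simp: odd_list_config)
  also have "\<dots> = (\<Sum>eq\<in>Emb. s eq)"
    unfolding configs_def s_def using finite_Emb finite_leaf_lists by (subst sum.Sigma) auto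
  finally have S: "(\<Sum>x\<in>configs j. principal_det M (set (odd_list x))) = (\<Sum>eq\<in>Emb. s eq)" .
  have E: "?N \<le> n * (fact k * real d) ^ a" "d * \<bar>?N - n * (fact k * real d) ^ a\<bar> \<le> emb_err a * n * real d ^ a"
    using card_embs[OF gr card_nb] of_nat_mono[of "card Emb" "n * (fact k * d) ^ a", where ?'a = real] by auto
  have "d * \<bar>(\<Sum>eq\<in>Emb. s eq) - ?N * (real d ^ j * ?L)\<bar> = d * \<bar>\<Sum>eq\<in>Emb. s eq - real d ^ j * ?L\<bar>"
    by (simp add: sum_subtractf)
  also have "\<dots> \<le> d * (\<Sum>eq\<in>Emb. \<bar>s eq - real d ^ j * ?L\<bar>)" by (intro mult_left_mono sum_abs) auto
  also have "\<dots> = (\<Sum>eq\<in>Emb. d * \<bar>s eq - real d ^ j * ?L\<bar>)" by (rule sum_distrib_left)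
  also have "\<dots> \<le> (\<Sum>eq\<in>Emb. ?c * real d ^ j)"
  proof (rule sum_mono)
    fix eq assume "eq \<in> Emb"
    then show "d * \<bar>s eq - real d ^ j * ?L\<bar> \<le> ?c * real d ^ j"
      using leaf_sum_det_M[of "fst eq" "snd eq" j] by (simp add: s_def)
  qed
  also have "\<dots> = ?N * (?c * real d ^ j)" by simp
  also have "\<dots> \<le> n * (fact k * real d) ^ a * (?c * real d ^ j)" using E(1) c0 by (intro mult_right_mono) auto
  finally have 1: "d * \<bar>(\<Sum>eq\<in>Emb. s eq) - ?N * (real d ^ j * ?L)\<bar> \<le> n * (fact k * real d) ^ a * (?c * real d ^ j)" .
  have "d * \<bar>(?N - n * (fact k * real d) ^ a) * (real d ^ j * ?L)\<bar> = (d * \<bar>?N - n * (fact k * real d) ^ a\<bar>) * (real d ^ j * \<bar>?L\<bar>)"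
    by (simp add: abs_mult)
  also have "\<dots> \<le> (emb_err a * n * real d ^ a) * (real d ^ j * \<bar>?L\<bar>)" using E(2) by (intro mult_right_mono) auto
  finally have 2: "d * \<bar>(?N - n * (fact k * real d) ^ a) * (real d ^ j * ?L)\<bar> \<le> (emb_err a * n * real d ^ a) * (real d ^ j * \<bar>?L\<bar>)" .
  have "(\<Sum>eq\<in>Emb. s eq) - fact k ^ a * ?L * (real n * real d ^ (j + a))
     = ((\<Sum>eq\<in>Emb. s eq) - ?N * (real d ^ j * ?L)) + (?N - n * (fact k * real d) ^ a) * (real d ^ j * ?L)"
    by (simp add: algebra_simps power_add power_mult_distrib)
  then have "\<bar>(\<Sum>eq\<in>Emb. s eq) - fact k ^ a * ?L * (real n * real d ^ (j + a))\<bar>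
     \<le> \<bar>(\<Sum>eq\<in>Emb. s eq) - ?N * (real d ^ j * ?L)\<bar> + \<bar>(?N - n * (fact k * real d) ^ a) * (real d ^ j * ?L)\<bar>"
    by (simp only: abs_triangle_ineq)
  then have "d * \<bar>(\<Sum>eq\<in>Emb. s eq) - fact k ^ a * ?L * (real n * real d ^ (j + a))\<bar>
     \<le> d * (\<bar>(\<Sum>eq\<in>Emb. s eq) - ?N * (real d ^ j * ?L)\<bar> + \<bar>(?N - n * (fact k * real d) ^ a) * (real d ^ j * ?L)\<bar>)"
    by (intro mult_left_mono) auto
  also have "\<dots> \<le> n * (fact k * real d) ^ a * (?c * real d ^ j) + (emb_err a * n * real d ^ a) * (real d ^ j * \<bar>?L\<bar>)"
    using 1 2 by (simp only: distrib_left add_mono)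
  also have "\<dots> = err_count j * (real n * real d ^ (j + a))"
    by (simp add: err_count_def power_add power_mult_distrib algebra_simps)
  finally show ?thesis unfolding S using d0 by (simp add: field_simps)
qed

definition "err_total j \<theta> = err_det j \<theta> / sqrt d + err_bad j / \<theta> + err_count j / d"

text \<open>Only good configurations enter with determinants of \<open>P\<close>. Once these are
  replaced by determinants of \<open>M\<close>, the bad configurations can be put back at a cost of
  order \<open>1 / \<theta>\<close>, so the full limit appears.\<close>

lemma good_moment:
  assumes \<theta>: "\<theta> > 0"
  shows "\<bar>(\<Sum>x\<in>good_configs \<theta> j. principal_det P (set (odd_list x))) / n - fact k ^ a * tree_limit j\<bar> \<le> err_total j \<theta>"
proof -
  let ?D = "real n * real d ^ (j + a)" and ?G = "good_configs \<theta> j" and ?L = "fact k ^ a * tree_limit j"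
  let ?P = "\<lambda>x. principal_det P (set (odd_list x))" and ?M = "\<lambda>x. principal_det M (set (odd_list x))"
  have D0: "?D > 0" using n0 d0 by simp
  have GC: "?G \<subseteq> configs j" by (auto simp: good_configs_def)
  have split: "(\<Sum>x\<in>configs j. ?M x) = (\<Sum>x\<in>configs j - ?G. ?M x) + (\<Sum>x\<in>?G. ?M x)"
    by (rule sum.subset_diff[OF GC finite_configs])
  have tri: "\<bar>x - y + z\<bar> \<le> \<bar>x\<bar> + \<bar>y\<bar> + \<bar>z\<bar>" for x y z :: real by linarith
  have eq: "real d ^ (j + a) * (\<Sum>x\<in>?G. ?P x) - ?L * ?D =
     (\<Sum>x\<in>?G. real d ^ (j + a) * ?P x - ?M x) - (\<Sum>x\<in>configs j - ?G. ?M x) + ((\<Sum>x\<in>configs j. ?M x) - ?L * ?D)"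
    unfolding split by (simp add: sum_subtractf sum_distrib_left)
  have "\<bar>real d ^ (j + a) * (\<Sum>x\<in>?G. ?P x) - ?L * ?D\<bar>
     \<le> \<bar>\<Sum>x\<in>?G. real d ^ (j + a) * ?P x - ?M x\<bar> + \<bar>\<Sum>x\<in>configs j - ?G. ?M x\<bar> + \<bar>(\<Sum>x\<in>configs j. ?M x) - ?L * ?D\<bar>"
    unfolding eq by (rule tri)
  also have "\<dots> \<le> (\<Sum>x\<in>?G. \<bar>real d ^ (j + a) * ?P x - ?M x\<bar>) + (\<Sum>x\<in>configs j - ?G. \<bar>?M x\<bar>) + \<bar>(\<Sum>x\<in>configs j. ?M x) - ?L * ?D\<bar>"
    by (rule add_mono[OF add_mono[OF sum_abs sum_abs] order_refl])
  also have "\<dots> \<le> err_det j \<theta> * ?D / sqrt d + err_bad j * ?D / \<theta> + err_count j * ?D / d"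
    by (rule add_mono[OF add_mono[OF good_det_error bad_configs_error[OF \<theta>]] config_sum_det_M]) (use \<theta> in simp)
  also have "\<dots> = ?D * err_total j \<theta>" by (simp add: err_total_def algebra_simps)
  finally have *: "\<bar>real d ^ (j + a) * (\<Sum>x\<in>?G. ?P x) - ?L * ?D\<bar> \<le> ?D * err_total j \<theta>" .
  have "real d ^ (j + a) * (\<Sum>x\<in>?G. ?P x) - ?L * ?D = ?D * ((\<Sum>x\<in>?G. ?P x) / n - ?L)"
    using n0 by (simp add: field_simps)
  then have "?D * \<bar>(\<Sum>x\<in>?G. ?P x) / n - ?L\<bar> \<le> ?D * err_total j \<theta>"
    using * D0 by (simp add: abs_mult)
  then show ?thesis using D0 by (simp only: mult_le_cancel_left_pos)
qed

end

section \<open>Exact embeddings and Bonferroni inequalities\<close>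

lemma card_distinct_lists:
  assumes Y: "finite Y"
  shows "card {xs. length xs = j \<and> distinct xs \<and> set xs \<subseteq> Y} = fact j * (card Y choose j)"
proof (cases "j \<le> card Y")
  case True
  have "fact j * fact (card Y - j) * (card Y choose j) = fact (card Y)"
    by (rule binomial_fact_lemma[OF True])
  then have "fact (card Y) div fact (card Y - j) = fact j * (card Y choose j)"
    by (metis div_mult_self_is_m fact_gt_zero mult.assoc mult.commute)
  then show ?thesis
    using card_lists_distinct_length_eq[OF Y True] fact_div_fact[of "card Y - j" "card Y"] by simp
next
  case False
  have "length xs \<le> card Y" if "distinct xs" "set xs \<subseteq> Y" for xs
    using card_mono[OF Y that(2)] that(1) by (simp add: distinct_card)
  then have "{xs. length xs = j \<and> distinct xs \<and> set xs \<subseteq> Y} = {}"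
    using False by auto
  then show ?thesis using False by (simp only: card.empty) simp
qed

lemma alternating_choose_sum:
  "(\<Sum>j<Suc m. (-1) ^ j * real (Suc N choose j)) = (-1) ^ m * real (N choose m)"
  by (induction m) (simp_all add: algebra_simps)

text \<open>For positive \<open>N\<close> the partial sum has the closed form above, which by
  Pascal's rule is at most the first omitted term.\<close>

lemma bonferroni:
  "\<bar>of_bool (N = 0) - (\<Sum>j<J. (-1) ^ j * real (N choose j))\<bar> \<le> real (N choose J)"
proof (cases J)
  case (Suc m)
  show ?thesis
  proof (cases N)
    case 0
    have "(\<Sum>j<Suc m. (-1) ^ j * real (0 choose j)) = (\<Sum>j\<in>{0}. (-1) ^ j * real (0 choose j))"
      by (rule sum.mono_neutral_right) auto
    then show ?thesis using 0 Suc by simp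
  next
    case N: (Suc N')
    then show ?thesis unfolding N Suc alternating_choose_sum by (simp add: abs_mult)
  qed
qed simp

context embedded_tree
begin

section \<open>Exact embeddings in the random set\<close>

abbreviation "\<mu> \<equiv> det_measure V U B"

lemma \<mu>_nonneg: "\<mu> S \<ge> 0" by (rule det_measure_nonneg[OF finV finU])

lemma \<mu>_total: "(\<Sum>S\<in>Pow U. \<mu> S) = 1"
  using det_measure_supersets[OF finV finU, of "{}" B] by simp

definition exact :: "'b set \<Rightarrow> (('x \<Rightarrow> 'a) \<times> ('u \<Rightarrow> 'b)) set" where
  "exact S = {(e, q) \<in> Emb. q ` set us = S \<inter> WU (e ` I)}"

text \<open>This bound holds for every fixed \<open>S\<close>: the inner vertices of an exactly embedded tree have at
  most \<open>length us\<close> neighbours in \<open>S\<close>, so few such trees pass through a given bad vertex.\<close>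
lemma exact_bad_le:
  assumes S: "S \<subseteq> U"
  shows "real (card (exact S - good_embs \<theta>))
    \<le> real Cf * (a * (fact (a - 1) * real ((k + 1) * a) ^ (a - 1) * (a * card (bad_vertices \<theta>))))"
proof (cases "us = []")
  case True
  then have "I = {}" using I_cover by auto
  then have "fst eq ` I \<inter> bad_vertices \<theta> = {}" for eq :: "('x \<Rightarrow> 'a) \<times> ('u \<Rightarrow> 'b)"
    by (simp only: image_empty Int_empty_left)
  then have "exact S - good_embs \<theta> = {}" unfolding exact_def good_embs_def by blast
  then have "card (exact S - good_embs \<theta>) = 0" by (simp only: card.empty)
  then show ?thesis by simp
next
  case us: False
  \<comment> \<open>Adjacency through a vertex with at most \<open>a\<close> neighbours in
    \<open>S\<close>. Exact embeddings are linked by this relation, and its degree within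
    \<open>S\<close> is bounded independently of \<open>d\<close>.\<close>
  define R where "R u w \<longleftrightarrow> (\<exists>v\<in>nbV u \<inter> nbV w. card (S \<inter> nbU v) \<le> a)" for u w
  define Z where "Z = {u \<in> S. \<exists>v\<in>nbV u \<inter> bad_vertices \<theta>. card (S \<inter> nbU v) \<le> a}"
  have fS: "finite S" using S finU finite_subset by blast
  interpret R: bounded_degree R S "real ((k + 1) * a)"
  proof
    show "finite S" by (rule fS)
    show "R u w \<Longrightarrow> R w u" for u w by (auto simp: R_def)
    show "real (card {w \<in> S. R u w}) \<le> real ((k + 1) * a)" if "u \<in> S" for u
    proof -
      let ?N = "{v \<in> nbV u. card (S \<inter> nbU v) \<le> a}"
      have "{w \<in> S. R u w} \<subseteq> (\<Union>v\<in>?N. S \<inter> nbU v)" by (auto simp: R_def mem_nb)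
      then have "card {w \<in> S. R u w} \<le> card (\<Union>v\<in>?N. S \<inter> nbU v)" using fS by (intro card_mono) auto
      also have "\<dots> \<le> (\<Sum>v\<in>?N. card (S \<inter> nbU v))" by (intro card_UN_le) auto
      also have "\<dots> \<le> (\<Sum>v\<in>?N. a)" by (intro sum_mono) auto
      also have "\<dots> \<le> card (nbV u) * a" by (simp add: card_mono)
      also have "\<dots> = (k + 1) * a" using that S by (subst card_nbV) auto
      finally show ?thesis by (rule of_nat_mono)
    qed
  qed simp
  have fb: "finite (bad_vertices \<theta>)" using finV by (simp add: bad_vertices_def)
  have cZ: "card Z \<le> a * card (bad_vertices \<theta>)"
  proof -
    let ?N = "{v \<in> bad_vertices \<theta>. card (S \<inter> nbU v) \<le> a}"
    have "Z \<subseteq> (\<Union>v\<in>?N. S \<inter> nbU v)" by (auto simp: Z_def mem_nb)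
    then have "card Z \<le> card (\<Union>v\<in>?N. S \<inter> nbU v)" using fS fb by (intro card_mono) auto
    also have "\<dots> \<le> (\<Sum>v\<in>?N. card (S \<inter> nbU v))" using fb by (intro card_UN_le) auto
    also have "\<dots> \<le> (\<Sum>v\<in>?N. a)" by (intro sum_mono) auto
    also have "\<dots> \<le> a * card (bad_vertices \<theta>)" using fb by (simp add: card_mono)
    finally show ?thesis .
  qed
  \<comment> \<open>Pairing with the empty list of leaves makes \<open>sum_odd_list_le\<close>
    applicable with \<open>j = 0\<close>.\<close>
  let ?X = "(exact S - good_embs \<theta>) \<times> {[] :: 'b list}" and ?T = "linked_lists R S a"
  let ?w = "\<lambda>h. \<Sum>p<a. (of_bool (h ! p \<in> Z) :: real)"
  have few: "card (S \<inter> nbU (e x)) \<le> a" if "(e, q) \<in> exact S" "x \<in> I" for e q x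
  proof -
    have eq: "(e, q) \<in> Emb" "q ` set us = S \<inter> WU (e ` I)" using that by (auto simp: exact_def)
    have "S \<inter> nbU (e x) \<subseteq> q ` set us" using eq(2) that(2) by (auto simp: WU_def)
    then show ?thesis using card_mono[of "q ` set us"] q_image(2)[OF eq(1)] by fastforce
  qed
  have "real (card (exact S - good_embs \<theta>)) = (\<Sum>x\<in>?X. 1)" by (simp add: card_cartesian_product)
  also have "\<dots> \<le> (\<Sum>x\<in>?X. ?w (odd_list x))"
  proof (rule sum_mono)
    fix x assume "x \<in> ?X"
    then obtain e q where xe: "x = ((e, q), [])" and ex: "(e, q) \<in> exact S" and nb: "(e, q) \<notin> good_embs \<theta>" by auto
    have eq: "(e, q) \<in> Emb" and qS: "q ` set us = S \<inter> WU (e ` I)" using ex by (auto simp: exact_def)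
    obtain y where y: "y \<in> I" "e y \<in> bad_vertices \<theta>" using nb eq by (auto simp: good_embs_def)
    obtain u where u: "u \<in> set us" "y \<in> nb u" using I_cover[OF y(1)] by blast
    then have "e y \<in> nbV (q u)" using embD(4)[OF eq u(1)] by blast
    then have "q u \<in> Z" using y u qS few[OF ex y(1)] by (auto simp: Z_def)
    moreover have "q u \<in> set (odd_list x)" using u by (simp add: xe odd_list_def)
    ultimately obtain p where p: "p < a" "odd_list x ! p \<in> Z"
      by (metis in_set_conv_nth length_map odd_list_def append_Nil xe fst_conv snd_conv)
    then have "(\<Sum>p\<in>{p}. of_bool (odd_list x ! p \<in> Z)) \<le> ?w (odd_list x)" by (intro sum_mono2) auto
    then show "1 \<le> ?w (odd_list x)" using p by simp
  qed
  also have "\<dots> \<le> real Cf * (\<Sum>h\<in>?T. ?w h)"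
  proof (rule sum_odd_list_le[OF us, where j = 0])
    show "?X \<subseteq> Emb \<times> {cs. length cs = 0}" by (auto simp: exact_def)
    have "finite (exact S)" by (rule finite_subset[OF _ finite_Emb]) (auto simp: exact_def)
    then show "finite ?X" by simp
    show "finite ?T" by (rule R.finite_linked_lists)
    show "odd_list ` ?X \<subseteq> ?T"
    proof
      fix h assume "h \<in> odd_list ` ?X"
      then obtain x where "x \<in> ?X" "h = odd_list x" by blast
      then obtain e q where h: "h = map q us" and ex: "(e, q) \<in> exact S" unfolding odd_list_def by force
      have eq: "(e, q) \<in> Emb" and qS: "q ` set us = S \<inter> WU (e ` I)" using ex by (auto simp: exact_def)
      have "linked R (map q us)"
        by (rule emb_linked[OF eq]) (use few[OF ex] in \<open>auto simp: R_def\<close>)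
      then show "h \<in> ?T" using qS by (auto simp: linked_lists_def h)
    qed
  qed (intro sum_nonneg, simp)
  also have "(\<Sum>h\<in>?T. ?w h) = (\<Sum>p<a. \<Sum>h\<in>?T. of_bool (h ! p \<in> Z))" by (rule sum.swap)
  finally have le1: "real (card (exact S - good_embs \<theta>)) \<le> real Cf * (\<Sum>p<a. \<Sum>h\<in>?T. of_bool (h ! p \<in> Z))" .
  have "(\<Sum>p<a. \<Sum>h\<in>?T. (of_bool (h ! p \<in> Z) :: real))
     \<le> (\<Sum>p<a. fact (a - 1) * real ((k + 1) * a) ^ (a - 1) * (\<Sum>u\<in>S. of_bool (u \<in> Z)))"
    by (intro sum_mono R.one_pin) auto
  also have "\<dots> = a * (fact (a - 1) * real ((k + 1) * a) ^ (a - 1) * real (card Z))"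
    using fS by (simp add: Z_def Int_def conj_commute)
  also have "\<dots> \<le> a * (fact (a - 1) * real ((k + 1) * a) ^ (a - 1) * (a * card (bad_vertices \<theta>)))"
    using of_nat_mono[OF cZ, where ?'a = real] by (intro mult_left_mono) auto
  finally have "real Cf * (\<Sum>p<a. \<Sum>h\<in>?T. (of_bool (h ! p \<in> Z) :: real))
    \<le> real Cf * (a * (fact (a - 1) * real ((k + 1) * a) ^ (a - 1) * (a * card (bad_vertices \<theta>))))"
    by (rule mult_left_mono) simp
  with le1 show ?thesis by (rule order_trans)
qed

definition mean_exact :: real where
  "mean_exact = (\<Sum>S\<in>Pow U. \<mu> S * card (exact S)) / n"

definition prob_exact :: "(('x \<Rightarrow> 'a) \<times> ('u \<Rightarrow> 'b)) \<Rightarrow> real" where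
  "prob_exact eq = (\<Sum>S\<in>Pow U. \<mu> S * of_bool (eq \<in> exact S))"

definition "err_exact = real Cf * (a * (fact (a - 1) * real ((k + 1) * a) ^ (a - 1) * a)) * (2 * k * (k + 1))"

text \<open>The bound on discarded embeddings holds for each \<open>S\<close> separately, so it
  survives averaging against any probability measure and needs no moment estimate.\<close>

lemma mean_exact_good:
  assumes \<theta>: "\<theta> > 0"
  shows "\<bar>mean_exact - (\<Sum>eq\<in>good_embs \<theta>. prob_exact eq) / n\<bar> \<le> err_exact / \<theta>"
proof -
  let ?c = "real Cf * (a * (fact (a - 1) * real ((k + 1) * a) ^ (a - 1) * a))"
  have fin: "finite (exact S)" for S by (rule finite_subset[OF _ finite_Emb]) (auto simp: exact_def)
  have fg: "finite (good_embs \<theta>)" using finite_Emb by (simp add: good_embs_def)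
  have "(\<Sum>eq\<in>good_embs \<theta>. prob_exact eq) = (\<Sum>S\<in>Pow U. \<mu> S * (\<Sum>eq\<in>good_embs \<theta>. of_bool (eq \<in> exact S)))"
    unfolding prob_exact_def sum_distrib_left by (rule sum.swap)
  also have "\<dots> = (\<Sum>S\<in>Pow U. \<mu> S * card (exact S \<inter> good_embs \<theta>))"
    using fg by (simp add: Int_def conj_commute)
  finally have G: "(\<Sum>eq\<in>good_embs \<theta>. prob_exact eq) = (\<Sum>S\<in>Pow U. \<mu> S * card (exact S \<inter> good_embs \<theta>))" .
  have split: "real (card (exact S)) = card (exact S \<inter> good_embs \<theta>) + card (exact S - good_embs \<theta>)" for S
    using card_Diff_subset_Int[of "exact S" "good_embs \<theta>"] fin[of S] card_mono[OF fin[of S], of "exact S \<inter> good_embs \<theta>"]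
    by (simp add: of_nat_diff)
  have diff: "mean_exact - (\<Sum>eq\<in>good_embs \<theta>. prob_exact eq) / n = (\<Sum>S\<in>Pow U. \<mu> S * card (exact S - good_embs \<theta>)) / n"
  proof -
    have "(\<Sum>S\<in>Pow U. \<mu> S * card (exact S))
       = (\<Sum>S\<in>Pow U. \<mu> S * card (exact S \<inter> good_embs \<theta>)) + (\<Sum>S\<in>Pow U. \<mu> S * card (exact S - good_embs \<theta>))"
      unfolding split by (simp add: distrib_left sum.distrib)
    then show ?thesis unfolding mean_exact_def G by (simp add: add_divide_distrib)
  qed
  have "(\<Sum>S\<in>Pow U. \<mu> S * card (exact S - good_embs \<theta>)) \<le> (\<Sum>S\<in>Pow U. \<mu> S * (?c * card (bad_vertices \<theta>)))"
  proof (intro sum_mono mult_left_mono \<mu>_nonneg)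
    fix S assume "S \<in> Pow U"
    then show "real (card (exact S - good_embs \<theta>)) \<le> ?c * card (bad_vertices \<theta>)"
      using exact_bad_le[of S \<theta>] by (simp add: mult_ac)
  qed
  also have "\<dots> = ?c * card (bad_vertices \<theta>)" by (simp add: \<mu>_total flip: sum_distrib_right)
  also have "\<dots> \<le> ?c * (2 * k * (k + 1) * n / \<theta>)"
    using card_bad_vertices[OF \<theta>] by (intro mult_left_mono) auto
  finally have le: "(\<Sum>S\<in>Pow U. \<mu> S * card (exact S - good_embs \<theta>)) \<le> ?c * (2 * k * (k + 1) * n / \<theta>)" .
  have "(\<Sum>S\<in>Pow U. \<mu> S * card (exact S - good_embs \<theta>)) / n \<le> ?c * (2 * k * (k + 1) * n / \<theta>) / n"
    by (rule divide_right_mono[OF le]) simp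
  also have "\<dots> = err_exact / \<theta>" using n0 by (simp add: err_exact_def)
  finally have "(\<Sum>S\<in>Pow U. \<mu> S * card (exact S - good_embs \<theta>)) / n \<le> err_exact / \<theta>" .
  moreover have "(\<Sum>S\<in>Pow U. \<mu> S * card (exact S - good_embs \<theta>)) / n \<ge> 0"
    by (intro divide_nonneg_nonneg sum_nonneg mult_nonneg_nonneg \<mu>_nonneg) auto
  ultimately show ?thesis unfolding diff by simp
qed

definition leaf_moment :: "nat \<Rightarrow> (('x \<Rightarrow> 'a) \<times> ('u \<Rightarrow> 'b)) \<Rightarrow> real" where
  "leaf_moment j eq = (\<Sum>cs\<in>leaf_lists (snd eq ` set us) (fst eq ` I) j. principal_det P (snd eq ` set us \<union> set cs))"

text \<open>Ordered lists of distinct leaves compute a factorial moment: on the event that the tree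
  is present, division by \<open>fact j\<close> gives the mean of a binomial coefficient in the
  number of extra elements.\<close>

lemma leaf_moment_eq:
  assumes eq: "(e, q) \<in> Emb"
  shows "leaf_moment j (e, q) / fact j =
    (\<Sum>S\<in>Pow U. \<mu> S * (of_bool (q ` set us \<subseteq> S) * real (card (S \<inter> (WU (e ` I) - q ` set us)) choose j)))"
proof -
  let ?A = "q ` set us" and ?W = "WU (e ` I)"
  let ?L = "leaf_lists ?A (e ` I) j"
  have "leaf_moment j (e, q) = (\<Sum>cs\<in>?L. \<Sum>S\<in>Pow U. \<mu> S * of_bool (?A \<union> set cs \<subseteq> S))"
    unfolding leaf_moment_def fst_conv snd_conv
  proof (intro sum.cong refl)
    fix cs assume "cs \<in> ?L"
    then have "?A \<union> set cs \<subseteq> U" using q_image(1)[OF eq] WU_sub[of "e ` I"] by (auto simp: leaf_lists_def)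
    then show "principal_det P (?A \<union> set cs) = (\<Sum>S\<in>Pow U. \<mu> S * of_bool (?A \<union> set cs \<subseteq> S))"
      by (rule det_measure_supersets[OF finV finU, symmetric])
  qed
  also have "\<dots> = (\<Sum>S\<in>Pow U. \<mu> S * (\<Sum>cs\<in>?L. of_bool (?A \<union> set cs \<subseteq> S)))"
    unfolding sum_distrib_left by (rule sum.swap)
  also have "\<dots> = (\<Sum>S\<in>Pow U. \<mu> S * (fact j * (of_bool (?A \<subseteq> S) * real (card (S \<inter> (?W - ?A)) choose j))))"
  proof (rule sum.cong[OF refl])
    fix S assume "S \<in> Pow U"
    have "(\<Sum>cs\<in>?L. of_bool (?A \<union> set cs \<subseteq> S)) = real (card (?L \<inter> {cs. ?A \<union> set cs \<subseteq> S}))"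
      using finite_leaf_lists by simp
    also have "\<dots> = of_bool (?A \<subseteq> S) * real (card {cs. length cs = j \<and> distinct cs \<and> set cs \<subseteq> S \<inter> (?W - ?A)})"
    proof (cases "?A \<subseteq> S")
      case True
      then have "?L \<inter> {cs. ?A \<union> set cs \<subseteq> S} = {cs. length cs = j \<and> distinct cs \<and> set cs \<subseteq> S \<inter> (?W - ?A)}"
        by (auto simp: leaf_lists_def)
      then show ?thesis using True by simp
    next
      case False
      then have "?L \<inter> {cs. ?A \<union> set cs \<subseteq> S} = {}" by auto
      then show ?thesis using False by (simp only: card.empty) simp
    qed
    also have "\<dots> = fact j * (of_bool (?A \<subseteq> S) * real (card (S \<inter> (?W - ?A)) choose j))"
      by (subst card_distinct_lists) (simp_all add: mult_ac)
    finally show "\<mu> S * (\<Sum>cs\<in>?L. of_bool (?A \<union> set cs \<subseteq> S)) =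
      \<mu> S * (fact j * (of_bool (?A \<subseteq> S) * real (card (S \<inter> (?W - ?A)) choose j)))" by simp
  qed
  also have "\<dots> = fact j * (\<Sum>S\<in>Pow U. \<mu> S * (of_bool (?A \<subseteq> S) * real (card (S \<inter> (?W - ?A)) choose j)))"
    by (simp add: sum_distrib_left mult_ac)
  finally show ?thesis by simp
qed

lemma prob_exact_bonferroni:
  assumes eq: "(e, q) \<in> Emb"
  shows "\<bar>prob_exact (e, q) - (\<Sum>j<J. (-1) ^ j * (leaf_moment j (e, q) / fact j))\<bar> \<le> leaf_moment J (e, q) / fact J"
proof -
  let ?A = "q ` set us" and ?W = "WU (e ` I)"
  define N where "N S = card (S \<inter> (?W - ?A))" for S
  have ex: "(e, q) \<in> exact S \<longleftrightarrow> ?A \<subseteq> S \<and> N S = 0" for S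
  proof -
    have "(e, q) \<in> exact S \<longleftrightarrow> ?A = S \<inter> ?W" using eq by (simp add: exact_def)
    also have "\<dots> \<longleftrightarrow> ?A \<subseteq> S \<and> S \<inter> (?W - ?A) = {}" using q_in_WU[OF eq] by blast
    finally show ?thesis by (simp add: N_def card_eq_0_iff)
  qed
  have m: "leaf_moment j (e, q) / fact j = (\<Sum>S\<in>Pow U. \<mu> S * (of_bool (?A \<subseteq> S) * real (N S choose j)))" for j
    unfolding N_def by (rule leaf_moment_eq[OF eq])
  have "(\<Sum>j<J. (-1) ^ j * (leaf_moment j (e, q) / fact j))
     = (\<Sum>S\<in>Pow U. \<mu> S * (of_bool (?A \<subseteq> S) * (\<Sum>j<J. (-1) ^ j * real (N S choose j))))"
    unfolding m sum_distrib_left by (subst sum.swap) (simp add: mult_ac)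
  then have "prob_exact (e, q) - (\<Sum>j<J. (-1) ^ j * (leaf_moment j (e, q) / fact j))
     = (\<Sum>S\<in>Pow U. \<mu> S * (of_bool (?A \<subseteq> S) * (of_bool (N S = 0) - (\<Sum>j<J. (-1) ^ j * real (N S choose j)))))"
    unfolding prob_exact_def ex by (simp add: of_bool_conj right_diff_distrib sum_subtractf)
  also have "\<bar>\<dots>\<bar> \<le> (\<Sum>S\<in>Pow U. \<bar>\<mu> S * (of_bool (?A \<subseteq> S) * (of_bool (N S = 0) - (\<Sum>j<J. (-1) ^ j * real (N S choose j))))\<bar>)"
    by (rule sum_abs)
  also have "\<dots> \<le> (\<Sum>S\<in>Pow U. \<mu> S * (of_bool (?A \<subseteq> S) * real (N S choose J)))"
    unfolding abs_mult using \<mu>_nonneg bonferroni by (intro sum_mono mult_mono) auto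
  finally show ?thesis unfolding m .
qed

lemma sum_leaf_moment: "(\<Sum>eq\<in>good_embs \<theta>. leaf_moment j eq) = (\<Sum>x\<in>good_configs \<theta> j. principal_det P (set (odd_list x)))"
proof -
  have "good_configs \<theta> j = (SIGMA eq:good_embs \<theta>. leaf_lists (snd eq ` set us) (fst eq ` I) j)"
    by (auto simp: good_configs_def configs_def good_embs_def)
  moreover have "(\<Sum>x\<in>good_configs \<theta> j. principal_det P (set (odd_list x)))
     = (\<Sum>x\<in>good_configs \<theta> j. case x of (eq, cs) \<Rightarrow> principal_det P (snd eq ` set us \<union> set cs))"
    by (intro sum.cong refl) (auto simp: odd_list_def Un_commute)
  moreover have "finite (good_embs \<theta>)" using finite_Emb by (simp add: good_embs_def)
  ultimately show ?thesis
    unfolding leaf_moment_def using finite_leaf_lists by (simp only:) (subst sum.Sigma, auto)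
qed

abbreviation "partial_limit J \<equiv> (\<Sum>j<J. (-1) ^ j * (fact k ^ a * tree_limit j / fact j))"

lemma mean_exact_error:
  assumes \<theta>: "\<theta> > 0"
  shows "\<bar>mean_exact - partial_limit J\<bar>
    \<le> err_exact / \<theta> + fact k ^ a * tree_limit J / fact J + (\<Sum>j\<le>J. err_total j \<theta> / fact j)"
proof -
  let ?G = "good_embs \<theta>"
  define Y where "Y j = (\<Sum>eq\<in>?G. leaf_moment j eq) / n" for j
  have Y: "\<bar>Y j / fact j - fact k ^ a * tree_limit j / fact j\<bar> \<le> err_total j \<theta> / fact j" for j
  proof -
    have "\<bar>Y j - fact k ^ a * tree_limit j\<bar> \<le> err_total j \<theta>"
      unfolding Y_def sum_leaf_moment by (rule good_moment[OF \<theta>])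
    then have "\<bar>Y j - fact k ^ a * tree_limit j\<bar> / fact j \<le> err_total j \<theta> / fact j" by (rule divide_right_mono) simp
    then show ?thesis by (simp flip: diff_divide_distrib)
  qed
  have "(\<Sum>j<J. (-1) ^ j * ((\<Sum>eq\<in>?G. leaf_moment j eq) / fact j))
     = (\<Sum>j<J. \<Sum>eq\<in>?G. (-1) ^ j * (leaf_moment j eq / fact j))"
    by (simp add: sum_distrib_left sum_divide_distrib)
  also have "\<dots> = (\<Sum>eq\<in>?G. \<Sum>j<J. (-1) ^ j * (leaf_moment j eq / fact j))" by (rule sum.swap)
  finally have "(\<Sum>eq\<in>?G. prob_exact eq) - (\<Sum>j<J. (-1) ^ j * ((\<Sum>eq\<in>?G. leaf_moment j eq) / fact j))
     = (\<Sum>eq\<in>?G. prob_exact eq - (\<Sum>j<J. (-1) ^ j * (leaf_moment j eq / fact j)))"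
    by (simp only: sum_subtractf)
  also have "\<bar>\<dots>\<bar> \<le> (\<Sum>eq\<in>?G. \<bar>prob_exact eq - (\<Sum>j<J. (-1) ^ j * (leaf_moment j eq / fact j))\<bar>)" by (rule sum_abs)
  also have "\<dots> \<le> (\<Sum>eq\<in>?G. leaf_moment J eq / fact J)"
  proof (rule sum_mono)
    fix eq assume "eq \<in> ?G"
    then have "(fst eq, snd eq) \<in> Emb" by (simp add: good_embs_def)
    from prob_exact_bonferroni[OF this, of J]
    show "\<bar>prob_exact eq - (\<Sum>j<J. (-1) ^ j * (leaf_moment j eq / fact j))\<bar> \<le> leaf_moment J eq / fact J" by simp
  qed
  finally have "\<bar>(\<Sum>eq\<in>?G. prob_exact eq) - (\<Sum>j<J. (-1) ^ j * ((\<Sum>eq\<in>?G. leaf_moment j eq) / fact j))\<bar> / n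
     \<le> (\<Sum>eq\<in>?G. leaf_moment J eq / fact J) / n" by (rule divide_right_mono) simp
  moreover have "\<bar>x\<bar> / n = \<bar>x / n\<bar>" for x :: real by simp
  moreover have "((\<Sum>eq\<in>?G. prob_exact eq) - (\<Sum>j<J. (-1) ^ j * ((\<Sum>eq\<in>?G. leaf_moment j eq) / fact j))) / n
     = (\<Sum>eq\<in>?G. prob_exact eq) / n - (\<Sum>j<J. (-1) ^ j * (Y j / fact j))"
    unfolding Y_def diff_divide_distrib sum_divide_distrib[of _ "{..<J}"] by (simp add: mult_ac)
  moreover have "(\<Sum>eq\<in>?G. leaf_moment J eq / fact J) / n = Y J / fact J"
    by (simp add: Y_def mult_ac flip: sum_divide_distrib)
  ultimately have 1: "\<bar>(\<Sum>eq\<in>?G. prob_exact eq) / n - (\<Sum>j<J. (-1) ^ j * (Y j / fact j))\<bar> \<le> Y J / fact J"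
    by (simp only:)
  have "\<bar>(\<Sum>j<J. (-1) ^ j * (Y j / fact j)) - partial_limit J\<bar>
     = \<bar>\<Sum>j<J. (-1) ^ j * (Y j / fact j - fact k ^ a * tree_limit j / fact j)\<bar>"
    by (simp add: sum_subtractf right_diff_distrib)
  also have "\<dots> \<le> (\<Sum>j<J. \<bar>(-1) ^ j * (Y j / fact j - fact k ^ a * tree_limit j / fact j)\<bar>)" by (rule sum_abs)
  also have "\<dots> \<le> (\<Sum>j<J. err_total j \<theta> / fact j)"
    using Y by (intro sum_mono) (simp add: abs_mult)
  finally have 2: "\<bar>(\<Sum>j<J. (-1) ^ j * (Y j / fact j)) - partial_limit J\<bar> \<le> (\<Sum>j<J. err_total j \<theta> / fact j)" .
  \<comment> \<open>The Bonferroni remainder is itself a moment and is replaced by its limit as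
    well; hence the error sum includes \<open>j = J\<close>.\<close>
  have 3: "Y J / fact J \<le> fact k ^ a * tree_limit J / fact J + err_total J \<theta> / fact J" using Y[of J] by linarith
  have 4: "(\<Sum>j\<le>J. err_total j \<theta> / fact j) = (\<Sum>j<J. err_total j \<theta> / fact j) + err_total J \<theta> / fact J"
    by (simp flip: lessThan_Suc_atMost)
  have tri: "\<bar>w - z\<bar> \<le> c1 + (b + (t + s))" if "\<bar>w - x\<bar> \<le> c1" "\<bar>x - y\<bar> \<le> c2" "\<bar>y - z\<bar> \<le> t" "c2 \<le> b + s" for w x y z b c1 c2 t s :: real
    using that by linarith
  show ?thesis
    unfolding 4 using tri[OF mean_exact_good[OF \<theta>] 1 2 3] by (simp only: add.assoc)
qed

end

text \<open>The parameters are chosen in the order \<open>J\<close>, \<open>\<theta>\<close>,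
  \<open>n\<close>: first the truncation, then a tolerance large enough to beat \<open>A J\<close>,
  and only then the size of the graph. So \<open>A\<close> may grow with \<open>J\<close>, and the
  speed of \<open>E\<close> may depend on both.\<close>

lemma nested_limit:
  fixes X s b A :: "nat \<Rightarrow> real"
  assumes s: "s \<longlonglongrightarrow> L" and b: "b \<longlonglongrightarrow> 0"
    and E: "\<And>J \<theta>. \<theta> > 0 \<Longrightarrow> E J \<theta> \<longlonglongrightarrow> 0"
    and bound: "\<forall>\<^sub>F n in sequentially. \<forall>J \<theta>. \<theta> > 0 \<longrightarrow> \<bar>X n - s J\<bar> \<le> A J / \<theta> + b J + E J \<theta> n"
  shows "X \<longlonglongrightarrow> L"
proof (rule LIMSEQ_I)
  fix r :: real assume r: "r > 0"
  have "\<forall>\<^sub>F J in sequentially. \<bar>s J - L\<bar> < r / 4" "\<forall>\<^sub>F J in sequentially. \<bar>b J\<bar> < r / 4"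
    using tendstoD[OF s, of "r / 4"] tendstoD[OF b, of "r / 4"] r by (simp_all add: dist_real_def)
  then have "\<forall>\<^sub>F J in sequentially. \<bar>s J - L\<bar> < r / 4 \<and> \<bar>b J\<bar> < r / 4" by (rule eventually_conj)
  then obtain J where J: "\<bar>s J - L\<bar> < r / 4" "\<bar>b J\<bar> < r / 4" by (auto simp: eventually_sequentially)
  define \<theta> where "\<theta> = 4 * \<bar>A J\<bar> / r + 1"
  have \<theta>: "\<theta> > 0" using r by (simp add: \<theta>_def add_nonneg_pos)
  have A: "A J / \<theta> < r / 4"
  proof -
    have "4 * \<bar>A J\<bar> < r * \<theta>" using r by (simp add: \<theta>_def distrib_left)
    then have "4 * A J < r * \<theta>" by linarith
    then show ?thesis using \<theta> by (simp add: field_simps)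
  qed
  have "\<forall>\<^sub>F n in sequentially. \<bar>E J \<theta> n\<bar> < r / 4"
    using tendstoD[OF E[OF \<theta>, of J], of "r / 4"] r by (simp add: dist_real_def)
  then have "\<forall>\<^sub>F n in sequentially. \<bar>X n - L\<bar> < r"
    using bound
  proof eventually_elim
    case (elim n)
    have "\<bar>X n - s J\<bar> \<le> A J / \<theta> + b J + E J \<theta> n" using elim(2) \<theta> by blast
    then show ?case using elim(1) A J by linarith
  qed
  then show "\<exists>N. \<forall>n\<ge>N. norm (X n - L) < r" by (simp add: eventually_sequentially)
qed

section \<open>Rooted trees\<close>

lemma walk_of_Cons: "walk_of adj (x # xs) \<longleftrightarrow> xs = [] \<or> adj x (hd xs) \<and> walk_of adj xs"
proof (cases xs)
  case (Cons y ys)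
  have "(\<forall>i. Suc i < length (x # xs) \<longrightarrow> adj ((x # xs) ! i) ((x # xs) ! Suc i))
     \<longleftrightarrow> adj x y \<and> (\<forall>i. Suc i < length xs \<longrightarrow> adj (xs ! i) (xs ! Suc i))" (is "?l \<longleftrightarrow> ?r")
  proof
    assume l: ?l
    have "adj x y" using l[rule_format, of 0] Cons by simp
    moreover have "adj (xs ! i) (xs ! Suc i)" if "Suc i < length xs" for i
      using l[rule_format, of "Suc i"] that by simp
    ultimately show ?r by blast
  next
    assume r: ?r
    show ?l
    proof (intro allI impI)
      fix i assume "Suc i < length (x # xs)"
      then show "adj ((x # xs) ! i) ((x # xs) ! Suc i)" using r Cons by (cases i) auto
    qed
  qed
  then show ?thesis using Cons by (auto simp: walk_of_def)
qed (simp add: walk_of_def)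

lemma walk_of_snoc: "walk_of adj (xs @ [y]) \<longleftrightarrow> xs = [] \<or> walk_of adj xs \<and> adj (last xs) y"
proof (induction xs)
  case (Cons x xs)
  show ?case
  proof (cases "xs = []")
    case False
    then show ?thesis using Cons by (auto simp: walk_of_Cons)
  qed (simp add: walk_of_Cons)
qed (simp add: walk_of_Cons)

lemma walk_of_nonempty: "walk_of adj xs \<Longrightarrow> xs \<noteq> []" by (simp add: walk_of_def)

locale valid_rooted_tree =
  fixes k :: nat and Tv :: "'t set" and TE :: "'t \<Rightarrow> 't \<Rightarrow> bool" and rt :: 't
  assumes tree: "finite_rooted_tree Tv TE rt" and valid: "valid_tree k Tv TE rt"
begin

abbreviation "ht \<equiv> vheight TE rt"
abbreviation "r \<equiv> tree_height Tv TE rt"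
abbreviation "Ev \<equiv> even_vertices Tv TE rt"
abbreviation "Od \<equiv> odd_vertices Tv TE rt"
abbreviation "I \<equiv> inner_even Tv TE rt"

definition nb :: "'t \<Rightarrow> 't set" where "nb u = {y \<in> Tv. TE u y}"

lemma finT: "finite Tv" and rtT: "rt \<in> Tv" and TE_sym: "TE x y \<Longrightarrow> TE y x" and TE_irr: "\<not> TE x x"
  and TE_in: "TE x y \<Longrightarrow> x \<in> Tv" "TE x y \<Longrightarrow> y \<in> Tv" and no_cycle: "\<not> is_cycle TE xs"
  using tree unfolding finite_rooted_tree_def by blast+

lemma connected: "y \<in> Tv \<Longrightarrow> \<exists>xs. walk_of TE xs \<and> hd xs = rt \<and> last xs = y"
  using tree unfolding finite_rooted_tree_def by blast

lemma ht_le: "walk_of TE xs \<Longrightarrow> hd xs = rt \<Longrightarrow> last xs = y \<Longrightarrow> length xs = Suc m \<Longrightarrow> ht y \<le> m"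
  unfolding vheight_def gdist_def by (rule Least_le) blast

lemma ht_walk:
  assumes "y \<in> Tv"
  obtains xs where "walk_of TE xs" "hd xs = rt" "last xs = y" "length xs = Suc (ht y)"
proof -
  obtain xs where xs: "walk_of TE xs" "hd xs = rt" "last xs = y" using connected[OF assms] by blast
  then have "length xs = Suc (length xs - 1)" using walk_of_nonempty[OF xs(1)] by (cases xs) auto
  with xs have "\<exists>m xs. walk_of TE xs \<and> hd xs = rt \<and> last xs = y \<and> length xs = Suc m" by blast
  from LeastI_ex[OF this] show ?thesis using that unfolding vheight_def gdist_def by blast
qed

lemma ht_rt [simp]: "ht rt = 0"
  using ht_le[of "[rt]" rt 0] by (simp add: walk_of_Cons)

lemma ht_0: "x \<in> Tv \<Longrightarrow> ht x = 0 \<Longrightarrow> x = rt"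
proof -
  assume "x \<in> Tv" "ht x = 0"
  then obtain xs where "hd xs = rt" "last xs = x" "length xs = Suc 0" using ht_walk by metis
  then show "x = rt" by (cases xs) auto
qed

lemma ht_step: "TE x y \<Longrightarrow> ht y \<le> Suc (ht x)"
proof -
  assume xy: "TE x y"
  obtain xs where xs: "walk_of TE xs" "hd xs = rt" "last xs = x" "length xs = Suc (ht x)"
    using ht_walk[OF TE_in(1)[OF xy]] .
  show ?thesis
    by (rule ht_le[of "xs @ [y]"]) (use xs xy walk_of_nonempty[OF xs(1)] in \<open>auto simp: walk_of_snoc\<close>)
qed

lemma parent_exists:
  assumes x: "x \<in> Tv" "x \<noteq> rt"
  obtains y where "TE y x" "ht x = Suc (ht y)"
proof -
  obtain xs where xs: "walk_of TE xs" "hd xs = rt" "last xs = x" "length xs = Suc (ht x)"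
    using ht_walk[OF x(1)] .
  have "ht x \<noteq> 0" using ht_0 x by blast
  then obtain ys where ys: "xs = ys @ [x]" "ys \<noteq> []"
    using xs walk_of_nonempty[OF xs(1)] by (metis append_butlast_last_id length_append_singleton list.size(3) nat.inject)
  then have w: "walk_of TE ys" "TE (last ys) x" using xs(1) by (auto simp: walk_of_snoc)
  have "hd ys = rt" using xs(2) ys by simp
  moreover have "length ys = Suc (ht x - 1)" using xs(4) ys \<open>ht x \<noteq> 0\<close> by simp
  ultimately have "ht (last ys) \<le> ht x - 1" using ht_le[OF w(1)] by blast
  then have "ht x = Suc (ht (last ys))" using ht_step[OF w(2)] \<open>ht x \<noteq> 0\<close> by simp
  then show ?thesis using that w(2) by blast
qed

text \<open>Descending from the higher end point until the two descents meet.\<close>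
lemma low_path:
  assumes "y \<in> Tv" "z \<in> Tv" "y \<noteq> z"
  shows "\<exists>xs. walk_of TE xs \<and> distinct xs \<and> hd xs = y \<and> last xs = z \<and>
    (\<forall>w\<in>set xs. w = y \<or> w = z \<or> ht w < max (ht y) (ht z))"
  using assms
proof (induction "ht y + ht z" arbitrary: y z rule: less_induct)
  case less
  show ?case
  proof (cases "ht z \<le> ht y")
    case True
    have "y \<noteq> rt" using True less.prems ht_0[of z] by auto
    then obtain p where p: "TE p y" "ht y = Suc (ht p)" using parent_exists less.prems by blast
    show ?thesis
    proof (cases "p = z")
      case True
      then show ?thesis using p TE_sym less.prems by (intro exI[of _ "[y, z]"]) (auto simp: walk_of_Cons)
    next
      case False
      obtain xs where xs: "walk_of TE xs" "distinct xs" "hd xs = p" "last xs = z"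
        "\<forall>w\<in>set xs. w = p \<or> w = z \<or> ht w < max (ht p) (ht z)"
        using less.hyps[of p z] False p TE_in less.prems by auto
      have "y \<notin> set xs" using xs(5) p(2) less.prems(3) True by auto
      moreover have "xs \<noteq> []" using walk_of_nonempty[OF xs(1)] .
      moreover have "\<forall>w\<in>set xs. w = y \<or> w = z \<or> ht w < max (ht y) (ht z)" using xs(5) p(2) True by auto
      ultimately show ?thesis using xs p TE_sym
        by (intro exI[of _ "y # xs"]) (auto simp: walk_of_Cons)
    qed
  next
    case False
    then have "z \<noteq> rt" by auto
    then obtain p where p: "TE p z" "ht z = Suc (ht p)" using parent_exists less.prems by blast
    show ?thesis
    proof (cases "p = y")
      case True
      then show ?thesis using p less.prems by (intro exI[of _ "[y, z]"]) (auto simp: walk_of_Cons)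
    next
      case False': False
      obtain xs where xs: "walk_of TE xs" "distinct xs" "hd xs = y" "last xs = p"
        "\<forall>w\<in>set xs. w = y \<or> w = p \<or> ht w < max (ht y) (ht p)"
        using less.hyps[of y p] False' p TE_in less.prems by auto
      have "z \<notin> set xs" using xs(5) p(2) less.prems(3) False by auto
      moreover have "xs \<noteq> []" using walk_of_nonempty[OF xs(1)] .
      moreover have "\<forall>w\<in>set xs. w = y \<or> w = z \<or> ht w < max (ht y) (ht z)" using xs(5) p(2) False by auto
      ultimately show ?thesis using xs p
        by (intro exI[of _ "xs @ [z]"]) (auto simp: walk_of_snoc)
    qed
  qed
qed

lemma unique_lower:
  assumes y: "TE x y" "ht y \<le> ht x" and z: "TE x z" "ht z \<le> ht x"
  shows "y = z"
proof (rule ccontr)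
  assume "y \<noteq> z"
  then obtain xs where xs: "walk_of TE xs" "distinct xs" "hd xs = y" "last xs = z"
    "\<forall>w\<in>set xs. w = y \<or> w = z \<or> ht w < max (ht y) (ht z)"
    using low_path TE_in y z by metis
  have ne: "xs \<noteq> []" using walk_of_nonempty[OF xs(1)] .
  have "x \<notin> set xs" using xs(5) y z TE_irr by (auto simp: max_def split: if_splits)
  moreover have "length xs \<ge> 2" using xs(3,4) \<open>y \<noteq> z\<close> ne by (cases xs; cases "tl xs") auto
  ultimately have "is_cycle TE (x # xs)"
    using xs y z ne TE_sym by (auto simp: is_cycle_def walk_of_Cons)
  then show False using no_cycle by blast
qed

lemma ht_adj: "TE x y \<Longrightarrow> ht y = Suc (ht x) \<or> ht x = Suc (ht y)"
proof -
  assume xy: "TE x y"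
  have "ht x \<noteq> ht y"
  proof
    assume h: "ht x = ht y"
    have "x \<noteq> rt"
    proof
      assume "x = rt"
      then have "y = rt" using h ht_0[of y] TE_in[OF xy] by simp
      then show False using \<open>x = rt\<close> xy TE_irr by auto
    qed
    then obtain p where p: "TE p x" "ht x = Suc (ht p)"
      using parent_exists[OF TE_in(1)[OF xy]] by blast
    have "p = y" by (rule unique_lower[OF TE_sym[OF p(1)] _ xy]) (use p(2) h in simp_all)
    then show False using p h by simp
  qed
  then show ?thesis using ht_step[OF xy] ht_step[OF TE_sym[OF xy]] by linarith
qed

lemma parity: "TE x y \<Longrightarrow> even (ht x) \<longleftrightarrow> odd (ht y)"
  using ht_adj[of x y] by auto

lemma Ev_Od: "Ev \<union> Od = Tv" "Ev \<inter> Od = {}"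
  by (auto simp: even_vertices_def odd_vertices_def)

lemma nb_Od: "u \<in> Od \<Longrightarrow> nb u \<subseteq> Ev"
  using parity by (auto simp: nb_def even_vertices_def odd_vertices_def)

lemma card_nb: "u \<in> Od \<Longrightarrow> card (nb u) = k + 1"
  using valid by (simp add: valid_tree_def nb_def)

lemma ht_le_r: "x \<in> Tv \<Longrightarrow> ht x \<le> r"
  using finT by (simp add: tree_height_def)

lemma I_sub_Ev: "I \<subseteq> Ev" by (auto simp: inner_even_def)

lemma Od_parent:
  assumes u: "u \<in> Od"
  obtains p where "p \<in> I" "p \<in> nb u" "ht u = Suc (ht p)"
proof -
  have uT: "u \<in> Tv" "odd (ht u)" using u by (auto simp: odd_vertices_def)
  then have "u \<noteq> rt" by auto
  then obtain p where p: "TE p u" "ht u = Suc (ht p)" using parent_exists[OF uT(1)] by blast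
  then have "ht p < r" "p \<in> Tv" using ht_le_r[OF uT(1)] TE_in[OF p(1)] by auto
  then have "p \<in> I" using p uT(2) by (auto simp: inner_even_def even_vertices_def)
  then show ?thesis using that p TE_sym[OF p(1)] TE_in[OF p(1)] by (simp add: nb_def)
qed

lemma Ev_parent:
  assumes x: "x \<in> Ev" "x \<noteq> rt"
  obtains u where "u \<in> Od" "x \<in> nb u" "ht x = Suc (ht u)"
proof -
  have xT: "x \<in> Tv" "even (ht x)" using x by (auto simp: even_vertices_def)
  then obtain u where u: "TE u x" "ht x = Suc (ht u)" using parent_exists[OF xT(1) x(2)] by blast
  then show ?thesis using that[of u] xT TE_in[OF u(1)] by (simp add: nb_def odd_vertices_def)
qed

text \<open>Other inner vertices have an odd parent. The root has none, but if it is inner the tree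
  has positive height, and a walk to a highest vertex starts with an odd child.\<close>

lemma I_cover:
  assumes x: "x \<in> I"
  shows "\<exists>u\<in>Od. x \<in> nb u"
proof (cases "x = rt")
  case False
  then show ?thesis using Ev_parent[of x] x I_sub_Ev by blast
next
  case True
  have "r \<in> ht ` Tv" unfolding tree_height_def using finT rtT by (intro Max_in) auto
  then obtain y where y: "y \<in> Tv" "ht y = r" by auto
  then obtain xs where xs: "walk_of TE xs" "hd xs = rt" "last xs = y" "length xs = Suc r" using ht_walk by metis
  have "r > 0" using x True by (simp add: inner_even_def)
  then obtain z zs where "xs = rt # z # zs" using xs(2,4) by (cases xs; cases "tl xs") auto
  then have rz: "TE rt z" using xs(1) by (simp add: walk_of_Cons)
  then have "z \<in> Od" "rt \<in> nb z"
    using TE_in[OF rz] TE_sym[OF rz] ht_adj[OF rz] rtT by (auto simp: nb_def odd_vertices_def)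
  then show ?thesis using True by blast
qed

text \<open>Breadth-first order, with the highest vertices at the head. When \<open>u\<close> is
  attached its parent is present already, while its other neighbours lie one level higher and have
  \<open>u\<close> as their only lower neighbour, so they are fresh.\<close>

lemma grown_ordering: "\<exists>us. distinct us \<and> set us = Od \<and> grown rt nb I us"
proof -
  have "finite Od" using finT by (simp add: odd_vertices_def)
  then obtain xs where xs: "set xs = Od" "distinct xs" using finite_distinct_list by blast
  define us where "us = rev (sort_key ht xs)"
  have us: "set us = Od" "distinct us" using xs by (auto simp: us_def)
  have desc: "sorted_wrt (\<lambda>a b. ht a \<ge> ht b) us"
    using sorted_sort_key[of ht xs] by (simp add: us_def sorted_wrt_rev sorted_map)
  have "us = pre @ us' \<Longrightarrow> grown rt nb I us'" for pre us'
  proof (induction us' arbitrary: pre)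
    case (Cons u us')
    have u: "u \<in> Od" using us Cons.prems by auto
    obtain p where p: "p \<in> I" "p \<in> nb u" "ht u = Suc (ht p)" using Od_parent[OF u] .
    have low: "w \<in> set us'" if "w \<in> Od" "ht w < ht u" for w
    proof -
      have "\<forall>a\<in>set pre. ht a \<ge> ht u" using desc Cons.prems by (auto simp: sorted_wrt_append)
      then have "w \<notin> set pre" "w \<noteq> u" using that by auto
      moreover have "w \<in> set pre \<union> {u} \<union> set us'" using that us(1) Cons.prems by auto
      ultimately show ?thesis by blast
    qed
    have high: "ht w \<le> ht u" if "w \<in> set us'" for w using desc Cons.prems that by (auto simp: sorted_wrt_append)
    have "p \<in> even_part rt nb us'"
    proof (cases "p = rt")
      case False
      then obtain w where "w \<in> Od" "p \<in> nb w" "ht p = Suc (ht w)" using Ev_parent[of p] p(1) I_sub_Ev by blast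
      then show ?thesis using low[of w] p(3) by (auto simp: even_part_def)
    qed (simp add: even_part_def)
    moreover have "y = p" if y: "y \<in> nb u" "y \<in> even_part rt nb us'" for y
    proof (rule ccontr)
      assume yp: "y \<noteq> p"
      have uy: "TE u y" "TE u p" using y p by (auto simp: nb_def)
      have "\<not> ht y \<le> ht u"
      proof
        assume "ht y \<le> ht u"
        then have "y = p" by (rule unique_lower[OF uy(1) _ uy(2)]) (use p(3) in simp)
        then show False using yp by simp
      qed
      then have hy: "ht y = Suc (ht u)" using ht_adj[OF uy(1)] by auto
      then have "y \<noteq> rt" by auto
      then obtain w where w: "w \<in> set us'" "TE w y" using y(2) by (auto simp: even_part_def nb_def)
      have "w = u"
        by (rule unique_lower[OF TE_sym[OF w(2)] _ TE_sym[OF uy(1)]]) (use hy high[OF w(1)] in simp_all)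
      then show False using w(1) us(2) Cons.prems by auto
    qed
    ultimately have "nb u \<inter> even_part rt nb us' = {p}" using p(2) by blast
    moreover have "grown rt nb I us'" using Cons.IH[of "pre @ [u]"] Cons.prems by simp
    ultimately show ?case using p(1) us(2) Cons.prems by auto
  qed simp
  then have "grown rt nb I us" by (metis append_Nil)
  then show ?thesis using us by blast
qed

text \<open>The ordering is chosen from the tree alone, so that constants built from it do not vary
  with \<open>n\<close>.\<close>

definition us :: "'t list" where
  "us = (SOME us. distinct us \<and> set us = Od \<and> grown rt nb I us)"

lemma us: "distinct us" "set us = Od" "grown rt nb I us"
  using someI_ex[OF grown_ordering] unfolding us_def by blast+

lemma length_us: "length us = card Od" using us distinct_card by metis

lemma even_part_us: "even_part rt nb us = Ev"
proof
  show "even_part rt nb us \<subseteq> Ev"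
    using nb_Od rtT us(2) by (auto simp: even_part_def even_vertices_def)
  show "Ev \<subseteq> even_part rt nb us"
  proof
    fix x assume x: "x \<in> Ev"
    show "x \<in> even_part rt nb us"
    proof (cases "x = rt")
      case False
      then obtain u where "u \<in> Od" "x \<in> nb u" using Ev_parent[OF x] by blast
      then show ?thesis using us(2) by (auto simp: even_part_def)
    qed (simp add: even_part_def)
  qed
qed

text \<open>Every edge has exactly one odd end and every odd vertex is saturated, so a matching is
  the graph of an injective choice of neighbours for the odd vertices.\<close>

lemma num_matchings_eq: "num_matchings I Tv TE rt = card {f \<in> Pi\<^sub>E Od nb. inj_on f Od \<and> I \<subseteq> f ` Od}"
proof -
  let ?F = "{f \<in> Pi\<^sub>E Od nb. inj_on f Od \<and> I \<subseteq> f ` Od}"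
  let ?G = "{M. is_matching TE M \<and> I \<union> Od \<subseteq> \<Union>M}"
  define m where "m f = (\<lambda>u. {u, f u}) ` Od" for f :: "'t \<Rightarrow> 't"
  have fE: "f u \<in> Ev" "TE u (f u)" "f u \<in> nb u" if "f \<in> ?F" "u \<in> Od" for f u
  proof -
    show "f u \<in> nb u" using that by auto
    then show "f u \<in> Ev" "TE u (f u)" using nb_Od[OF that(2)] by (auto simp: nb_def)
  qed
  have ne: "x \<noteq> y" if "x \<in> Ev" "y \<in> Od" for x y using that Ev_Od(2) by auto
  have "bij_betw m ?F ?G"
    unfolding bij_betw_def
  proof
    show "inj_on m ?F"
    proof (rule inj_onI)
      fix f g assume f: "f \<in> ?F" and g: "g \<in> ?F" and mm: "m f = m g"
      have "f u = g u" if u: "u \<in> Od" for u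
      proof -
        have "{u, f u} \<in> m g" using u mm by (auto simp: m_def)
        then obtain w where w: "w \<in> Od" "{u, f u} = {w, g w}" by (auto simp: m_def)
        then have "u = w" using ne fE(1)[OF g w(1)] u by (metis doubleton_eq_iff)
        then show ?thesis using w(2) by (auto simp: doubleton_eq_iff)
      qed
      then show "f = g" using f g by (auto simp: PiE_iff intro: extensionalityI)
    qed
    show "m ` ?F = ?G"
    proof (intro equalityI subsetI)
      fix M assume "M \<in> m ` ?F"
      then obtain f where f: "f \<in> ?F" and M: "M = m f" by auto
      have "is_matching TE M"
        unfolding is_matching_def
      proof (intro conjI ballI impI)
        fix e assume "e \<in> M"
        then show "\<exists>x y. e = {x, y} \<and> TE x y" using fE(2)[OF f] by (auto simp: M m_def)
      next
        fix e1 e2 assume "e1 \<in> M" "e2 \<in> M" "e1 \<noteq> e2"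
        then obtain u w where u: "u \<in> Od" "e1 = {u, f u}" and w: "w \<in> Od" "e2 = {w, f w}" "u \<noteq> w"
          by (auto simp: M m_def)
        then have "f u \<noteq> f w" using f by (auto dest: inj_onD)
        then show "e1 \<inter> e2 = {}" using u w ne fE(1)[OF f u(1)] fE(1)[OF f w(1)] by auto
      qed
      moreover have "I \<union> Od \<subseteq> \<Union>M" using f by (auto simp: M m_def)
      ultimately show "M \<in> ?G" by simp
    next
      fix M assume "M \<in> ?G"
      then have M: "\<And>e. e \<in> M \<Longrightarrow> \<exists>x y. e = {x, y} \<and> TE x y"
        "\<And>e1 e2. e1 \<in> M \<Longrightarrow> e2 \<in> M \<Longrightarrow> e1 \<noteq> e2 \<Longrightarrow> e1 \<inter> e2 = {}"
        and cov: "I \<subseteq> \<Union>M" "Od \<subseteq> \<Union>M" by (auto simp: is_matching_def)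
      have edge: "\<exists>y. {u, y} \<in> M \<and> TE u y" if "u \<in> \<Union>M" for u
      proof -
        obtain e where e: "e \<in> M" "u \<in> e" using \<open>u \<in> \<Union>M\<close> by blast
        then obtain x y where xy: "e = {x, y}" "TE x y" using M(1) by blast
        then show ?thesis using e TE_sym[OF xy(2)] by (cases "u = x") (auto simp: insert_commute)
      qed
      then have "\<forall>u\<in>Od. \<exists>y. {u, y} \<in> M \<and> TE u y" using cov by blast
      then obtain f0 where f0: "\<And>u. u \<in> Od \<Longrightarrow> {u, f0 u} \<in> M \<and> TE u (f0 u)" by metis
      define f where "f = restrict f0 Od"
      have f: "{u, f u} \<in> M" "TE u (f u)" "f u \<in> nb u" if "u \<in> Od" for u
        using f0[OF that] that TE_in(2)[of u "f0 u"] by (auto simp: f_def nb_def)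
      have fE: "f u \<in> Ev" if "u \<in> Od" for u using f(3)[OF that] nb_Od[OF that] by blast
      have inj: "inj_on f Od"
      proof (rule inj_onI, rule ccontr)
        fix u w assume u: "u \<in> Od" "w \<in> Od" "f u = f w" "u \<noteq> w"
        then have "{u, f u} \<noteq> {w, f w}" using ne fE by (metis doubleton_eq_iff)
        then show False using M(2)[OF f(1)[OF u(1)] f(1)[OF u(2)]] u(3) by auto
      qed
      have same: "e = {u, f u}" if "e \<in> M" "u \<in> Od" "u \<in> e" for e u
        using M(2)[OF that(1) f(1)[OF that(2)]] that by blast
      have odd_end: "\<exists>u\<in>Od. u \<in> e" if "e \<in> M" for e
      proof -
        obtain x y where xy: "e = {x, y}" "TE x y" using M(1)[OF \<open>e \<in> M\<close>] by blast
        then have "x \<in> Od \<or> y \<in> Od" using parity[of x y] TE_in[of x y] by (auto simp: odd_vertices_def)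
        then show ?thesis using xy by auto
      qed
      have "I \<subseteq> f ` Od"
      proof
        fix x assume x: "x \<in> I"
        then obtain e where e: "e \<in> M" "x \<in> e" using cov by blast
        obtain u where u: "u \<in> Od" "u \<in> e" using odd_end[OF e(1)] by blast
        have "e = {u, f u}" using same e u by blast
        moreover have "x \<noteq> u" using x I_sub_Ev ne u by blast
        ultimately show "x \<in> f ` Od" using e u by auto
      qed
      moreover have "f \<in> Pi\<^sub>E Od nb" using f(3) by (auto simp: f_def)
      moreover have "M = m f" using same odd_end f(1) by (fastforce simp: m_def)
      ultimately show "M \<in> m ` ?F" using inj by blast
    qed
  qed
  then have "card ?F = card ?G" by (rule bij_betw_same_card)
  then show ?thesis by (simp add: num_matchings_def)
qed

end

section \<open>Balls and embeddings\<close>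

context embedded_tree
begin

lemma tree_limit_sums:
  "(\<lambda>j. (-1) ^ j * (fact k ^ a * tree_limit j / fact j)) sums
     (exp (- (real k * \<kappa>)) * fact k ^ a * card {f \<in> tree_sat. I \<subseteq> f ` set us})"
proof -
  have fin: "finite tree_sat"
    unfolding tree_sat_def by (rule finite_subset[of _ "Pi\<^sub>E (set us) nb"]) (auto intro!: finite_PiE finite_nb)
  have "(\<lambda>j. \<Sum>f\<in>tree_sat. (-1) ^ j * death_sum (real k * \<kappa>) j (card (I - f ` set us)) / fact j) sums
      (\<Sum>f\<in>tree_sat. if card (I - f ` set us) = 0 then exp (- (real k * \<kappa>)) else 0)"
    by (intro sums_sum death_sum_sums)
  from sums_mult[OF this, of "fact k ^ a"]
  have "(\<lambda>j. (-1) ^ j * (fact k ^ a * tree_limit j / fact j)) sums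
      (fact k ^ a * (\<Sum>f\<in>tree_sat. if card (I - f ` set us) = 0 then exp (- (real k * \<kappa>)) else 0))"
    by (simp add: tree_limit_def sum_distrib_left sum_divide_distrib mult_ac)
  moreover have "(\<Sum>f\<in>tree_sat. if card (I - f ` set us) = 0 then exp (- (real k * \<kappa>)) else 0)
     = (\<Sum>f\<in>{f \<in> tree_sat. I \<subseteq> f ` set us}. exp (- (real k * \<kappa>)))"
    using fin finite_I by (intro sum.mono_neutral_cong_right) auto
  ultimately show ?thesis by (simp add: mult_ac)
qed

end

locale tree_graph = bireg k d n V U E B + valid_rooted_tree k Tv TE rt
  for k d n :: nat and V :: "'a set" and U :: "'b set" and E :: "('a \<times> 'b) set"
    and B :: "'a \<Rightarrow> 'b \<Rightarrow> real" and Tv :: "'t set" and TE :: "'t \<Rightarrow> 't \<Rightarrow> bool" and rt :: 't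
begin

sublocale T: embedded_tree k d n V U E B rt nb us I
proof
  show "grown rt nb I us" by (rule us(3))
  show "card (nb u) = k + 1" if "u \<in> set us" for u using card_nb that us(2) by blast
  show "\<exists>u\<in>set us. x \<in> nb u" if "x \<in> I" for x using I_cover[OF that] us(2) by simp
qed

lemma emb_Ev:
  assumes "(e, q) \<in> embs rt nb us"
  shows "e \<in> Ev \<rightarrow>\<^sub>E V" "q \<in> Od \<rightarrow>\<^sub>E U" "inj_on e Ev" "\<And>u. u \<in> Od \<Longrightarrow> e ` nb u = nbV (q u)"
  using T.embD[OF assms] us(2) even_part_us by auto

abbreviation "adj \<equiv> adj_sub E"
abbreviation "sball S v \<equiv> ball_set (adj_sub E S) (Inl v) r"

lemma adj_simps [simp]:
  "adj S (Inl v) (Inr u) \<longleftrightarrow> u \<in> S \<and> v \<in> nbV u" "adj S (Inr u) (Inl v) \<longleftrightarrow> u \<in> S \<and> v \<in> nbV u"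
  "\<not> adj S (Inl v) (Inl w)" "\<not> adj S (Inr x) (Inr y)"
  using EVU by (auto simp: adj_sub_def nbV_def)

definition glue :: "('t \<Rightarrow> 'a) \<Rightarrow> ('t \<Rightarrow> 'b) \<Rightarrow> 't \<Rightarrow> 'a + 'b" where
  "glue e q t = (if t \<in> Ev then Inl (e t) else Inr (q t))"

text \<open>These maps go from the tree to the ball, opposite to \<open>rooted_iso\<close>, so that
  automorphisms of the tree act by composition; extensionality makes them countable.\<close>

definition isos :: "'b set \<Rightarrow> 'a \<Rightarrow> ('t \<Rightarrow> 'a + 'b) set" where
  "isos S v = {g \<in> extensional Tv. bij_betw g Tv (sball S v) \<and> g rt = Inl v \<and>
     (\<forall>x\<in>Tv. \<forall>y\<in>Tv. TE x y \<longleftrightarrow> adj S (g x) (g y))}"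

lemma rt_Ev: "rt \<in> Ev" using rtT by (simp add: even_vertices_def)

lemma walk_map: "walk_of TE xs \<Longrightarrow> (\<And>x y. TE x y \<Longrightarrow> R (g x) (g y)) \<Longrightarrow> walk_of R (map g xs)"
  by (simp add: walk_of_def)

lemma mem_nb_tree: "x \<in> nb u \<longleftrightarrow> TE u x" using TE_in(2) by (auto simp: nb_def)

text \<open>A walk of length at most \<open>r\<close> from the root cannot leave the image: at inner
  vertices exactness allows only embedded odd vertices, and the star of an embedded odd vertex lies
  entirely in the image.\<close>

lemma exact_glue:
  assumes ex: "(e, q) \<in> T.exact S" and S: "S \<subseteq> U"
  shows "restrict (glue e q) Tv \<in> isos S (e rt)"
proof -
  have eq: "(e, q) \<in> embs rt nb us" and qS: "q ` Od = S \<inter> WU (e ` I)"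
    using ex us(2) by (auto simp: T.exact_def)
  note e = emb_Ev[OF eq]
  have eo: "adj S (Inl (e x)) (Inr (q y)) \<longleftrightarrow> TE x y" if x: "x \<in> Ev" and y: "y \<in> Od" for x y
  proof -
    have "e x \<in> e ` nb y \<longleftrightarrow> x \<in> nb y" by (rule inj_on_image_mem_iff[OF e(3) x nb_Od[OF y]])
    moreover have "q y \<in> S" using qS y by blast
    ultimately show ?thesis using e(4)[OF y] mem_nb_tree TE_sym by auto
  qed
  have adj: "TE x y \<longleftrightarrow> adj S (glue e q x) (glue e q y)" if xy: "x \<in> Tv" "y \<in> Tv" for x y
  proof -
    have sym: "adj S (Inr a) (Inl b) \<longleftrightarrow> adj S (Inl b) (Inr a)" for a b by simp
    consider "x \<in> Ev" "y \<in> Ev" | "x \<in> Ev" "y \<in> Od" | "x \<in> Od" "y \<in> Ev" | "x \<in> Od" "y \<in> Od"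
      using xy Ev_Od(1) by blast
    then show ?thesis
    proof cases
      case 1
      then show ?thesis using parity[of x y] by (auto simp: glue_def even_vertices_def)
    next
      case 2
      then have "y \<notin> Ev" using Ev_Od(2) by blast
      then show ?thesis using eo[OF 2] 2 by (simp add: glue_def)
    next
      case 3
      then have "x \<notin> Ev" using Ev_Od(2) by blast
      moreover have "TE x y \<longleftrightarrow> TE y x" using TE_sym by blast
      ultimately show ?thesis using eo[OF 3(2,1)] 3 by (simp add: glue_def)
    next
      case 4
      then have "x \<notin> Ev" "y \<notin> Ev" using Ev_Od(2) by blast+
      then show ?thesis using parity[of x y] 4 by (auto simp: glue_def odd_vertices_def)
    qed
  qed
  have inj: "inj_on (glue e q) Tv"
  proof (rule inj_onI)
    fix x y assume x: "x \<in> Tv" and y: "y \<in> Tv" and g: "glue e q x = glue e q y"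
    have q: "inj_on q Od" using T.inj_q[OF eq] us(2) by simp
    show "x = y"
      using g x y Ev_Od(1) e(3) q by (auto simp: glue_def dest: inj_onD split: if_splits)
  qed
  have sub: "glue e q t \<in> sball S (e rt)" if t: "t \<in> Tv" for t
  proof -
    obtain xs where xs: "walk_of TE xs" "hd xs = rt" "last xs = t" "length xs = Suc (ht t)" using ht_walk[OF t] .
    have "walk_of (adj S) (map (glue e q) xs)"
      by (rule walk_map[OF xs(1)]) (use adj TE_in in blast)
    moreover have "hd (map (glue e q) xs) = Inl (e rt)" "last (map (glue e q) xs) = glue e q t"
      using xs walk_of_nonempty[OF xs(1)] rt_Ev by (simp_all add: hd_map last_map glue_def)
    ultimately show ?thesis unfolding ball_set_def
      using xs(4) ht_le_r[OF t] by (intro CollectI exI[of _ "map (glue e q) xs"]) simp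
  qed
  have reach: "walk_of (adj S) xs \<Longrightarrow> hd xs = Inl (e rt) \<Longrightarrow> length xs \<le> Suc r \<Longrightarrow>
     \<exists>t\<in>Tv. glue e q t = last xs \<and> Suc (ht t) \<le> length xs" for xs
  proof (induction xs rule: rev_induct)
    case Nil
    then show ?case by (simp add: walk_of_def)
  next
    case (snoc y xs)
    show ?case
    proof (cases "xs = []")
      case True
      then show ?thesis using snoc.prems rtT rt_Ev by (intro bexI[of _ rt]) (auto simp: glue_def)
    next
      case False
      then have w: "walk_of (adj S) xs" "adj S (last xs) y" "hd xs = Inl (e rt)" "length xs \<le> r"
        using snoc.prems by (auto simp: walk_of_snoc)
      then obtain t where t: "t \<in> Tv" "glue e q t = last xs" "Suc (ht t) \<le> length xs"
        using snoc.IH by auto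
      have "\<exists>t'\<in>Tv. glue e q t' = y \<and> TE t t'"
      proof (cases "t \<in> Ev")
        case True
        then have l: "last xs = Inl (e t)" using t(2) by (simp add: glue_def)
        then obtain u where u: "y = Inr u" "u \<in> S" "e t \<in> nbV u" using w(2) by (cases y) auto
        \<comment> \<open>Before the last step the walk has at most \<open>r\<close> vertices, so
          \<open>t\<close> has height below \<open>r\<close> and is inner.\<close>
        have "t \<in> I" using True t(3) w(4) by (simp add: inner_even_def)
        then have "u \<in> WU (e ` I)" using u(3) mem_nb by (auto simp: WU_def)
        then have "u \<in> q ` Od" using u(2) qS by blast
        then obtain t' where t': "t' \<in> Od" "u = q t'" by blast
        then have "TE t t'" using eo[OF True t'(1)] u by simp
        moreover have "glue e q t' = y" using t' u Ev_Od(2) by (auto simp: glue_def)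
        ultimately show ?thesis using TE_in(2) by blast
      next
        case False
        then have to: "t \<in> Od" using t(1) Ev_Od(1) by blast
        have l: "last xs = Inr (q t)" using t(2) False by (simp add: glue_def)
        then obtain v where v: "y = Inl v" "v \<in> nbV (q t)" using w(2) by (cases y) auto
        then obtain t' where t': "t' \<in> nb t" "v = e t'" using e(4)[OF to] by blast
        then have "t' \<in> Ev" "TE t t'" using nb_Od[OF to] mem_nb_tree by auto
        then show ?thesis using v t' TE_in(2)[of t t'] by (intro bexI[of _ t']) (auto simp: glue_def)
      qed
      then obtain t' where "t' \<in> Tv" "glue e q t' = y" "TE t t'" by blast
      then show ?thesis using t(3) ht_step[of t t'] by (intro bexI[of _ t']) auto
    qed
  qed
  have "glue e q ` Tv = sball S (e rt)"
  proof
    show "glue e q ` Tv \<subseteq> sball S (e rt)" using sub by blast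
    show "sball S (e rt) \<subseteq> glue e q ` Tv"
    proof
      fix y assume "y \<in> sball S (e rt)"
      then obtain xs where "walk_of (adj S) xs" "hd xs = Inl (e rt)" "last xs = y" "length xs \<le> Suc r"
        by (auto simp: ball_set_def)
      then show "y \<in> glue e q ` Tv" using reach[of xs] by (metis imageI)
    qed
  qed
  then have "bij_betw (glue e q) Tv (sball S (e rt))" using inj by (simp add: bij_betw_def)
  then have "bij_betw (restrict (glue e q) Tv) Tv (sball S (e rt))" by (subst bij_betw_cong[of _ _ "glue e q"]) auto
  moreover have "restrict (glue e q) Tv rt = Inl (e rt)" using rtT rt_Ev by (simp add: glue_def)
  moreover have "\<forall>x\<in>Tv. \<forall>y\<in>Tv. TE x y \<longleftrightarrow> adj S (restrict (glue e q) Tv x) (restrict (glue e q) Tv y)"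
    using adj by simp
  ultimately show ?thesis unfolding isos_def by blast
qed

text \<open>Adjacency alternates between \<open>Inl\<close> and \<open>Inr\<close>, so parity of the
  height splits \<open>g\<close> into \<open>e\<close> and \<open>q\<close>. Degree
  \<open>k + 1\<close> on both sides makes the stars agree. An element of \<open>S\<close> next to
  the image of an inner vertex is within distance \<open>r\<close> of \<open>v\<close>, hence in the
  ball and in the image.\<close>

lemma isos_exact:
  assumes g: "g \<in> isos S v" and v: "v \<in> V" and S: "S \<subseteq> U"
  shows "\<exists>e q. (e, q) \<in> T.exact S \<and> e rt = v \<and> restrict (glue e q) Tv = g"
proof -
  have ext: "g \<in> extensional Tv" and bij: "bij_betw g Tv (sball S v)" and grt: "g rt = Inl v"
    and gadj: "\<And>x y. x \<in> Tv \<Longrightarrow> y \<in> Tv \<Longrightarrow> TE x y \<longleftrightarrow> adj S (g x) (g y)"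
    using g unfolding isos_def by blast+
  have TEadj: "adj S (g x) (g y)" if "TE x y" for x y using gadj TE_in[OF that] that by blast
  have par: "t \<in> Tv \<Longrightarrow> ht t = m \<Longrightarrow> even m \<longleftrightarrow> isl (g t)" for m t
  proof (induction m arbitrary: t)
    case 0
    then have "t = rt" using ht_0 by simp
    then show ?case using grt by simp
  next
    case (Suc m)
    then have "t \<noteq> rt" by auto
    then obtain p where p: "TE p t" "ht t = Suc (ht p)" using parent_exists[OF Suc.prems(1)] by blast
    then have "even m \<longleftrightarrow> isl (g p)" using Suc TE_in(1)[OF p(1)] by auto
    moreover have "isl (g p) \<longleftrightarrow> \<not> isl (g t)" using TEadj[OF p(1)] by (cases "g p"; cases "g t") auto
    ultimately show ?case by simp
  qed
  define e where "e = (\<lambda>t\<in>Ev. projl (g t))"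
  define q where "q = (\<lambda>t\<in>Od. projr (g t))"
  have gE: "g t = Inl (e t)" if "t \<in> Ev" for t
    using par[of t "ht t"] that by (auto simp: e_def even_vertices_def)
  have gO: "g t = Inr (q t)" if "t \<in> Od" for t
    using par[of t "ht t"] that by (auto simp: q_def odd_vertices_def)
  have glue: "restrict (glue e q) Tv = g"
  proof (rule extensionalityI[OF _ ext])
    fix t assume t: "t \<in> Tv"
    show "restrict (glue e q) Tv t = g t"
    proof (cases "t \<in> Ev")
      case False
      then have "t \<in> Od" using t Ev_Od(1) by blast
      then show ?thesis using gO t False by (simp add: glue_def)
    qed (use gE t in \<open>simp add: glue_def\<close>)
  qed simp
  have edge: "e y \<in> nbV (q u)" "q u \<in> S" if u: "u \<in> Od" and y: "y \<in> nb u" for u y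
  proof -
    have "y \<in> Ev" "TE u y" using nb_Od[OF u] y mem_nb_tree by auto
    then have "adj S (Inr (q u)) (Inl (e y))" using TEadj[of u y] gE gO u by simp
    then show "e y \<in> nbV (q u)" "q u \<in> S" by simp_all
  qed
  have ert: "e rt = v" using gE[OF rt_Ev] grt by simp
  have injg: "inj_on g Tv" using bij by (rule bij_betw_imp_inj_on)
  have EvT: "Ev \<subseteq> Tv" and OdT: "Od \<subseteq> Tv" using Ev_Od(1) by auto
  have "e t \<in> V" if t: "t \<in> Ev" for t
  proof (cases "t = rt")
    case False
    then obtain u where "u \<in> Od" "t \<in> nb u" using Ev_parent[OF t] by blast
    then show ?thesis using edge(1) nbV_sub by blast
  qed (use ert v in simp)
  then have e: "e \<in> Ev \<rightarrow>\<^sub>E V" by (auto simp: e_def)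
  have qS: "q u \<in> S" if u: "u \<in> Od" for u
  proof -
    obtain p where "p \<in> nb u" using Od_parent[OF u] by blast
    then show ?thesis using edge(2)[OF u] by blast
  qed
  then have q: "q \<in> Od \<rightarrow>\<^sub>E U" using S by (auto simp: q_def)
  have inje: "inj_on e Ev"
  proof (rule inj_onI)
    fix x y assume xy: "x \<in> Ev" "y \<in> Ev" "e x = e y"
    then have "g x = g y" using gE[of x] gE[of y] by simp
    then show "x = y" using inj_onD[OF injg] xy EvT by blast
  qed
  have nbq: "e ` nb u = nbV (q u)" if u: "u \<in> Od" for u
  proof (rule card_subset_eq)
    show "e ` nb u \<subseteq> nbV (q u)" using edge(1)[OF u] by blast
    have "q u \<in> U" using qS[OF u] S by blast
    then show "card (e ` nb u) = card (nbV (q u))"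
      using inj_on_subset[OF inje nb_Od[OF u]] card_nb[OF u] card_nbV by (simp add: card_image)
  qed simp
  have "(e, q) \<in> embs rt nb us"
    unfolding embs_def even_part_us us(2) using e q inje nbq by blast
  moreover have "q ` Od = S \<inter> WU (e ` I)"
  proof
    show "q ` Od \<subseteq> S \<inter> WU (e ` I)"
    proof
      fix c assume "c \<in> q ` Od"
      then obtain u where u: "u \<in> Od" "c = q u" by blast
      obtain p where p: "p \<in> I" "p \<in> nb u" using Od_parent[OF u(1)] by blast
      then have "q u \<in> nbU (e p)" using edge(1)[OF u(1)] mem_nb by blast
      then show "c \<in> S \<inter> WU (e ` I)" using u p qS by (auto simp: WU_def)
    qed
    show "S \<inter> WU (e ` I) \<subseteq> q ` Od"
    proof
      fix c assume c: "c \<in> S \<inter> WU (e ` I)"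
      then obtain x where x: "x \<in> I" "c \<in> nbU (e x)" by (auto simp: WU_def)
      then have xE: "x \<in> Ev" "ht x < r" by (auto simp: inner_even_def)
      obtain xs where xs: "walk_of TE xs" "hd xs = rt" "last xs = x" "length xs = Suc (ht x)"
        using ht_walk[of x] xE EvT by blast
      have ne: "xs \<noteq> []" using walk_of_nonempty[OF xs(1)] .
      have "walk_of (adj S) (map g xs)" by (rule walk_map[OF xs(1)]) (rule TEadj)
      moreover have "adj S (last (map g xs)) (Inr c)"
        using xs(3) ne gE[OF xE(1)] c x(2) mem_nb by (simp add: last_map)
      ultimately have "walk_of (adj S) (map g xs @ [Inr c])" by (simp add: walk_of_snoc)
      moreover have "hd (map g xs @ [Inr c]) = Inl v" using xs(2) ne grt by (simp add: hd_map hd_append)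
      ultimately have "Inr c \<in> sball S v"
        unfolding ball_set_def using xs(4) xE(2) by (intro CollectI exI[of _ "map g xs @ [Inr c]"]) simp
      then obtain t where t: "t \<in> Tv" "g t = Inr c" using bij unfolding bij_betw_def by (metis imageE)
      then have "t \<in> Od" using gE Ev_Od(1) by (metis Inl_Inr_False UnE)
      then show "c \<in> q ` Od" using gO t(2) by auto
    qed
  qed
  ultimately have "(e, q) \<in> T.exact S" unfolding T.exact_def us(2) by blast
  then show ?thesis using ert glue by blast
qed

lemma card_exact_root:
  assumes v: "v \<in> V" and S: "S \<subseteq> U"
  shows "card {(e, q) \<in> T.exact S. e rt = v} = card (isos S v)"
proof (rule bij_betw_same_card[of "\<lambda>(e, q). restrict (glue e q) Tv"], unfold bij_betw_def, intro conjI)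
  show "inj_on (\<lambda>(e, q). restrict (glue e q) Tv) {(e, q) \<in> T.exact S. e rt = v}"
  proof (rule inj_onI)
    fix x y assume x: "x \<in> {(e, q) \<in> T.exact S. e rt = v}" and y: "y \<in> {(e, q) \<in> T.exact S. e rt = v}"
      and eq: "(\<lambda>(e, q). restrict (glue e q) Tv) x = (\<lambda>(e, q). restrict (glue e q) Tv) y"
    obtain e q where xe: "x = (e, q)" by (metis surj_pair)
    obtain e' q' where ye: "y = (e', q')" by (metis surj_pair)
    have em: "(e, q) \<in> embs rt nb us" "(e', q') \<in> embs rt nb us"
      using x y unfolding xe ye by (auto simp: T.exact_def)
    have "restrict (glue e q) Tv = restrict (glue e' q') Tv" using eq unfolding xe ye by simp
    then have gl: "glue e q t = glue e' q' t" if "t \<in> Tv" for t using that by (metis restrict_apply')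
    have "e t = e' t" if "t \<in> Ev" for t using gl[of t] that Ev_Od(1) by (auto simp: glue_def)
    moreover have "q t = q' t" if "t \<in> Od" for t
    proof -
      have "t \<in> Tv" "t \<notin> Ev" using that Ev_Od by blast+
      then show ?thesis using gl[of t] by (simp add: glue_def)
    qed
    moreover have "e \<in> extensional Ev" "e' \<in> extensional Ev" "q \<in> extensional Od" "q' \<in> extensional Od"
      using emb_Ev(1,2)[OF em(1)] emb_Ev(1,2)[OF em(2)] by (simp_all add: PiE_iff)
    ultimately show "x = y" unfolding xe ye by (metis extensionalityI)
  qed
  show "(\<lambda>(e, q). restrict (glue e q) Tv) ` {(e, q) \<in> T.exact S. e rt = v} = isos S v"
    using exact_glue[OF _ S] isos_exact[OF _ v S] by (fastforce simp: image_iff)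
qed

lemma root_in_ball: "Inl v \<in> sball S v"
  unfolding ball_set_def by (intro CollectI exI[of _ "[Inl v]"]) (simp add: walk_of_Cons)

lemma ball_iso_iff: "ball_iso E S v r Tv TE rt \<longleftrightarrow> isos S v \<noteq> {}"
proof
  assume "ball_iso E S v r Tv TE rt"
  then obtain f where f: "bij_betw f (sball S v) Tv" "f (Inl v) = rt"
    "\<And>x y. x \<in> sball S v \<Longrightarrow> y \<in> sball S v \<Longrightarrow> adj S x y \<longleftrightarrow> TE (f x) (f y)"
    unfolding ball_iso_def rooted_iso_def by blast
  let ?g = "inv_into (sball S v) f"
  have g: "bij_betw ?g Tv (sball S v)" by (rule bij_betw_inv_into[OF f(1)])
  have fg: "f (?g t) = t" "?g t \<in> sball S v" if "t \<in> Tv" for t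
    using f(1) that by (auto simp: bij_betw_def f_inv_into_f inv_into_into)
  have "bij_betw (restrict ?g Tv) Tv (sball S v)" using g by (subst bij_betw_cong[of _ _ ?g]) auto
  moreover have "?g rt = Inl v"
    using inv_into_f_f[OF bij_betw_imp_inj_on[OF f(1)] root_in_ball[of v S]] f(2) by simp
  moreover have "TE x y \<longleftrightarrow> adj S (?g x) (?g y)" if "x \<in> Tv" "y \<in> Tv" for x y
    using f(3)[OF fg(2)[OF that(1)] fg(2)[OF that(2)]] fg(1) that by simp
  ultimately have "restrict ?g Tv \<in> isos S v" using rtT by (simp add: isos_def)
  then show "isos S v \<noteq> {}" by blast
next
  assume "isos S v \<noteq> {}"
  then obtain g where g: "bij_betw g Tv (sball S v)" "g rt = Inl v"
    "\<And>x y. x \<in> Tv \<Longrightarrow> y \<in> Tv \<Longrightarrow> TE x y \<longleftrightarrow> adj S (g x) (g y)"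
    unfolding isos_def by blast
  let ?f = "inv_into Tv g"
  have f: "bij_betw ?f (sball S v) Tv" by (rule bij_betw_inv_into[OF g(1)])
  have gf: "g (?f t) = t" "?f t \<in> Tv" if "t \<in> sball S v" for t
    using g(1) that by (auto simp: bij_betw_def f_inv_into_f inv_into_into)
  have "?f (Inl v) = rt" using inv_into_f_f[OF bij_betw_imp_inj_on[OF g(1)] rtT] g(2) by simp
  moreover have "adj S x y \<longleftrightarrow> TE (?f x) (?f y)" if "x \<in> sball S v" "y \<in> sball S v" for x y
    using g(3)[OF gf(2)[OF that(1)] gf(2)[OF that(2)]] gf(1) that by simp
  ultimately show "ball_iso E S v r Tv TE rt"
    unfolding ball_iso_def rooted_iso_def using f by (intro exI[of _ ?f]) blast
qed

text \<open>Composition with one fixed isomorphism \<open>g0\<close> identifies the automorphisms of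
  the tree with all isomorphisms.\<close>

lemma card_isos:
  assumes g0: "g0 \<in> isos S v"
  shows "card (isos S v) = card (root_auts Tv TE rt)"
proof -
  have bij: "bij_betw g0 Tv (sball S v)" and grt: "g0 rt = Inl v"
    and gadj: "\<And>x y. x \<in> Tv \<Longrightarrow> y \<in> Tv \<Longrightarrow> TE x y \<longleftrightarrow> adj S (g0 x) (g0 y)"
    using g0 unfolding isos_def by blast+
  have inj: "inj_on g0 Tv" using bij by (rule bij_betw_imp_inj_on)
  have "bij_betw (\<lambda>f. restrict (g0 \<circ> f) Tv) (root_auts Tv TE rt) (isos S v)"
    unfolding bij_betw_def
  proof (intro conjI equalityI subsetI)
    show "inj_on (\<lambda>f. restrict (g0 \<circ> f) Tv) (root_auts Tv TE rt)"
    proof (rule inj_onI, rule ext)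
      fix f f' x assume f: "f \<in> root_auts Tv TE rt" and f': "f' \<in> root_auts Tv TE rt"
        and eq: "restrict (g0 \<circ> f) Tv = restrict (g0 \<circ> f') Tv"
      show "f x = f' x"
      proof (cases "x \<in> Tv")
        case True
        then have "g0 (f x) = g0 (f' x)" using fun_cong[OF eq, of x] by simp
        moreover have "f x \<in> Tv" "f' x \<in> Tv" using f f' True by (auto simp: root_auts_def bij_betw_def)
        ultimately show ?thesis using inj by (auto dest: inj_onD)
      next
        case False
        then show ?thesis using f f' by (simp add: root_auts_def)
      qed
    qed
  next
    fix g assume "g \<in> (\<lambda>f. restrict (g0 \<circ> f) Tv) ` root_auts Tv TE rt"
    then obtain f where f: "bij_betw f Tv Tv" "f rt = rt"
      "\<And>x y. x \<in> Tv \<Longrightarrow> y \<in> Tv \<Longrightarrow> TE x y \<longleftrightarrow> TE (f x) (f y)" and g: "g = restrict (g0 \<circ> f) Tv"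
      by (auto simp: root_auts_def)
    have "bij_betw g Tv (sball S v)"
      unfolding g using bij_betw_trans[OF f(1) bij] by (subst bij_betw_cong[of _ _ "g0 \<circ> f"]) auto
    moreover have "TE x y \<longleftrightarrow> adj S (g x) (g y)" if xy: "x \<in> Tv" "y \<in> Tv" for x y
    proof -
      have "f x \<in> Tv" "f y \<in> Tv" using f(1) xy by (auto simp: bij_betw_def)
      then have "TE (f x) (f y) \<longleftrightarrow> adj S (g0 (f x)) (g0 (f y))" by (rule gadj)
      then show ?thesis using f(3)[OF xy] xy by (simp add: g)
    qed
    moreover have "g rt = Inl v" using f(2) grt rtT by (simp add: g)
    moreover have "g \<in> extensional Tv" by (simp add: g)
    ultimately show "g \<in> isos S v" unfolding isos_def by blast
  next
    fix g assume "g \<in> isos S v"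
    then have gext: "g \<in> extensional Tv" and gbij: "bij_betw g Tv (sball S v)" and gr: "g rt = Inl v"
      and ga: "\<And>x y. x \<in> Tv \<Longrightarrow> y \<in> Tv \<Longrightarrow> TE x y \<longleftrightarrow> adj S (g x) (g y)"
      unfolding isos_def by blast+
    let ?i = "inv_into Tv g0"
    define f where "f x = (if x \<in> Tv then ?i (g x) else x)" for x
    have gx: "g x \<in> sball S v" if "x \<in> Tv" for x using gbij that by (auto simp: bij_betw_def)
    have i: "g0 (?i y) = y" "?i y \<in> Tv" if "y \<in> sball S v" for y
      using bij that by (auto simp: bij_betw_def f_inv_into_f inv_into_into)
    have "bij_betw f Tv Tv"
      using bij_betw_trans[OF gbij bij_betw_inv_into[OF bij]]
      by (subst bij_betw_cong[of _ _ "?i \<circ> g"]) (auto simp: f_def)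
    moreover have "f rt = rt" using rtT gr grt inv_into_f_f[OF inj rtT] by (simp add: f_def)
    moreover have "TE x y \<longleftrightarrow> TE (f x) (f y)" if "x \<in> Tv" "y \<in> Tv" for x y
      using ga[OF that] gadj[of "f x" "f y"] i gx that by (simp add: f_def)
    ultimately have "f \<in> root_auts Tv TE rt" by (auto simp: root_auts_def f_def)
    moreover have "g = restrict (g0 \<circ> f) Tv"
      by (rule extensionalityI[OF gext]) (use i gx in \<open>auto simp: f_def\<close>)
    ultimately show "g \<in> (\<lambda>f. restrict (g0 \<circ> f) Tv) ` root_auts Tv TE rt" by blast
  qed
  then show ?thesis by (rule bij_betw_same_card[symmetric])
qed

lemma card_root_auts_pos: "card (root_auts Tv TE rt) > 0"
proof -
  have "id \<in> root_auts Tv TE rt" by (simp add: root_auts_def)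
  moreover have "finite (root_auts Tv TE rt)"
  proof (rule inj_on_finite[of "\<lambda>f. restrict f Tv"])
    show "inj_on (\<lambda>f. restrict f Tv) (root_auts Tv TE rt)"
    proof (rule inj_onI, rule ext)
      fix f g x assume "f \<in> root_auts Tv TE rt" "g \<in> root_auts Tv TE rt" "restrict f Tv = restrict g Tv"
      then show "f x = g x" by (cases "x \<in> Tv") (auto simp: root_auts_def fun_eq_iff restrict_def split: if_splits)
    qed
    show "(\<lambda>f. restrict f Tv) ` root_auts Tv TE rt \<subseteq> Tv \<rightarrow>\<^sub>E Tv" by (auto simp: root_auts_def bij_betw_def)
    show "finite (Tv \<rightarrow>\<^sub>E Tv)" using finT by (simp add: finite_PiE)
  qed
  ultimately show ?thesis by (auto simp: card_gt_0_iff)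
qed

lemma ball_prob_eq: "ball_prob V U E B r Tv TE rt = T.mean_exact / card (root_auts Tv TE rt)"
proof -
  let ?A = "card (root_auts Tv TE rt)"
  have "card (T.exact S) = ?A * card {v \<in> V. ball_iso E S v r Tv TE rt}" if S: "S \<in> Pow U" for S
  proof -
    have fin: "finite (T.exact S)" by (rule finite_subset[OF _ T.finite_Emb]) (auto simp: T.exact_def)
    have "T.exact S = (\<Union>v\<in>V. {(e, q) \<in> T.exact S. e rt = v})"
      using emb_Ev(1) rt_Ev by (fastforce simp: T.exact_def)
    then have "card (T.exact S) = card (\<Union>v\<in>V. {(e, q) \<in> T.exact S. e rt = v})" by simp
    also have "\<dots> = (\<Sum>v\<in>V. card {(e, q) \<in> T.exact S. e rt = v})"
      using finV fin by (intro card_UN_disjoint) (auto intro: finite_subset[of _ "T.exact S"])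
    also have "\<dots> = (\<Sum>v\<in>V. if ball_iso E S v r Tv TE rt then ?A else 0)"
    proof (intro sum.cong refl)
      fix v assume "v \<in> V"
      then have "card {(e, q) \<in> T.exact S. e rt = v} = card (isos S v)" using S by (intro card_exact_root) auto
      then show "card {(e, q) \<in> T.exact S. e rt = v} = (if ball_iso E S v r Tv TE rt then ?A else 0)"
        unfolding ball_iso_iff using card_isos by (cases "isos S v = {}") auto
    qed
    also have "\<dots> = ?A * card {v \<in> V. ball_iso E S v r Tv TE rt}"
      using finV by (simp add: sum.If_cases Int_def)
    finally show ?thesis .
  qed
  then have "T.mean_exact = (\<Sum>S\<in>Pow U. det_measure V U B S * real (?A * card {v \<in> V. ball_iso E S v r Tv TE rt})) / n"
    unfolding T.mean_exact_def by simp
  also have "\<dots> = ?A * ball_prob V U E B r Tv TE rt"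
    unfolding ball_prob_def cardV by (simp add: sum_distrib_left sum_divide_distrib mult_ac)
  finally show ?thesis using card_root_auts_pos by simp
qed

text \<open>The errors are regrouped by the parameter that makes them small, namely
  \<open>\<theta>\<close>, \<open>J\<close> and \<open>d\<close>, in the shape expected by
  \<open>nested_limit\<close>.\<close>

lemma ball_prob_error:
  assumes \<theta>: "\<theta> > 0"
  shows "\<bar>ball_prob V U E B r Tv TE rt - T.partial_limit J / card (root_auts Tv TE rt)\<bar>
    \<le> (T.err_exact + (\<Sum>j\<le>J. T.err_bad j / fact j)) / \<theta> + fact k ^ length us * T.tree_limit J / fact J
      + (\<Sum>j\<le>J. (T.err_det j \<theta> / sqrt d + T.err_count j / d) / fact j)"
proof -
  let ?A = "real (card (root_auts Tv TE rt))"
  have A: "?A \<ge> 1" using card_root_auts_pos by simp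
  have shrink: "\<bar>x / ?A - y / ?A\<bar> \<le> \<bar>x - y\<bar>" for x y :: real
  proof -
    have "\<bar>x / ?A - y / ?A\<bar> = \<bar>x - y\<bar> / ?A" by (simp flip: diff_divide_distrib)
    also have "\<dots> \<le> \<bar>x - y\<bar> / 1" using A by (intro divide_left_mono) auto
    finally show ?thesis by simp
  qed
  have total: "(\<Sum>j\<le>J. T.err_total j \<theta> / fact j)
     = (\<Sum>j\<le>J. T.err_bad j / fact j) / \<theta> + (\<Sum>j\<le>J. (T.err_det j \<theta> / sqrt d + T.err_count j / d) / fact j)"
    by (simp add: T.err_total_def sum.distrib sum_divide_distrib add_divide_distrib mult_ac)
  have arrange: "e / \<theta> + t + (b / \<theta> + c) = (e + b) / \<theta> + t + c" for e t b c :: real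
    by (simp add: add_divide_distrib)
  show ?thesis
    unfolding ball_prob_eq arrange[symmetric] total[symmetric]
    by (rule order_trans[OF shrink T.mean_exact_error[OF \<theta>]])
qed

lemma partial_limit_tendsto:
  "(\<lambda>J. T.partial_limit J / card (root_auts Tv TE rt)) \<longlonglongrightarrow>
     exp (- real k * real (card I)) * fact k ^ card Od * real (num_matchings I Tv TE rt)
       / real (card (root_auts Tv TE rt))"
    and tail_tendsto: "(\<lambda>J. fact k ^ length us * T.tree_limit J / fact J) \<longlonglongrightarrow> 0"
proof -
  have num: "num_matchings I Tv TE rt = card {f \<in> T.tree_sat. I \<subseteq> f ` set us}"
    unfolding num_matchings_eq T.tree_sat_def us(2) by (rule arg_cong[of _ _ card]) auto
  note sums = T.tree_limit_sums
  from tendsto_divide[OF sums[unfolded sums_def] tendsto_const[of "real (card (root_auts Tv TE rt))"]]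
  show "(\<lambda>J. T.partial_limit J / card (root_auts Tv TE rt)) \<longlonglongrightarrow>
     exp (- real k * real (card I)) * fact k ^ card Od * real (num_matchings I Tv TE rt)
       / real (card (root_auts Tv TE rt))"
    using card_root_auts_pos by (simp add: num length_us)
  have "(\<lambda>j. (-1) ^ j * (fact k ^ length us * T.tree_limit j / fact j)) \<longlonglongrightarrow> 0"
    using sums_summable[OF sums] by (rule summable_LIMSEQ_zero)
  from tendsto_rabs[OF this]
  have "(\<lambda>j. \<bar>fact k ^ length us * T.tree_limit j / fact j\<bar>) \<longlonglongrightarrow> 0"
    by (simp add: abs_mult)
  then show "(\<lambda>J. fact k ^ length us * T.tree_limit J / fact J) \<longlonglongrightarrow> 0"
    by (rule tendsto_rabs_zero_cancel)
qed

end

theorem theorem1p2: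
  fixes k :: nat and d :: "nat \<Rightarrow> nat"
    and V :: "nat \<Rightarrow> 'a set" and U :: "nat \<Rightarrow> 'b set"
    and E :: "nat \<Rightarrow> ('a \<times> 'b) set" and B :: "nat \<Rightarrow> 'a \<Rightarrow> 'b \<Rightarrow> real"
    and Tv :: "'t set" and TE :: "'t \<Rightarrow> 't \<Rightarrow> bool" and rt :: 't and r :: nat
  assumes "k \<ge> 1"
    and "\<forall>n. d n > 0"
    and "filterlim d at_top sequentially"
    and "eventually (\<lambda>n. setup_graph k (d n) n (V n) (U n) (E n) (B n)) sequentially"
    and "finite_rooted_tree Tv TE rt"
    and "valid_tree k Tv TE rt"
    and "tree_height Tv TE rt = r"
  shows "(\<lambda>n. ball_prob (V n) (U n) (E n) (B n) r Tv TE rt)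
     \<longlonglongrightarrow> exp (- real k * real (card (inner_even Tv TE rt)))
          * (fact k) ^ card (odd_vertices Tv TE rt)
          * real (num_matchings (inner_even Tv TE rt) Tv TE rt)
          / real (card (root_auts Tv TE rt))"
proof -
  \<comment> \<open>Outside their locales these constants take only \<open>k\<close> and data of the
    tree as arguments, so they agree for all \<open>n\<close> although each \<open>n\<close> has its
    own graph.\<close>
  let ?nb = "valid_rooted_tree.nb Tv TE" and ?us = "valid_rooted_tree.us Tv TE rt" and ?I = "inner_even Tv TE rt"
  let ?det = "embedded_tree.err_det k rt ?nb ?us" and ?bad = "embedded_tree.err_bad k rt ?nb ?us"
    and ?count = "embedded_tree.err_count k ?nb ?us ?I"
    and ?lim = "embedded_tree.tree_limit k ?nb ?us ?I"
  let ?s = "\<lambda>J. (\<Sum>j<J. (-1) ^ j * (fact k ^ length ?us * ?lim j / fact j)) / real (card (root_auts Tv TE rt))"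
  let ?E = "\<lambda>J \<theta> n. \<Sum>j\<le>J. (?det j \<theta> / sqrt (d n) + ?count j / d n) / fact j"
  have "\<forall>\<^sub>F n in sequentially. n > 0 \<and> setup_graph k (d n) n (V n) (U n) (E n) (B n)"
    using assms(4) eventually_gt_at_top[of 0] by eventually_elim simp
  then have tg: "\<forall>\<^sub>F n in sequentially. tree_graph k (d n) n (V n) (U n) (E n) (B n) Tv TE rt"
  proof eventually_elim
    case (elim n)
    then show ?case using assms(1,2,5,6) by unfold_locales auto
  qed
  \<comment> \<open>Any single \<open>m\<close> will do: the two limits in \<open>J\<close> taken
    from this interpretation involve only \<open>k\<close> and the tree.\<close>
  then obtain m where "tree_graph k (d m) m (V m) (U m) (E m) (B m) Tv TE rt"
    by (auto simp: eventually_sequentially)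
  then interpret G: tree_graph k "d m" m "V m" "U m" "E m" "B m" Tv TE rt .
  have d: "filterlim (\<lambda>n. real (d n)) at_top sequentially"
    using filterlim_compose[OF filterlim_real_sequentially assms(3)] .
  have sd: "filterlim (\<lambda>n. sqrt (d n)) at_top sequentially"
    using filterlim_compose[OF sqrt_at_top d] .
  have E: "?E J \<theta> \<longlonglongrightarrow> 0" for J \<theta>
  proof (rule tendsto_null_sum)
    fix j
    have "(\<lambda>n. ?det j \<theta> / sqrt (d n) + ?count j / d n) \<longlonglongrightarrow> 0 + 0"
      by (intro tendsto_add tendsto_divide_0[OF tendsto_const] filterlim_at_top_imp_at_infinity d sd)
    then show "(\<lambda>n. (?det j \<theta> / sqrt (d n) + ?count j / d n) / fact j) \<longlonglongrightarrow> 0"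
      by (intro tendsto_divide_zero) simp
  qed
  show ?thesis
  proof (rule nested_limit[where s = ?s and b = "\<lambda>J. fact k ^ length ?us * ?lim J / fact J" and E = ?E
        and A = "\<lambda>J. embedded_tree.err_exact k rt ?nb ?us + (\<Sum>j\<le>J. ?bad j / fact j)"])
    show "?s \<longlonglongrightarrow> exp (- real k * real (card ?I)) * (fact k) ^ card (odd_vertices Tv TE rt)
          * real (num_matchings ?I Tv TE rt) / real (card (root_auts Tv TE rt))"
      by (rule G.partial_limit_tendsto)
    show "(\<lambda>J. fact k ^ length ?us * ?lim J / fact J) \<longlonglongrightarrow> 0" by (rule G.tail_tendsto)
    show "\<forall>\<^sub>F n in sequentially. \<forall>J \<theta>. \<theta> > 0 \<longrightarrow>
        \<bar>ball_prob (V n) (U n) (E n) (B n) r Tv TE rt - ?s J\<bar>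
        \<le> (embedded_tree.err_exact k rt ?nb ?us + (\<Sum>j\<le>J. ?bad j / fact j)) / \<theta>
          + fact k ^ length ?us * ?lim J / fact J + ?E J \<theta> n"
      using tg
    proof eventually_elim
      case (elim n)
      then interpret H: tree_graph k "d n" n "V n" "U n" "E n" "B n" Tv TE rt .
      show ?case using H.ball_prob_error unfolding assms(7) by blast
    qed
  qed (rule E)
qed

end
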